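(* Let $K$ be a field, let $H$ be a numerical semigroup, and let $K[[H]]$ be its numerical semigroup ring. Assume that $K[[H]]$ has type $4$. Then $K[[H]]$ is far-flung Gorenstein if and only if $H$ belongs to one of the following 40 families of numerical semigroups (where $m$ and $x$ denote integers subject to the stated conditions): 1. $\langle 5,5m+1,5m+5x-3,5m+5x-2,5m+5x-1\rangle$, $1\leq x\leq m$; 2. $\langle 5,5m+4,5m+5x+1,5m+5x+2,5m+5x+3\rangle$, $1\leq x\leq m$; 3. $\langle 5,5m+2,5m+5x+1,5m+5x+3,5m+5x+4\rangle$, $1\leq x\leq m-1$; 4. $\langle 5,5m+3,5m+5x-1,5m+5x+1,5m+5x+2\rangle$, $1\leq x\leq m$; 5. $\langle 6,6m+5,12m+7,12m+8,12m+9\rangle$, $m\geq 1$; 6. $\langle 6,6m+1,12m+3,12m+4,12m+5\rangle$, $m\geq 1$; 7. $\langle 6,6m+2,12m+1,12m+3,12m+5\rangle$, $m\geq 1$; 8. $\langle 6,6m+4,12m+5,12m+7,12m+9\rangle$, $m\geq 1$; 9. $\langle 6,6m+5,12m+13,12m+14,12m+15\rangle$, $m\geq 1$; 10. $\langle 6,6m+1,12m-1,12m+3,12m+4\rangle$, $m\geq 1$; 11. $\langle 6,6m+4,12m+3,12m+5,12m+7\rangle$, $m\geq 1$; 12. $\langle 6,6m+2,12m-1,12m+1,12m+3\rangle$, $m\geq 1$; 13. $\langle 7,7m+5,7x+6,7m+7x+8,7m+7x+9,7m+7x+10\rangle$, $m,x\geq 1$ and $\frac{m-1}{2}\leq x\leq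 m$; 14. $\langle 7,7m+1,7x+2,7m+7x+4,7m+7x+5,7m+7x+6\rangle$, $1\leq m\leq x\leq 2m$; 15. $\langle 7,7m+1,7m+3,14m+5\rangle$, $m\geq 1$; 16. $\langle 7,7m+4,7m+5,14m+6\rangle$, $m\geq 1$; 17. $\langle 7,7m+2,7m+3,14m+1\rangle$, $m\geq 1$; 18. $\langle 7,7m+4,7x+6,7m+7x+5,7m+7x+8,7m+7x+9\rangle$, $m,x\geq 1$ and $m-1\leq x\leq m$; 19. $\langle 7,7m+3,7x+6,7m+7x+8,7m+7x+11,7m+7x+12\rangle$, $1\leq m\leq x\leq 2m$; 20. $\langle 7,7m+1,7x+4,7m+7x+2,7m+7x+3,7m+7x+6\rangle$, $m,x\geq 1$ and $\frac{m-1}{2}\leq x\leq m$; 21. $\langle 7,7m+3,7m+4,14m+5,14m+9\rangle$, $m\geq 1$; 22. $\langle 7,7m+2,7x+4,7m+7x+1,7m+7x+3,7m+7x+5\rangle$, $m,x\geq 1$ and $m-1\leq x\leq 2m$; 23. $\langle 7,7m+3,7x+5,7m+7x+4,7m+7x+6,7m+7x+9\rangle$, $m,x\geq 1$ and $\frac{m-1}{2}\leq x\leq m$; 24. $\langle 8,8m+1,8m+3,8x+4,8m+8x+2,8m+8x+6\rangle$, $1\leq x\leq m$; 25. $\langle 8,8m+4,8x+5,8x+7,8m+8x+6,8m+8x+10\rangle$, $1\leq m\leq x$; 26. $\langle 8,8m+3,8x+6,8x+7,8m+8x+12,8m+8x+13\rangle$, $1\leq m\leq x\leq 2m$; 27.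 $\langle 8,8m+3,8m+6,8x+7,8m+8x+9,8m+8x+12\rangle$, $m,x\geq 1$ and $\frac{m-1}{2}\leq x\leq m-1$; 28. $\langle 8,8m-1,8m+1,8x+4,8m+8x+2,8m+8x+6\rangle$, $1\leq x\leq m-1$; 29. $\langle 8,8m+1,8x+2,8x+5,8m+8x+4,8m+8x+7\rangle$, $1\leq m\leq x\leq 2m$; 30. $\langle 8,8m+1,8m+2,8x+5,8m+8x+3,8m+8x+4\rangle$, $m,x\geq 1$ and $\frac{m-1}{2}\leq x\leq m-1$; 31. $\langle 8,8m+3,8x+4,8m+5,8m+8x+6,8m+8x+10\rangle$, $1\leq x\leq m$; 32. $\langle 9,9m+3,9m+6,9x+7,9x+8\rangle$, $1\leq m\leq x$; 33. $\langle 9,9m+3,9m+6,9x+7,18x-9m+8,18x+10,18x+13\rangle$, $m\geq 3$ and $\frac{2m-1}{3}\leq x\leq m-1$; 34. $\langle 9,9m+1,18m-9x-5,18m-9x-2,9x+8,18m+5\rangle$, $m,x\geq 1$ and $\frac{2m-2}{3}\leq x\leq m-1$; 35. $\langle 9,9m-2,9m-1,9m+1,9x+4,9m+9x+6\rangle$, $m,x\geq 1$ and $\frac{m-1}{2}\leq x\leq m-1$; 36. $\langle 9,9m+1,18x-9m+11,18x-9m+14,9x+8,18x+13\rangle$, $1\leq m\leq x\leq \frac{3m-1}{2}$; 37. $\langle 9,9m-1,9m+1,9m+2,9x+5,9m+9x+3\rangle$, $m,x\geq 1$ and $\frac{m-1}{2}\leq x\leq m-1$; 38. $\langle 9,9m+1,9x+2,18x-9m+3,18x-9m+6,18x+5,18x+8\rangle$,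 $1\leq m\leq x\leq 2m$; 39. $\langle 9,9x+3,9x+6,9m+1,9m+2\rangle$, $1\leq x\leq m-1$; 40. $\langle 9,9m+3,9x+4,9x+5,9m+6\rangle$, $1\leq m\leq x$.
   Context: A numerical semigroup $H$ is a submonoid of $(\mathbb N,+)$ (with $0\in\mathbb N$) such that $\mathbb N\setminus H$ is finite. $\langle a_1,\dots,a_k\rangle$ denotes the submonoid of $\mathbb N$ generated by $a_1,\dots,a_k$ (the listed generators need not be minimal). For a field $K$, the numerical semigroup ring of $H$ is the subring $K[[H]]:=K[[t^h : h\in H]]$ of the power series ring $K[[t]]$; it is a one-dimensional Cohen-Macaulay local domain with integral closure $K[[t]]$. The type of $K[[H]]$ is its Cohen-Macaulay type. It equals the type $r(H)$ of $H$, i.e. the cardinality of the set of pseudo-Frobenius numbers $PF(H):=\{x\in\mathbb Z\setminus H : x+h\in H \text{ for all } h\in H\setminus\{0\}\}$. For a ring $R$ and an $R$-module $M$, the trace ideal of $M$ is $\mathrm{tr}(M):=\sum_{\varphi\in \mathrm{Hom}_R(M,R)}\mathrm{Im}(\varphi)$. A one-dimensional Cohen-Macaulay local ring $R$ with a canonical module $\omega_R$ is called far-flung Gorenstein if $\mathrm{tr}(\omega_R)=R:\overline{R}$, where $\overline{R}$ is the integral closure of $R$ in its total ring of fractions $Q(R)$ and the colon $R:\overline R=\{q\in Q(R): q\overline R\subseteq R\}$ is taken in $Q(R)$. *)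

theory Defs
  imports "HOL-Computational_Algebra.Computational_Algebra"
begin

definition add_submonoid :: "'a::monoid_add set \<Rightarrow> bool" where
  "add_submonoid S \<longleftrightarrow> 0 \<in> S \<and> (\<forall>a\<in>S. \<forall>b\<in>S. a + b \<in> S)"

definition submonoid_gen :: "'a::monoid_add set \<Rightarrow> 'a set" where
  "submonoid_gen A = add_submonoid hull A"

definition numerical_semigroup :: "nat set \<Rightarrow> bool" where
  "numerical_semigroup H \<longleftrightarrow> add_submonoid H \<and> finite (- H)"

text \<open>
  Throughout, \<open>R\<close> is meant to be a subring of the field given by the ambient type, so that the
  total ring of fractions of the domain \<open>R\<close> is realised inside that type. It may be a proper
  subset of the type; colons and the integral closure are taken in \<open>total_fractions R\<close>.
\<close>

definition total_fractions :: "'a::field set \<Rightarrow> 'a set" where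
  "total_fractions R = {a / b | a b. a \<in> R \<and> b \<in> R \<and> b \<noteq> 0}"

definition int_closure :: "'a::field set \<Rightarrow> 'a set" where
  "int_closure R = {q \<in> total_fractions R.
     \<exists>p. lead_coeff p = 1 \<and> (\<forall>i. coeff p i \<in> R) \<and> poly p q = 0}"

definition colon :: "'a::field set \<Rightarrow> 'a set \<Rightarrow> 'a set \<Rightarrow> 'a set" where
  "colon R I J = {q \<in> total_fractions R. \<forall>x\<in>J. q * x \<in> I}"

definition is_submodule :: "'a::field set \<Rightarrow> 'a set \<Rightarrow> bool" where
  "is_submodule R M \<longleftrightarrow>
     0 \<in> M \<and> (\<forall>x\<in>M. \<forall>y\<in>M. x + y \<in> M) \<and> (\<forall>r\<in>R. \<forall>x\<in>M. r * x \<in> M)"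

definition module_homs :: "'a::field set \<Rightarrow> 'a set \<Rightarrow> 'a set \<Rightarrow> ('a \<Rightarrow> 'a) set" where
  "module_homs R M N = {\<phi>. \<phi> ` M \<subseteq> N \<and>
     (\<forall>x\<in>M. \<forall>y\<in>M. \<phi> (x + y) = \<phi> x + \<phi> y) \<and> (\<forall>r\<in>R. \<forall>x\<in>M. \<phi> (r * x) = r * \<phi> x)}"

definition trace_ideal :: "'a::field set \<Rightarrow> 'a set \<Rightarrow> 'a set" where
  "trace_ideal R M = is_submodule R hull (\<Union>\<phi>\<in>module_homs R M R. \<phi> ` M)"

text \<open>
  For Noetherian \<open>R\<close> (such as \<open>K[[H]]\<close>), having a common denominator is the same as being
  finitely generated.
\<close>

definition fractional_ideal :: "'a::field set \<Rightarrow> 'a set \<Rightarrow> bool" where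
  "fractional_ideal R I \<longleftrightarrow> is_submodule R I \<and> I \<subseteq> total_fractions R \<and> I \<noteq> {0} \<and>
     (\<exists>d\<in>R. d \<noteq> 0 \<and> (\<forall>x\<in>I. d * x \<in> R))"

text \<open>
  Canonical modules of a one-dimensional Cohen-Macaulay local domain, realised as fractional
  ideals as in Herzog and Kunz, Der kanonische Modul eines Cohen-Macaulay-Rings: \<open>\<omega>\<close> is canonical
  iff \<open>\<omega> : (\<omega> : I) = I\<close> for all fractional ideals \<open>I\<close>. Every canonical module of such a domain is
  isomorphic to one of these, they are all isomorphic to each other, and the trace ideal depends
  only on the isomorphism class.
\<close>

definition canonical_ideal :: "'a::field set \<Rightarrow> 'a set \<Rightarrow> bool" where
  "canonical_ideal R \<omega> \<longleftrightarrow> fractional_ideal R \<omega> \<and>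
     (\<forall>I. fractional_ideal R I \<longrightarrow> colon R \<omega> (colon R \<omega> I) = I)"

text \<open>To be used for one-dimensional Cohen-Macaulay local domains \<open>R\<close> only.\<close>

definition far_flung_gorenstein :: "'a::field set \<Rightarrow> bool" where
  "far_flung_gorenstein R \<longleftrightarrow>
     (\<exists>\<omega>. canonical_ideal R \<omega> \<and> trace_ideal R \<omega> = colon R R (int_closure R))"

text \<open>The maximal ideal, when \<open>R\<close> is local.\<close>

definition nonunits :: "'a::field set \<Rightarrow> 'a set" where
  "nonunits R = {x \<in> R. \<forall>y\<in>R. x * y \<noteq> 1}"

text \<open>
  For \<open>R\<close>-modules \<open>M \<subseteq> N\<close> with \<open>\<mm> N \<subseteq> M\<close>, where \<open>\<mm> = nonunits R\<close>, this says that the vector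
  space \<open>N/M\<close> over the residue field \<open>R/\<mm>\<close> has dimension \<open>n\<close>: the classes of the elements
  of \<open>B\<close> form a basis.
\<close>

definition has_residue_dim :: "'a::field set \<Rightarrow> 'a set \<Rightarrow> 'a set \<Rightarrow> nat \<Rightarrow> bool" where
  "has_residue_dim R N M n \<longleftrightarrow> (\<exists>B. finite B \<and> card B = n \<and> B \<subseteq> N \<and>
     (\<forall>x\<in>N. \<exists>c. c ` B \<subseteq> R \<and> x - (\<Sum>b\<in>B. c b * b) \<in> M) \<and>
     (\<forall>c. c ` B \<subseteq> R \<and> (\<Sum>b\<in>B. c b * b) \<in> M \<longrightarrow> c ` B \<subseteq> nonunits R))"

text \<open>
  The type of a one-dimensional Cohen-Macaulay local domain is the dimension over the residue
  field of the socle \<open>(aR :\<^sub>R \<mm>)/aR\<close> of \<open>R/aR\<close>, where \<open>a\<close> is a parameter, that is, a nonzero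
  element of \<open>\<mm>\<close>; the choice of \<open>a\<close> does not matter.
\<close>

definition has_cm_type :: "'a::field set \<Rightarrow> nat \<Rightarrow> bool" where
  "has_cm_type R n \<longleftrightarrow> (\<exists>a\<in>nonunits R. a \<noteq> 0 \<and>
     has_residue_dim R {x \<in> R. \<forall>y\<in>nonunits R. x * y \<in> (*) a ` R} ((*) a ` R) n)"

text \<open>
  \<open>K[[H]]\<close>, the power series with support in \<open>H\<close>, placed inside the field of Laurent series
  over \<open>K\<close>, here the type variable \<open>'k\<close>.
\<close>

definition semigroup_ring :: "nat set \<Rightarrow> 'k::field fls set" where
  "semigroup_ring H = fps_to_fls ` {f. \<forall>n. fps_nth f n \<noteq> 0 \<longrightarrow> n \<in> H}"

text \<open>
  The parameters \<open>m\<close> and \<open>x\<close> are integers and the semigroups are sets of integers, so that no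
  subtraction is truncated. Fractional bounds are multiplied out: \<open>m - 1 \<le> 2*x\<close> stands for
  \<open>(m - 1)/2 \<le> x\<close>, and so on.
\<close>

inductive ffg_type4_family :: "int set \<Rightarrow> bool" where
  F1: "\<lbrakk>1 \<le> x; x \<le> m\<rbrakk> \<Longrightarrow> ffg_type4_family (submonoid_gen {5, 5*m + 1, 5*m + 5*x - 3, 5*m + 5*x - 2, 5*m + 5*x - 1})"
| F2: "\<lbrakk>1 \<le> x; x \<le> m\<rbrakk> \<Longrightarrow> ffg_type4_family (submonoid_gen {5, 5*m + 4, 5*m + 5*x + 1, 5*m + 5*x + 2, 5*m + 5*x + 3})"
| F3: "\<lbrakk>1 \<le> x; x \<le> m - 1\<rbrakk> \<Longrightarrow> ffg_type4_family (submonoid_gen {5, 5*m + 2, 5*m + 5*x + 1, 5*m + 5*x + 3, 5*m + 5*x + 4})"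
| F4: "\<lbrakk>1 \<le> x; x \<le> m\<rbrakk> \<Longrightarrow> ffg_type4_family (submonoid_gen {5, 5*m + 3, 5*m + 5*x - 1, 5*m + 5*x + 1, 5*m + 5*x + 2})"
| F5: "1 \<le> m \<Longrightarrow> ffg_type4_family (submonoid_gen {6, 6*m + 5, 12*m + 7, 12*m + 8, 12*m + 9})"
| F6: "1 \<le> m \<Longrightarrow> ffg_type4_family (submonoid_gen {6, 6*m + 1, 12*m + 3, 12*m + 4, 12*m + 5})"
| F7: "1 \<le> m \<Longrightarrow> ffg_type4_family (submonoid_gen {6, 6*m + 2, 12*m + 1, 12*m + 3, 12*m + 5})"
| F8: "1 \<le> m \<Longrightarrow> ffg_type4_family (submonoid_gen {6, 6*m + 4, 12*m + 5, 12*m + 7, 12*m + 9})"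
| F9: "1 \<le> m \<Longrightarrow> ffg_type4_family (submonoid_gen {6, 6*m + 5, 12*m + 13, 12*m + 14, 12*m + 15})"
| F10: "1 \<le> m \<Longrightarrow> ffg_type4_family (submonoid_gen {6, 6*m + 1, 12*m - 1, 12*m + 3, 12*m + 4})"
| F11: "1 \<le> m \<Longrightarrow> ffg_type4_family (submonoid_gen {6, 6*m + 4, 12*m + 3, 12*m + 5, 12*m + 7})"
| F12: "1 \<le> m \<Longrightarrow> ffg_type4_family (submonoid_gen {6, 6*m + 2, 12*m - 1, 12*m + 1, 12*m + 3})"
| F13: "\<lbrakk>1 \<le> m; 1 \<le> x; m - 1 \<le> 2*x; x \<le> m\<rbrakk> \<Longrightarrow> ffg_type4_family (submonoid_gen {7, 7*m + 5, 7*x + 6, 7*m + 7*x + 8, 7*m + 7*x + 9, 7*m + 7*x + 10})"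
| F14: "\<lbrakk>1 \<le> m; m \<le> x; x \<le> 2*m\<rbrakk> \<Longrightarrow> ffg_type4_family (submonoid_gen {7, 7*m + 1, 7*x + 2, 7*m + 7*x + 4, 7*m + 7*x + 5, 7*m + 7*x + 6})"
| F15: "1 \<le> m \<Longrightarrow> ffg_type4_family (submonoid_gen {7, 7*m + 1, 7*m + 3, 14*m + 5})"
| F16: "1 \<le> m \<Longrightarrow> ffg_type4_family (submonoid_gen {7, 7*m + 4, 7*m + 5, 14*m + 6})"
| F17: "1 \<le> m \<Longrightarrow> ffg_type4_family (submonoid_gen {7, 7*m + 2, 7*m + 3, 14*m + 1})"
| F18: "\<lbrakk>1 \<le> m; 1 \<le> x; m - 1 \<le> x; x \<le> m\<rbrakk> \<Longrightarrow> ffg_type4_family (submonoid_gen {7, 7*m + 4, 7*x + 6, 7*m + 7*x + 5, 7*m + 7*x + 8, 7*m + 7*x + 9})"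
| F19: "\<lbrakk>1 \<le> m; m \<le> x; x \<le> 2*m\<rbrakk> \<Longrightarrow> ffg_type4_family (submonoid_gen {7, 7*m + 3, 7*x + 6, 7*m + 7*x + 8, 7*m + 7*x + 11, 7*m + 7*x + 12})"
| F20: "\<lbrakk>1 \<le> m; 1 \<le> x; m - 1 \<le> 2*x; x \<le> m\<rbrakk> \<Longrightarrow> ffg_type4_family (submonoid_gen {7, 7*m + 1, 7*x + 4, 7*m + 7*x + 2, 7*m + 7*x + 3, 7*m + 7*x + 6})"
| F21: "1 \<le> m \<Longrightarrow> ffg_type4_family (submonoid_gen {7, 7*m + 3, 7*m + 4, 14*m + 5, 14*m + 9})"
| F22: "\<lbrakk>1 \<le> m; 1 \<le> x; m - 1 \<le> x; x \<le> 2*m\<rbrakk> \<Longrightarrow> ffg_type4_family (submonoid_gen {7, 7*m + 2, 7*x + 4, 7*m + 7*x + 1, 7*m + 7*x + 3, 7*m + 7*x + 5})"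
| F23: "\<lbrakk>1 \<le> m; 1 \<le> x; m - 1 \<le> 2*x; x \<le> m\<rbrakk> \<Longrightarrow> ffg_type4_family (submonoid_gen {7, 7*m + 3, 7*x + 5, 7*m + 7*x + 4, 7*m + 7*x + 6, 7*m + 7*x + 9})"
| F24: "\<lbrakk>1 \<le> x; x \<le> m\<rbrakk> \<Longrightarrow> ffg_type4_family (submonoid_gen {8, 8*m + 1, 8*m + 3, 8*x + 4, 8*m + 8*x + 2, 8*m + 8*x + 6})"
| F25: "\<lbrakk>1 \<le> m; m \<le> x\<rbrakk> \<Longrightarrow> ffg_type4_family (submonoid_gen {8, 8*m + 4, 8*x + 5, 8*x + 7, 8*m + 8*x + 6, 8*m + 8*x + 10})"
| F26: "\<lbrakk>1 \<le> m; m \<le> x; x \<le> 2*m\<rbrakk> \<Longrightarrow> ffg_type4_family (submonoid_gen {8, 8*m + 3, 8*x + 6, 8*x + 7, 8*m + 8*x + 12, 8*m + 8*x + 13})"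
| F27: "\<lbrakk>1 \<le> m; 1 \<le> x; m - 1 \<le> 2*x; x \<le> m - 1\<rbrakk> \<Longrightarrow> ffg_type4_family (submonoid_gen {8, 8*m + 3, 8*m + 6, 8*x + 7, 8*m + 8*x + 9, 8*m + 8*x + 12})"
| F28: "\<lbrakk>1 \<le> x; x \<le> m - 1\<rbrakk> \<Longrightarrow> ffg_type4_family (submonoid_gen {8, 8*m - 1, 8*m + 1, 8*x + 4, 8*m + 8*x + 2, 8*m + 8*x + 6})"
| F29: "\<lbrakk>1 \<le> m; m \<le> x; x \<le> 2*m\<rbrakk> \<Longrightarrow> ffg_type4_family (submonoid_gen {8, 8*m + 1, 8*x + 2, 8*x + 5, 8*m + 8*x + 4, 8*m + 8*x + 7})"
| F30: "\<lbrakk>1 \<le> m; 1 \<le> x; m - 1 \<le> 2*x; x \<le> m - 1\<rbrakk> \<Longrightarrow> ffg_type4_family (submonoid_gen {8, 8*m + 1, 8*m + 2, 8*x + 5, 8*m + 8*x + 3, 8*m + 8*x + 4})"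
| F31: "\<lbrakk>1 \<le> x; x \<le> m\<rbrakk> \<Longrightarrow> ffg_type4_family (submonoid_gen {8, 8*m + 3, 8*x + 4, 8*m + 5, 8*m + 8*x + 6, 8*m + 8*x + 10})"
| F32: "\<lbrakk>1 \<le> m; m \<le> x\<rbrakk> \<Longrightarrow> ffg_type4_family (submonoid_gen {9, 9*m + 3, 9*m + 6, 9*x + 7, 9*x + 8})"
| F33: "\<lbrakk>3 \<le> m; 2*m - 1 \<le> 3*x; x \<le> m - 1\<rbrakk> \<Longrightarrow> ffg_type4_family (submonoid_gen {9, 9*m + 3, 9*m + 6, 9*x + 7, 18*x - 9*m + 8, 18*x + 10, 18*x + 13})"
| F34: "\<lbrakk>1 \<le> m; 1 \<le> x; 2*m - 2 \<le> 3*x; x \<le> m - 1\<rbrakk> \<Longrightarrow> ffg_type4_family (submonoid_gen {9, 9*m + 1, 18*m - 9*x - 5, 18*m - 9*x - 2, 9*x + 8, 18*m + 5})"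
| F35: "\<lbrakk>1 \<le> m; 1 \<le> x; m - 1 \<le> 2*x; x \<le> m - 1\<rbrakk> \<Longrightarrow> ffg_type4_family (submonoid_gen {9, 9*m - 2, 9*m - 1, 9*m + 1, 9*x + 4, 9*m + 9*x + 6})"
| F36: "\<lbrakk>1 \<le> m; m \<le> x; 2*x \<le> 3*m - 1\<rbrakk> \<Longrightarrow> ffg_type4_family (submonoid_gen {9, 9*m + 1, 18*x - 9*m + 11, 18*x - 9*m + 14, 9*x + 8, 18*x + 13})"
| F37: "\<lbrakk>1 \<le> m; 1 \<le> x; m - 1 \<le> 2*x; x \<le> m - 1\<rbrakk> \<Longrightarrow> ffg_type4_family (submonoid_gen {9, 9*m - 1, 9*m + 1, 9*m + 2, 9*x + 5, 9*m + 9*x + 3})"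
| F38: "\<lbrakk>1 \<le> m; m \<le> x; x \<le> 2*m\<rbrakk> \<Longrightarrow> ffg_type4_family (submonoid_gen {9, 9*m + 1, 9*x + 2, 18*x - 9*m + 3, 18*x - 9*m + 6, 18*x + 5, 18*x + 8})"
| F39: "\<lbrakk>1 \<le> x; x \<le> m - 1\<rbrakk> \<Longrightarrow> ffg_type4_family (submonoid_gen {9, 9*x + 3, 9*x + 6, 9*m + 1, 9*m + 2})"
| F40: "\<lbrakk>1 \<le> m; m \<le> x\<rbrakk> \<Longrightarrow> ffg_type4_family (submonoid_gen {9, 9*m + 3, 9*x + 4, 9*x + 5, 9*m + 6})"

end

theory Submission
  imports Defs
begin

text \<open>
  Let \<open>F\<close> be the Frobenius number of \<open>H\<close> and \<open>K = {F - z | z \<notin> H}\<close>. The Laurent series supported in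
  \<open>K\<close> form a canonical ideal \<open>\<omega>\<close>, by duality for the pairing that sends \<open>(f, g)\<close> to the coefficient
  of \<open>f g\<close> at \<open>F\<close>, and canonical ideals of a local ring are unique up to scaling. All colons involved
  are graded, and \<open>tr(\<omega>)\<close> is the conductor iff \<open>K + K\<close> is the set of all natural numbers.

  As \<open>K\<close> is generated over \<open>H\<close> by the set \<open>D\<close> of all \<open>F - f\<close> with \<open>f\<close> pseudo-Frobenius, this forces
  \<open>{0..<e} \<subseteq> D + D\<close> for the multiplicity \<open>e\<close> of \<open>H\<close>. Here \<open>D\<close> has four elements, so
  \<open>5 \<le> e \<le> 9\<close> and there are few choices for \<open>D\<close>. Given \<open>D\<close> and the residue of \<open>F\<close> modulo \<open>e\<close>, the
  pseudo-Frobenius numbers fix all but at most four Kunz coordinates of \<open>H\<close>. The remaining Apery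
  elements are not maximal, which turns some of the Kunz inequalities into equations, and linear
  integer arithmetic leads to the listed families.
\<close>

section \<open>Semigroups with given Kunz coordinates\<close>

text \<open>Let \<open>T\<close> be the set of \<open>z\<close> with \<open>z + K\<close> inside
  \<open>H\<close>. Now \<open>z\<close> is outside \<open>T\<close> iff \<open>z + b\<close> is a
  gap for some \<open>b\<close> in \<open>K\<close>, that is, iff \<open>F - z\<close> is in
  \<open>K + K\<close>. As \<open>0\<close> is in \<open>K\<close>, the trace contains the series
  supported in \<open>T\<close>; so it is the conductor iff \<open>T\<close> is the set of numbers
  above \<open>F\<close>, iff \<open>K + K\<close> is everything. Duality needs no topology. A
  fractional ideal has orders bounded below and contains all series of high order, so a functional
  vanishing on it sees only finitely many coefficients of the relevant series, and pairing with a
  Laurent polynomial realises it. For \<open>n < e\<close>, the semigroup parts in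
  \<open>n = (d + s) + (d' + s')\<close> vanish because \<open>e\<close> is the least positive
  element; this is where \<open>D + D\<close> comes from. Four differences have at most ten sums,
  and \<open>{0, 1, 3, 4}\<close> reaches furthest, up to 8. Cases without a family mostly die by
  parity: two free classes would force one coordinate to be both even and odd. Type 4 is a
  hypothesis of the theorem, so for the families only the covering by sums is checked, with explicit
  gaps.\<close>

definition kset :: "int \<Rightarrow> (int \<Rightarrow> int) \<Rightarrow> int set" where
  "kset e k = {z. k (z mod e) \<le> z div e}"

text \<open>The differences \<open>F - y\<close> with \<open>y\<close> a gap form \<open>K\<close>,
  so the last clause is \<open>K + K = {0..}\<close>. Binding \<open>F\<close> inside makes this a
  property of the bare set; the first two clauses determine \<open>F\<close>.\<close>

definition gap_sums_cover :: "int set \<Rightarrow> bool" where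
  "gap_sums_cover S \<longleftrightarrow> (\<exists>F. F \<notin> S \<and> (\<forall>z>F. z \<in> S) \<and>
     (\<forall>n\<ge>0. \<exists>y z. y \<notin> S \<and> z \<notin> S \<and> n = (F - y) + (F - z)))"

lemma kset_cong: "0 < e \<Longrightarrow> (\<And>i. i \<in> set [0..e-1] \<Longrightarrow> k i = k' i) \<Longrightarrow> kset e k = kset e k'"
  by (auto simp: kset_def)

lemma mem_kset: "0 \<le> i \<Longrightarrow> i < e \<Longrightarrow> e * q + i \<in> kset e k \<longleftrightarrow> k i \<le> q"
  by (simp add: kset_def)

lemma upto_numeral [simp]: "[0..numeral n] = 0 # [1..numeral n]" "[1..numeral n] = 1 # [2..numeral n]"
  by (simp_all add: upto.simps)

lemma submonoid_gen_add_submonoid: "add_submonoid (submonoid_gen A)"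
  unfolding submonoid_gen_def
  by (rule hull_in) (auto simp: add_submonoid_def)

lemma sum_list_in_submonoid_gen: "set xs \<subseteq> A \<Longrightarrow> sum_list xs \<in> submonoid_gen A"
proof (induction xs)
  case Nil
  then show ?case using submonoid_gen_add_submonoid[of A] by (simp add: add_submonoid_def)
next
  case (Cons a xs)
  have "a \<in> submonoid_gen A"
    unfolding submonoid_gen_def using Cons.prems by (auto intro: hull_inc)
  then show ?case
    using Cons submonoid_gen_add_submonoid[of A] by (simp add: add_submonoid_def)
qed

lemma mult_in_submonoid:
  assumes "add_submonoid S" "(e::int) \<in> S" "0 \<le> t" shows "e * t \<in> S"
proof -
  have "e * int n \<in> S" for n
    by (induction n) (use assms in \<open>auto simp: add_submonoid_def algebra_simps\<close>)
  from this[of "nat t"] show ?thesis using assms(3) by simp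
qed

text \<open>These are the Kunz inequalities: the least elements of classes \<open>i\<close> and
  \<open>j\<close> must add up to something not below the least element of class
  \<open>i + j\<close>. By symmetry and \<open>k 0 = 0\<close>, pairs with
  \<open>1 \<le> i \<le> j\<close> suffice.\<close>

lemma kunz_add_submonoid:
  assumes e: "0 < e" and k0: "k 0 = 0"
    and kunz: "list_all (\<lambda>i. list_all (\<lambda>j. k ((i + j) mod e) \<le> k i + k j + (i + j) div e) [i..e-1]) [1..e-1]"
  shows "add_submonoid (kset e k)"
proof -
  have *: "k ((i + j) mod e) \<le> k i + k j + (i + j) div e"
    if "i \<in> {0..<e}" "j \<in> {0..<e}" for i j
  proof (cases "i = 0 \<or> j = 0")
    case True
    then show ?thesis using that k0 by auto
  next
    case False
    then show ?thesis
      using that kunz[unfolded list_all_iff, rule_format, of i j]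
        kunz[unfolded list_all_iff, rule_format, of j i]
      by (cases "i \<le> j") (auto simp: add.commute)
  qed
  have "a + b \<in> kset e k" if "a \<in> kset e k" "b \<in> kset e k" for a b
  proof -
    have "k (a mod e) \<le> a div e" "k (b mod e) \<le> b div e"
      using that by (auto simp: kset_def)
    moreover have "(a + b) div e = a div e + b div e + (a mod e + b mod e) div e"
      using e by (metis div_add1_eq)
    moreover have "k ((a + b) mod e) \<le> k (a mod e) + k (b mod e) + (a mod e + b mod e) div e"
      using *[of "a mod e" "b mod e"] e by (simp add: mod_add_eq)
    ultimately show ?thesis by (simp add: kset_def)
  qed
  then show ?thesis using k0 by (simp add: add_submonoid_def kset_def)
qed

text \<open>A submonoid containing \<open>e\<close> is known from its Apery elements
  \<open>e * k i + i\<close>. Every generator is one of these or \<open>e\<close>, and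
  \<open>xss ! nat i\<close> displays the Apery element of class \<open>i\<close> as a sum of
  generators.\<close>

lemma submonoid_gen_eq_kset:
  fixes xss :: "int list list"
  assumes e: "0 < e" and k0: "k 0 = 0"
    and kunz: "list_all (\<lambda>i. list_all (\<lambda>j. k ((i + j) mod e) \<le> k i + k j + (i + j) div e) [i..e-1]) [1..e-1]"
    and eG: "e \<in> G"
    and sub: "\<forall>g\<in>G. g = e \<or> list_ex (\<lambda>i. g = e * k i + i) [1..e-1]"
    and apery: "list_all (\<lambda>i. set (xss ! nat i) \<subseteq> G \<and> sum_list (xss ! nat i) = e * k i + i) [1..e-1]"
  shows "submonoid_gen G = kset e k"
proof
  have "g \<in> kset e k" if "g \<in> G" for g
    using sub that k0 e mem_kset[of _ e] mem_kset[of 0 e 1 k] by (fastforce simp: list_ex_iff)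
  then show "submonoid_gen G \<subseteq> kset e k"
    unfolding submonoid_gen_def using kunz_add_submonoid[OF e k0 kunz]
    by (intro hull_minimal) auto
  show "kset e k \<subseteq> submonoid_gen G"
  proof
    fix z assume z: "z \<in> kset e k"
    let ?i = "z mod e"
    note sm = submonoid_gen_add_submonoid[of G]
    have "e * k ?i + ?i \<in> submonoid_gen G"
    proof (cases "?i = 0")
      case True
      then show ?thesis using k0 sm by (simp add: add_submonoid_def)
    next
      case False
      then have "?i \<in> set [1..e-1]"
        using pos_mod_sign[OF e, of z] pos_mod_bound[OF e, of z] unfolding set_upto atLeastAtMost_iff by linarith
      then show ?thesis using sum_list_in_submonoid_gen[of "xss ! nat ?i" G] apery by (auto simp: list_all_iff)
    qed
    moreover have "e * (z div e - k ?i) \<in> submonoid_gen G"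
      using z mult_in_submonoid[OF sm] sum_list_in_submonoid_gen[of "[e]" G] eG
      by (simp add: kset_def)
    ultimately have "(e * k ?i + ?i) + e * (z div e - k ?i) \<in> submonoid_gen G"
      using sm by (auto simp: add_submonoid_def)
    then show "z \<in> submonoid_gen G" by (simp add: algebra_simps)
  qed
qed

text \<open>Gaps stay gaps when semigroup elements are subtracted. So it is enough to cover
  \<open>n < e\<close> by sums from \<open>ds\<close>; a larger \<open>n\<close> is reached by
  moving one of the two gaps down by \<open>e * (n div e)\<close>. The condition \<open>frob\<close>
  puts every Apery element at or below \<open>F + e\<close>.\<close>

lemma gap_sums_cover_kset:
  assumes e: "0 < e" and k0: "k 0 = 0"
    and kunz: "list_all (\<lambda>i. list_all (\<lambda>j. k ((i + j) mod e) \<le> k i + k j + (i + j) div e) [i..e-1]) [1..e-1]"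
    and frob: "list_all (\<lambda>i. e * k i + i \<le> e * q + r + e) [0..e-1]"
    and gaps: "\<forall>d\<in>set ds. q + (r - d) div e < k ((r - d) mod e)"
    and zero: "0 \<in> set ds"
    and cover: "list_all (\<lambda>n. list_ex (\<lambda>c. list_ex (\<lambda>d. n = c + d) ds) ds) [0..e-1]"
  shows "gap_sums_cover (kset e k)"
  unfolding gap_sums_cover_def
proof (rule exI[of _ "e * q + r"], intro conjI allI impI)
  have gap: "e * q + r - d \<notin> kset e k" if "d \<in> set ds" for d
  proof -
    have "(e * q + r - d) div e = q + (r - d) div e" "(e * q + r - d) mod e = (r - d) mod e"
      using e by (simp_all add: add_diff_eq[symmetric])
    then show ?thesis using gaps that by (auto simp: kset_def)
  qed
  from gap[OF zero] show "e * q + r \<notin> kset e k" by simp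
  show "z \<in> kset e k" if "e * q + r < z" for z
  proof -
    have "z mod e \<in> set [0..e-1]" using e by simp
    with frob[unfolded list_all_iff] have "e * k (z mod e) + z mod e \<le> e * q + r + e" by blast
    moreover have "z = e * (z div e) + z mod e" by simp
    ultimately have "e * k (z mod e) < e * (z div e + 1)"
      using that unfolding distrib_left by linarith
    then show ?thesis using e by (simp add: kset_def)
  qed
  note sm = kunz_add_submonoid[OF e k0 kunz]
  have eS: "e \<in> kset e k" using e k0 by (simp add: kset_def)
  fix n :: int assume n: "0 \<le> n"
  have "n mod e \<in> set [0..e-1]" using e by simp
  then obtain c d where cd: "c \<in> set ds" "d \<in> set ds" "n mod e = c + d"
    using cover unfolding list_all_iff list_ex_iff by blast
  let ?y = "e * q + r - c - e * (n div e)" and ?z = "e * q + r - d"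
  have "?y \<notin> kset e k"
  proof
    assume "?y \<in> kset e k"
    moreover have "e * (n div e) \<in> kset e k"
      using mult_in_submonoid[OF sm eS] n e by (simp add: pos_imp_zdiv_nonneg_iff)
    ultimately have "?y + e * (n div e) \<in> kset e k" using sm unfolding add_submonoid_def by blast
    then show False using gap[OF cd(1)] by simp
  qed
  moreover have "n = (e * q + r - ?y) + (e * q + r - ?z)"
    using cd(3) mult_div_mod_eq[of e n] by linarith
  ultimately show "\<exists>y z. y \<notin> kset e k \<and> z \<notin> kset e k \<and> n = (e * q + r - y) + (e * q + r - z)"
    using gap[OF cd(2)] by blast
qed

section \<open>The families\<close>

text \<open>The scheme of all forty lemmas: the list after \<open>kset\<close> gives the Kunz
  coordinates, \<open>e * q + r\<close> is the Frobenius number, and \<open>ds\<close> lists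
  distances from it down to gaps. For multiplicity at least 6, \<open>ds\<close> is the set
  \<open>D\<close> that leads back to the family in the converse direction.\<close>

lemma family_1:
  fixes m x :: int
  assumes "1 \<le> x" "x \<le> m"
  shows "submonoid_gen {5, 5*m + 1, 5*m + 5*x - 3, 5*m + 5*x - 2, 5*m + 5*x - 1}
      = kset 5 (\<lambda>i. [0, m, m + x - 1, m + x - 1, m + x - 1] ! nat i)" (is ?A)
    and "gap_sums_cover (submonoid_gen {5, 5*m + 1, 5*m + 5*x - 3, 5*m + 5*x - 2, 5*m + 5*x - 1})"
proof -
  show A: ?A
    by (rule submonoid_gen_eq_kset[where xss =
          "[[], [5*m + 1], [5*m + 5*x - 3], [5*m + 5*x - 2], [5*m + 5*x - 1]]"])
      (use assms in simp_all)
  show "gap_sums_cover (submonoid_gen {5, 5*m + 1, 5*m + 5*x - 3, 5*m + 5*x - 2, 5*m + 5*x - 1})"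
    unfolding A
    by (rule gap_sums_cover_kset[where q = "m + x - 2" and r = 4 and ds = "[0, 1, 2]"])
      (use assms in simp_all)
qed

lemma family_2:
  fixes m x :: int
  assumes "1 \<le> x" "x \<le> m"
  shows "submonoid_gen {5, 5*m + 4, 5*m + 5*x + 1, 5*m + 5*x + 2, 5*m + 5*x + 3}
      = kset 5 (\<lambda>i. [0, m + x, m + x, m + x, m] ! nat i)" (is ?A)
    and "gap_sums_cover (submonoid_gen {5, 5*m + 4, 5*m + 5*x + 1, 5*m + 5*x + 2, 5*m + 5*x + 3})"
proof -
  show A: ?A
    by (rule submonoid_gen_eq_kset[where xss =
          "[[], [5*m + 5*x + 1], [5*m + 5*x + 2], [5*m + 5*x + 3], [5*m + 4]]"])
      (use assms in simp_all)
  show "gap_sums_cover (submonoid_gen {5, 5*m + 4, 5*m + 5*x + 1, 5*m + 5*x + 2, 5*m + 5*x + 3})"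
    unfolding A
    by (rule gap_sums_cover_kset[where q = "m + x - 1" and r = 3 and ds = "[0, 1, 2]"])
      (use assms in simp_all)
qed

lemma family_3:
  fixes m x :: int
  assumes "1 \<le> x" "x \<le> m - 1"
  shows "submonoid_gen {5, 5*m + 2, 5*m + 5*x + 1, 5*m + 5*x + 3, 5*m + 5*x + 4}
      = kset 5 (\<lambda>i. [0, m + x, m, m + x, m + x] ! nat i)" (is ?A)
    and "gap_sums_cover (submonoid_gen {5, 5*m + 2, 5*m + 5*x + 1, 5*m + 5*x + 3, 5*m + 5*x + 4})"
proof -
  show A: ?A
    by (rule submonoid_gen_eq_kset[where xss =
          "[[], [5*m + 5*x + 1], [5*m + 2], [5*m + 5*x + 3], [5*m + 5*x + 4]]"])
      (use assms in simp_all)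
  show "gap_sums_cover (submonoid_gen {5, 5*m + 2, 5*m + 5*x + 1, 5*m + 5*x + 3, 5*m + 5*x + 4})"
    unfolding A
    by (rule gap_sums_cover_kset[where q = "m + x - 1" and r = 4 and ds = "[0, 1, 3]"])
      (use assms in simp_all)
qed

lemma family_4:
  fixes m x :: int
  assumes "1 \<le> x" "x \<le> m"
  shows "submonoid_gen {5, 5*m + 3, 5*m + 5*x - 1, 5*m + 5*x + 1, 5*m + 5*x + 2}
      = kset 5 (\<lambda>i. [0, m + x, m + x, m, m + x - 1] ! nat i)" (is ?A)
    and "gap_sums_cover (submonoid_gen {5, 5*m + 3, 5*m + 5*x - 1, 5*m + 5*x + 1, 5*m + 5*x + 2})"
proof -
  show A: ?A
    by (rule submonoid_gen_eq_kset[where xss =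
          "[[], [5*m + 5*x + 1], [5*m + 5*x + 2], [5*m + 3], [5*m + 5*x - 1]]"])
      (use assms in simp_all)
  show "gap_sums_cover (submonoid_gen {5, 5*m + 3, 5*m + 5*x - 1, 5*m + 5*x + 1, 5*m + 5*x + 2})"
    unfolding A
    by (rule gap_sums_cover_kset[where q = "m + x - 1" and r = 2 and ds = "[0, 1, 3]"])
      (use assms in simp_all)
qed

section \<open>Families of multiplicity 6\<close>

lemma family_5:
  fixes m :: int
  assumes "1 \<le> m"
  shows "submonoid_gen {6, 6*m + 5, 12*m + 7, 12*m + 8, 12*m + 9}
      = kset 6 (\<lambda>i. [0, 2*m + 1, 2*m + 1, 2*m + 1, 2*m + 1, m] ! nat i)" (is ?A)
    and "gap_sums_cover (submonoid_gen {6, 6*m + 5, 12*m + 7, 12*m + 8, 12*m + 9})"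
proof -
  show A: ?A
    by (rule submonoid_gen_eq_kset[where xss =
          "[[], [12*m + 7], [12*m + 8], [12*m + 9], [6*m + 5, 6*m + 5], [6*m + 5]]"])
      (use assms in simp_all)
  show "gap_sums_cover (submonoid_gen {6, 6*m + 5, 12*m + 7, 12*m + 8, 12*m + 9})"
    unfolding A
    by (rule gap_sums_cover_kset[where q = "2*m" and r = 4 and ds = "[0, 1, 2, 3]"])
      (use assms in simp_all)
qed

lemma family_6:
  fixes m :: int
  assumes "1 \<le> m"
  shows "submonoid_gen {6, 6*m + 1, 12*m + 3, 12*m + 4, 12*m + 5}
      = kset 6 (\<lambda>i. [0, m, 2*m, 2*m, 2*m, 2*m] ! nat i)" (is ?A)
    and "gap_sums_cover (submonoid_gen {6, 6*m + 1, 12*m + 3, 12*m + 4, 12*m + 5})"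
proof -
  show A: ?A
    by (rule submonoid_gen_eq_kset[where xss =
          "[[], [6*m + 1], [6*m + 1, 6*m + 1], [12*m + 3], [12*m + 4], [12*m + 5]]"])
      (use assms in simp_all)
  show "gap_sums_cover (submonoid_gen {6, 6*m + 1, 12*m + 3, 12*m + 4, 12*m + 5})"
    unfolding A
    by (rule gap_sums_cover_kset[where q = "2*m - 1" and r = 5 and ds = "[0, 1, 2, 3]"])
      (use assms in simp_all)
qed

lemma family_7:
  fixes m :: int
  assumes "1 \<le> m"
  shows "submonoid_gen {6, 6*m + 2, 12*m + 1, 12*m + 3, 12*m + 5}
      = kset 6 (\<lambda>i. [0, 2*m, m, 2*m, 2*m, 2*m] ! nat i)" (is ?A)
    and "gap_sums_cover (submonoid_gen {6, 6*m + 2, 12*m + 1, 12*m + 3, 12*m + 5})"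
proof -
  show A: ?A
    by (rule submonoid_gen_eq_kset[where xss =
          "[[], [12*m + 1], [6*m + 2], [12*m + 3], [6*m + 2, 6*m + 2], [12*m + 5]]"])
      (use assms in simp_all)
  show "gap_sums_cover (submonoid_gen {6, 6*m + 2, 12*m + 1, 12*m + 3, 12*m + 5})"
    unfolding A
    by (rule gap_sums_cover_kset[where q = "2*m - 1" and r = 5 and ds = "[0, 1, 2, 4]"])
      (use assms in simp_all)
qed

lemma family_8:
  fixes m :: int
  assumes "1 \<le> m"
  shows "submonoid_gen {6, 6*m + 4, 12*m + 5, 12*m + 7, 12*m + 9}
      = kset 6 (\<lambda>i. [0, 2*m + 1, 2*m + 1, 2*m + 1, m, 2*m] ! nat i)" (is ?A)
    and "gap_sums_cover (submonoid_gen {6, 6*m + 4, 12*m + 5, 12*m + 7, 12*m + 9})"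
proof -
  show A: ?A
    by (rule submonoid_gen_eq_kset[where xss =
          "[[], [12*m + 7], [6*m + 4, 6*m + 4], [12*m + 9], [6*m + 4], [12*m + 5]]"])
      (use assms in simp_all)
  show "gap_sums_cover (submonoid_gen {6, 6*m + 4, 12*m + 5, 12*m + 7, 12*m + 9})"
    unfolding A
    by (rule gap_sums_cover_kset[where q = "2*m" and r = 3 and ds = "[0, 1, 2, 4]"])
      (use assms in simp_all)
qed

lemma family_9:
  fixes m :: int
  assumes "1 \<le> m"
  shows "submonoid_gen {6, 6*m + 5, 12*m + 13, 12*m + 14, 12*m + 15}
      = kset 6 (\<lambda>i. [0, 2*m + 2, 2*m + 2, 2*m + 2, 2*m + 1, m] ! nat i)" (is ?A)
    and "gap_sums_cover (submonoid_gen {6, 6*m + 5, 12*m + 13, 12*m + 14, 12*m + 15})"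
proof -
  show A: ?A
    by (rule submonoid_gen_eq_kset[where xss =
          "[[], [12*m + 13], [12*m + 14], [12*m + 15], [6*m + 5, 6*m + 5], [6*m + 5]]"])
      (use assms in simp_all)
  show "gap_sums_cover (submonoid_gen {6, 6*m + 5, 12*m + 13, 12*m + 14, 12*m + 15})"
    unfolding A
    by (rule gap_sums_cover_kset[where q = "2*m + 1" and r = 3 and ds = "[0, 1, 2, 5]"])
      (use assms in simp_all)
qed

lemma family_10:
  fixes m :: int
  assumes "1 \<le> m"
  shows "submonoid_gen {6, 6*m + 1, 12*m - 1, 12*m + 3, 12*m + 4}
      = kset 6 (\<lambda>i. [0, m, 2*m, 2*m, 2*m, 2*m - 1] ! nat i)" (is ?A)
    and "gap_sums_cover (submonoid_gen {6, 6*m + 1, 12*m - 1, 12*m + 3, 12*m + 4})"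
proof -
  show A: ?A
    by (rule submonoid_gen_eq_kset[where xss =
          "[[], [6*m + 1], [6*m + 1, 6*m + 1], [12*m + 3], [12*m + 4], [12*m - 1]]"])
      (use assms in simp_all)
  show "gap_sums_cover (submonoid_gen {6, 6*m + 1, 12*m - 1, 12*m + 3, 12*m + 4})"
    unfolding A
    by (rule gap_sums_cover_kset[where q = "2*m - 1" and r = 4 and ds = "[0, 1, 2, 5]"])
      (use assms in simp_all)
qed

lemma family_11:
  fixes m :: int
  assumes "1 \<le> m"
  shows "submonoid_gen {6, 6*m + 4, 12*m + 3, 12*m + 5, 12*m + 7}
      = kset 6 (\<lambda>i. [0, 2*m + 1, 2*m + 1, 2*m, m, 2*m] ! nat i)" (is ?A)
    and "gap_sums_cover (submonoid_gen {6, 6*m + 4, 12*m + 3, 12*m + 5, 12*m + 7})"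
proof -
  show A: ?A
    by (rule submonoid_gen_eq_kset[where xss =
          "[[], [12*m + 7], [6*m + 4, 6*m + 4], [12*m + 3], [6*m + 4], [12*m + 5]]"])
      (use assms in simp_all)
  show "gap_sums_cover (submonoid_gen {6, 6*m + 4, 12*m + 3, 12*m + 5, 12*m + 7})"
    unfolding A
    by (rule gap_sums_cover_kset[where q = "2*m" and r = 2 and ds = "[0, 1, 3, 5]"])
      (use assms in simp_all)
qed

lemma family_12:
  fixes m :: int
  assumes "1 \<le> m"
  shows "submonoid_gen {6, 6*m + 2, 12*m - 1, 12*m + 1, 12*m + 3}
      = kset 6 (\<lambda>i. [0, 2*m, m, 2*m, 2*m, 2*m - 1] ! nat i)" (is ?A)
    and "gap_sums_cover (submonoid_gen {6, 6*m + 2, 12*m - 1, 12*m + 1, 12*m + 3})"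
proof -
  show A: ?A
    by (rule submonoid_gen_eq_kset[where xss =
          "[[], [12*m + 1], [6*m + 2], [12*m + 3], [6*m + 2, 6*m + 2], [12*m - 1]]"])
      (use assms in simp_all)
  show "gap_sums_cover (submonoid_gen {6, 6*m + 2, 12*m - 1, 12*m + 1, 12*m + 3})"
    unfolding A
    by (rule gap_sums_cover_kset[where q = "2*m - 1" and r = 4 and ds = "[0, 1, 3, 5]"])
      (use assms in simp_all)
qed

section \<open>Families of multiplicity 7\<close>

lemma family_13:
  fixes m x :: int
  assumes "1 \<le> m" "1 \<le> x" "m - 1 \<le> 2*x" "x \<le> m"
  shows "submonoid_gen {7, 7*m + 5, 7*x + 6, 7*m + 7*x + 8, 7*m + 7*x + 9, 7*m + 7*x + 10}
      = kset 7 (\<lambda>i. [0, m + x + 1, m + x + 1, m + x + 1, m + x + 1, m, x] ! nat i)" (is ?A)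
    and "gap_sums_cover (submonoid_gen {7, 7*m + 5, 7*x + 6, 7*m + 7*x + 8, 7*m + 7*x + 9, 7*m + 7*x + 10})"
proof -
  show A: ?A
    by (rule submonoid_gen_eq_kset[where xss =
          "[[], [7*m + 7*x + 8], [7*m + 7*x + 9], [7*m + 7*x + 10], [7*m + 5, 7*x + 6], [7*m + 5],
            [7*x + 6]]"])
      (use assms in simp_all)
  show "gap_sums_cover (submonoid_gen {7, 7*m + 5, 7*x + 6, 7*m + 7*x + 8, 7*m + 7*x + 9, 7*m + 7*x + 10})"
    unfolding A
    by (rule gap_sums_cover_kset[where q = "m + x" and r = 4 and ds = "[0, 1, 2, 3]"])
      (use assms in simp_all)
qed

lemma family_14:
  fixes m x :: int
  assumes "1 \<le> m" "m \<le> x" "x \<le> 2*m"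
  shows "submonoid_gen {7, 7*m + 1, 7*x + 2, 7*m + 7*x + 4, 7*m + 7*x + 5, 7*m + 7*x + 6}
      = kset 7 (\<lambda>i. [0, m, x, m + x, m + x, m + x, m + x] ! nat i)" (is ?A)
    and "gap_sums_cover (submonoid_gen {7, 7*m + 1, 7*x + 2, 7*m + 7*x + 4, 7*m + 7*x + 5, 7*m + 7*x + 6})"
proof -
  show A: ?A
    by (rule submonoid_gen_eq_kset[where xss =
          "[[], [7*m + 1], [7*x + 2], [7*m + 1, 7*x + 2], [7*m + 7*x + 4], [7*m + 7*x + 5],
            [7*m + 7*x + 6]]"])
      (use assms in simp_all)
  show "gap_sums_cover (submonoid_gen {7, 7*m + 1, 7*x + 2, 7*m + 7*x + 4, 7*m + 7*x + 5, 7*m + 7*x + 6})"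
    unfolding A
    by (rule gap_sums_cover_kset[where q = "m + x - 1" and r = 6 and ds = "[0, 1, 2, 3]"])
      (use assms in simp_all)
qed

lemma family_15:
  fixes m :: int
  assumes "1 \<le> m"
  shows "submonoid_gen {7, 7*m + 1, 7*m + 3, 14*m + 5}
      = kset 7 (\<lambda>i. [0, m, 2*m, m, 2*m, 2*m, 2*m] ! nat i)" (is ?A)
    and "gap_sums_cover (submonoid_gen {7, 7*m + 1, 7*m + 3, 14*m + 5})"
proof -
  show A: ?A
    by (rule submonoid_gen_eq_kset[where xss =
          "[[], [7*m + 1], [7*m + 1, 7*m + 1], [7*m + 3], [7*m + 1, 7*m + 3], [14*m + 5],
            [7*m + 3, 7*m + 3]]"])
      (use assms in simp_all)
  show "gap_sums_cover (submonoid_gen {7, 7*m + 1, 7*m + 3, 14*m + 5})"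
    unfolding A
    by (rule gap_sums_cover_kset[where q = "2*m - 1" and r = 6 and ds = "[0, 1, 2, 4]"])
      (use assms in simp_all)
qed

lemma family_16:
  fixes m :: int
  assumes "1 \<le> m"
  shows "submonoid_gen {7, 7*m + 4, 7*m + 5, 14*m + 6}
      = kset 7 (\<lambda>i. [0, 2*m + 1, 2*m + 1, 2*m + 1, m, m, 2*m] ! nat i)" (is ?A)
    and "gap_sums_cover (submonoid_gen {7, 7*m + 4, 7*m + 5, 14*m + 6})"
proof -
  show A: ?A
    by (rule submonoid_gen_eq_kset[where xss =
          "[[], [7*m + 4, 7*m + 4], [7*m + 4, 7*m + 5], [7*m + 5, 7*m + 5], [7*m + 4], [7*m + 5],
            [14*m + 6]]"])
      (use assms in simp_all)
  show "gap_sums_cover (submonoid_gen {7, 7*m + 4, 7*m + 5, 14*m + 6})"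
    unfolding A
    by (rule gap_sums_cover_kset[where q = "2*m" and r = 3 and ds = "[0, 1, 2, 4]"])
      (use assms in simp_all)
qed

lemma family_17:
  fixes m :: int
  assumes "1 \<le> m"
  shows "submonoid_gen {7, 7*m + 2, 7*m + 3, 14*m + 1}
      = kset 7 (\<lambda>i. [0, 2*m, m, m, 2*m, 2*m, 2*m] ! nat i)" (is ?A)
    and "gap_sums_cover (submonoid_gen {7, 7*m + 2, 7*m + 3, 14*m + 1})"
proof -
  show A: ?A
    by (rule submonoid_gen_eq_kset[where xss =
          "[[], [14*m + 1], [7*m + 2], [7*m + 3], [7*m + 2, 7*m + 2], [7*m + 2, 7*m + 3],
            [7*m + 3, 7*m + 3]]"])
      (use assms in simp_all)
  show "gap_sums_cover (submonoid_gen {7, 7*m + 2, 7*m + 3, 14*m + 1})"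
    unfolding A
    by (rule gap_sums_cover_kset[where q = "2*m - 1" and r = 6 and ds = "[0, 1, 2, 5]"])
      (use assms in simp_all)
qed

lemma family_18:
  fixes m x :: int
  assumes "1 \<le> m" "1 \<le> x" "m - 1 \<le> x" "x \<le> m"
  shows "submonoid_gen {7, 7*m + 4, 7*x + 6, 7*m + 7*x + 5, 7*m + 7*x + 8, 7*m + 7*x + 9}
      = kset 7 (\<lambda>i. [0, m + x + 1, m + x + 1, m + x + 1, m, m + x, x] ! nat i)" (is ?A)
    and "gap_sums_cover (submonoid_gen {7, 7*m + 4, 7*x + 6, 7*m + 7*x + 5, 7*m + 7*x + 8, 7*m + 7*x + 9})"
proof -
  show A: ?A
    by (rule submonoid_gen_eq_kset[where xss =
          "[[], [7*m + 7*x + 8], [7*m + 7*x + 9], [7*m + 4, 7*x + 6], [7*m + 4], [7*m + 7*x + 5],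
            [7*x + 6]]"])
      (use assms in simp_all)
  show "gap_sums_cover (submonoid_gen {7, 7*m + 4, 7*x + 6, 7*m + 7*x + 5, 7*m + 7*x + 8, 7*m + 7*x + 9})"
    unfolding A
    by (rule gap_sums_cover_kset[where q = "m + x" and r = 3 and ds = "[0, 1, 2, 5]"])
      (use assms in simp_all)
qed

lemma family_19:
  fixes m x :: int
  assumes "1 \<le> m" "m \<le> x" "x \<le> 2*m"
  shows "submonoid_gen {7, 7*m + 3, 7*x + 6, 7*m + 7*x + 8, 7*m + 7*x + 11, 7*m + 7*x + 12}
      = kset 7 (\<lambda>i. [0, m + x + 1, m + x + 1, m, m + x + 1, m + x + 1, x] ! nat i)" (is ?A)
    and "gap_sums_cover (submonoid_gen {7, 7*m + 3, 7*x + 6, 7*m + 7*x + 8, 7*m + 7*x + 11, 7*m + 7*x + 12})"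
proof -
  show A: ?A
    by (rule submonoid_gen_eq_kset[where xss =
          "[[], [7*m + 7*x + 8], [7*m + 3, 7*x + 6], [7*m + 3], [7*m + 7*x + 11], [7*m + 7*x + 12],
            [7*x + 6]]"])
      (use assms in simp_all)
  show "gap_sums_cover (submonoid_gen {7, 7*m + 3, 7*x + 6, 7*m + 7*x + 8, 7*m + 7*x + 11, 7*m + 7*x + 12})"
    unfolding A
    by (rule gap_sums_cover_kset[where q = "m + x" and r = 5 and ds = "[0, 1, 3, 4]"])
      (use assms in simp_all)
qed

lemma family_20:
  fixes m x :: int
  assumes "1 \<le> m" "1 \<le> x" "m - 1 \<le> 2*x" "x \<le> m"
  shows "submonoid_gen {7, 7*m + 1, 7*x + 4, 7*m + 7*x + 2, 7*m + 7*x + 3, 7*m + 7*x + 6}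
      = kset 7 (\<lambda>i. [0, m, m + x, m + x, x, m + x, m + x] ! nat i)" (is ?A)
    and "gap_sums_cover (submonoid_gen {7, 7*m + 1, 7*x + 4, 7*m + 7*x + 2, 7*m + 7*x + 3, 7*m + 7*x + 6})"
proof -
  show A: ?A
    by (rule submonoid_gen_eq_kset[where xss =
          "[[], [7*m + 1], [7*m + 7*x + 2], [7*m + 7*x + 3], [7*x + 4], [7*m + 1, 7*x + 4],
            [7*m + 7*x + 6]]"])
      (use assms in simp_all)
  show "gap_sums_cover (submonoid_gen {7, 7*m + 1, 7*x + 4, 7*m + 7*x + 2, 7*m + 7*x + 3, 7*m + 7*x + 6})"
    unfolding A
    by (rule gap_sums_cover_kset[where q = "m + x - 1" and r = 6 and ds = "[0, 1, 3, 4]"])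
      (use assms in simp_all)
qed

lemma family_21:
  fixes m :: int
  assumes "1 \<le> m"
  shows "submonoid_gen {7, 7*m + 3, 7*m + 4, 14*m + 5, 14*m + 9}
      = kset 7 (\<lambda>i. [0, 2*m + 1, 2*m + 1, m, m, 2*m, 2*m] ! nat i)" (is ?A)
    and "gap_sums_cover (submonoid_gen {7, 7*m + 3, 7*m + 4, 14*m + 5, 14*m + 9})"
proof -
  show A: ?A
    by (rule submonoid_gen_eq_kset[where xss =
          "[[], [7*m + 4, 7*m + 4], [14*m + 9], [7*m + 3], [7*m + 4], [14*m + 5],
            [7*m + 3, 7*m + 3]]"])
      (use assms in simp_all)
  show "gap_sums_cover (submonoid_gen {7, 7*m + 3, 7*m + 4, 14*m + 5, 14*m + 9})"
    unfolding A
    by (rule gap_sums_cover_kset[where q = "2*m" and r = 2 and ds = "[0, 1, 3, 4]"])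
      (use assms in simp_all)
qed

lemma family_22:
  fixes m x :: int
  assumes "1 \<le> m" "1 \<le> x" "m - 1 \<le> x" "x \<le> 2*m"
  shows "submonoid_gen {7, 7*m + 2, 7*x + 4, 7*m + 7*x + 1, 7*m + 7*x + 3, 7*m + 7*x + 5}
      = kset 7 (\<lambda>i. [0, m + x, m, m + x, x, m + x, m + x] ! nat i)" (is ?A)
    and "gap_sums_cover (submonoid_gen {7, 7*m + 2, 7*x + 4, 7*m + 7*x + 1, 7*m + 7*x + 3, 7*m + 7*x + 5})"
proof -
  show A: ?A
    by (rule submonoid_gen_eq_kset[where xss =
          "[[], [7*m + 7*x + 1], [7*m + 2], [7*m + 7*x + 3], [7*x + 4], [7*m + 7*x + 5],
            [7*m + 2, 7*x + 4]]"])
      (use assms in simp_all)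
  show "gap_sums_cover (submonoid_gen {7, 7*m + 2, 7*x + 4, 7*m + 7*x + 1, 7*m + 7*x + 3, 7*m + 7*x + 5})"
    unfolding A
    by (rule gap_sums_cover_kset[where q = "m + x - 1" and r = 6 and ds = "[0, 1, 3, 5]"])
      (use assms in simp_all)
qed

lemma family_23:
  fixes m x :: int
  assumes "1 \<le> m" "1 \<le> x" "m - 1 \<le> 2*x" "x \<le> m"
  shows "submonoid_gen {7, 7*m + 3, 7*x + 5, 7*m + 7*x + 4, 7*m + 7*x + 6, 7*m + 7*x + 9}
      = kset 7 (\<lambda>i. [0, m + x + 1, m + x + 1, m, m + x, x, m + x] ! nat i)" (is ?A)
    and "gap_sums_cover (submonoid_gen {7, 7*m + 3, 7*x + 5, 7*m + 7*x + 4, 7*m + 7*x + 6, 7*m + 7*x + 9})"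
proof -
  show A: ?A
    by (rule submonoid_gen_eq_kset[where xss =
          "[[], [7*m + 3, 7*x + 5], [7*m + 7*x + 9], [7*m + 3], [7*m + 7*x + 4], [7*x + 5],
            [7*m + 7*x + 6]]"])
      (use assms in simp_all)
  show "gap_sums_cover (submonoid_gen {7, 7*m + 3, 7*x + 5, 7*m + 7*x + 4, 7*m + 7*x + 6, 7*m + 7*x + 9})"
    unfolding A
    by (rule gap_sums_cover_kset[where q = "m + x" and r = 2 and ds = "[0, 1, 3, 5]"])
      (use assms in simp_all)
qed

section \<open>Families of multiplicity 8\<close>

lemma family_24:
  fixes m x :: int
  assumes "1 \<le> x" "x \<le> m"
  shows "submonoid_gen {8, 8*m + 1, 8*m + 3, 8*x + 4, 8*m + 8*x + 2, 8*m + 8*x + 6}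
      = kset 8 (\<lambda>i. [0, m, m + x, m, x, m + x, m + x, m + x] ! nat i)" (is ?A)
    and "gap_sums_cover (submonoid_gen {8, 8*m + 1, 8*m + 3, 8*x + 4, 8*m + 8*x + 2, 8*m + 8*x + 6})"
proof -
  show A: ?A
    by (rule submonoid_gen_eq_kset[where xss =
          "[[], [8*m + 1], [8*m + 8*x + 2], [8*m + 3], [8*x + 4], [8*m + 1, 8*x + 4],
            [8*m + 8*x + 6], [8*m + 3, 8*x + 4]]"])
      (use assms in simp_all)
  show "gap_sums_cover (submonoid_gen {8, 8*m + 1, 8*m + 3, 8*x + 4, 8*m + 8*x + 2, 8*m + 8*x + 6})"
    unfolding A
    by (rule gap_sums_cover_kset[where q = "m + x - 1" and r = 7 and ds = "[0, 1, 2, 5]"])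
      (use assms in simp_all)
qed

lemma family_25:
  fixes m x :: int
  assumes "1 \<le> m" "m \<le> x"
  shows "submonoid_gen {8, 8*m + 4, 8*x + 5, 8*x + 7, 8*m + 8*x + 6, 8*m + 8*x + 10}
      = kset 8 (\<lambda>i. [0, m + x + 1, m + x + 1, m + x + 1, m, x, m + x, x] ! nat i)" (is ?A)
    and "gap_sums_cover (submonoid_gen {8, 8*m + 4, 8*x + 5, 8*x + 7, 8*m + 8*x + 6, 8*m + 8*x + 10})"
proof -
  show A: ?A
    by (rule submonoid_gen_eq_kset[where xss =
          "[[], [8*m + 4, 8*x + 5], [8*m + 8*x + 10], [8*m + 4, 8*x + 7], [8*m + 4], [8*x + 5],
            [8*m + 8*x + 6], [8*x + 7]]"])
      (use assms in simp_all)
  show "gap_sums_cover (submonoid_gen {8, 8*m + 4, 8*x + 5, 8*x + 7, 8*m + 8*x + 6, 8*m + 8*x + 10})"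
    unfolding A
    by (rule gap_sums_cover_kset[where q = "m + x" and r = 3 and ds = "[0, 1, 2, 5]"])
      (use assms in simp_all)
qed

lemma family_26:
  fixes m x :: int
  assumes "1 \<le> m" "m \<le> x" "x \<le> 2*m"
  shows "submonoid_gen {8, 8*m + 3, 8*x + 6, 8*x + 7, 8*m + 8*x + 12, 8*m + 8*x + 13}
      = kset 8 (\<lambda>i. [0, m + x + 1, m + x + 1, m, m + x + 1, m + x + 1, x, x] ! nat i)" (is ?A)
    and "gap_sums_cover (submonoid_gen {8, 8*m + 3, 8*x + 6, 8*x + 7, 8*m + 8*x + 12, 8*m + 8*x + 13})"
proof -
  show A: ?A
    by (rule submonoid_gen_eq_kset[where xss =
          "[[], [8*m + 3, 8*x + 6], [8*m + 3, 8*x + 7], [8*m + 3], [8*m + 8*x + 12],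
            [8*m + 8*x + 13], [8*x + 6], [8*x + 7]]"])
      (use assms in simp_all)
  show "gap_sums_cover (submonoid_gen {8, 8*m + 3, 8*x + 6, 8*x + 7, 8*m + 8*x + 12, 8*m + 8*x + 13})"
    unfolding A
    by (rule gap_sums_cover_kset[where q = "m + x" and r = 5 and ds = "[0, 1, 3, 4]"])
      (use assms in simp_all)
qed

lemma family_27:
  fixes m x :: int
  assumes "1 \<le> m" "1 \<le> x" "m - 1 \<le> 2*x" "x \<le> m - 1"
  shows "submonoid_gen {8, 8*m + 3, 8*m + 6, 8*x + 7, 8*m + 8*x + 9, 8*m + 8*x + 12}
      = kset 8 (\<lambda>i. [0, m + x + 1, m + x + 1, m, m + x + 1, m + x + 1, m, x] ! nat i)" (is ?A)
    and "gap_sums_cover (submonoid_gen {8, 8*m + 3, 8*m + 6, 8*x + 7, 8*m + 8*x + 9, 8*m + 8*x + 12})"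
proof -
  show A: ?A
    by (rule submonoid_gen_eq_kset[where xss =
          "[[], [8*m + 8*x + 9], [8*m + 3, 8*x + 7], [8*m + 3], [8*m + 8*x + 12],
            [8*m + 6, 8*x + 7], [8*m + 6], [8*x + 7]]"])
      (use assms in simp_all)
  show "gap_sums_cover (submonoid_gen {8, 8*m + 3, 8*m + 6, 8*x + 7, 8*m + 8*x + 9, 8*m + 8*x + 12})"
    unfolding A
    by (rule gap_sums_cover_kset[where q = "m + x" and r = 5 and ds = "[0, 1, 3, 4]"])
      (use assms in simp_all)
qed

lemma family_28:
  fixes m x :: int
  assumes "1 \<le> x" "x \<le> m - 1"
  shows "submonoid_gen {8, 8*m - 1, 8*m + 1, 8*x + 4, 8*m + 8*x + 2, 8*m + 8*x + 6}
      = kset 8 (\<lambda>i. [0, m, m + x, m + x, x, m + x, m + x, m - 1] ! nat i)" (is ?A)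
    and "gap_sums_cover (submonoid_gen {8, 8*m - 1, 8*m + 1, 8*x + 4, 8*m + 8*x + 2, 8*m + 8*x + 6})"
proof -
  show A: ?A
    by (rule submonoid_gen_eq_kset[where xss =
          "[[], [8*m + 1], [8*m + 8*x + 2], [8*m - 1, 8*x + 4], [8*x + 4], [8*m + 1, 8*x + 4],
            [8*m + 8*x + 6], [8*m - 1]]"])
      (use assms in simp_all)
  show "gap_sums_cover (submonoid_gen {8, 8*m - 1, 8*m + 1, 8*x + 4, 8*m + 8*x + 2, 8*m + 8*x + 6})"
    unfolding A
    by (rule gap_sums_cover_kset[where q = "m + x - 1" and r = 6 and ds = "[0, 1, 3, 4]"])
      (use assms in simp_all)
qed

lemma family_29:
  fixes m x :: int
  assumes "1 \<le> m" "m \<le> x" "x \<le> 2*m"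
  shows "submonoid_gen {8, 8*m + 1, 8*x + 2, 8*x + 5, 8*m + 8*x + 4, 8*m + 8*x + 7}
      = kset 8 (\<lambda>i. [0, m, x, m + x, m + x, x, m + x, m + x] ! nat i)" (is ?A)
    and "gap_sums_cover (submonoid_gen {8, 8*m + 1, 8*x + 2, 8*x + 5, 8*m + 8*x + 4, 8*m + 8*x + 7})"
proof -
  show A: ?A
    by (rule submonoid_gen_eq_kset[where xss =
          "[[], [8*m + 1], [8*x + 2], [8*m + 1, 8*x + 2], [8*m + 8*x + 4], [8*x + 5],
            [8*m + 1, 8*x + 5], [8*m + 8*x + 7]]"])
      (use assms in simp_all)
  show "gap_sums_cover (submonoid_gen {8, 8*m + 1, 8*x + 2, 8*x + 5, 8*m + 8*x + 4, 8*m + 8*x + 7})"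
    unfolding A
    by (rule gap_sums_cover_kset[where q = "m + x - 1" and r = 7 and ds = "[0, 1, 3, 4]"])
      (use assms in simp_all)
qed

lemma family_30:
  fixes m x :: int
  assumes "1 \<le> m" "1 \<le> x" "m - 1 \<le> 2*x" "x \<le> m - 1"
  shows "submonoid_gen {8, 8*m + 1, 8*m + 2, 8*x + 5, 8*m + 8*x + 3, 8*m + 8*x + 4}
      = kset 8 (\<lambda>i. [0, m, m, m + x, m + x, x, m + x, m + x] ! nat i)" (is ?A)
    and "gap_sums_cover (submonoid_gen {8, 8*m + 1, 8*m + 2, 8*x + 5, 8*m + 8*x + 3, 8*m + 8*x + 4})"
proof -
  show A: ?A
    by (rule submonoid_gen_eq_kset[where xss =
          "[[], [8*m + 1], [8*m + 2], [8*m + 8*x + 3], [8*m + 8*x + 4], [8*x + 5],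
            [8*m + 1, 8*x + 5], [8*m + 2, 8*x + 5]]"])
      (use assms in simp_all)
  show "gap_sums_cover (submonoid_gen {8, 8*m + 1, 8*m + 2, 8*x + 5, 8*m + 8*x + 3, 8*m + 8*x + 4})"
    unfolding A
    by (rule gap_sums_cover_kset[where q = "m + x - 1" and r = 7 and ds = "[0, 1, 3, 4]"])
      (use assms in simp_all)
qed

lemma family_31:
  fixes m x :: int
  assumes "1 \<le> x" "x \<le> m"
  shows "submonoid_gen {8, 8*m + 3, 8*x + 4, 8*m + 5, 8*m + 8*x + 6, 8*m + 8*x + 10}
      = kset 8 (\<lambda>i. [0, m + x + 1, m + x + 1, m, x, m, m + x, m + x] ! nat i)" (is ?A)
    and "gap_sums_cover (submonoid_gen {8, 8*m + 3, 8*x + 4, 8*m + 5, 8*m + 8*x + 6, 8*m + 8*x + 10})"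
proof -
  show A: ?A
    by (rule submonoid_gen_eq_kset[where xss =
          "[[], [8*x + 4, 8*m + 5], [8*m + 8*x + 10], [8*m + 3], [8*x + 4], [8*m + 5],
            [8*m + 8*x + 6], [8*m + 3, 8*x + 4]]"])
      (use assms in simp_all)
  show "gap_sums_cover (submonoid_gen {8, 8*m + 3, 8*x + 4, 8*m + 5, 8*m + 8*x + 6, 8*m + 8*x + 10})"
    unfolding A
    by (rule gap_sums_cover_kset[where q = "m + x" and r = 2 and ds = "[0, 1, 3, 4]"])
      (use assms in simp_all)
qed

section \<open>Families of multiplicity 9\<close>

lemma family_32:
  fixes m x :: int
  assumes "1 \<le> m" "m \<le> x"
  shows "submonoid_gen {9, 9*m + 3, 9*m + 6, 9*x + 7, 9*x + 8}
      = kset 9 (\<lambda>i. [0, m + x + 1, m + x + 1, m, m + x + 1, m + x + 1, m, x, x] ! nat i)" (is ?A)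
    and "gap_sums_cover (submonoid_gen {9, 9*m + 3, 9*m + 6, 9*x + 7, 9*x + 8})"
proof -
  show A: ?A
    by (rule submonoid_gen_eq_kset[where xss =
          "[[], [9*m + 3, 9*x + 7], [9*m + 3, 9*x + 8], [9*m + 3], [9*m + 6, 9*x + 7],
            [9*m + 6, 9*x + 8], [9*m + 6], [9*x + 7], [9*x + 8]]"])
      (use assms in simp_all)
  show "gap_sums_cover (submonoid_gen {9, 9*m + 3, 9*m + 6, 9*x + 7, 9*x + 8})"
    unfolding A
    by (rule gap_sums_cover_kset[where q = "m + x" and r = 5 and ds = "[0, 1, 3, 4]"])
      (use assms in simp_all)
qed

lemma family_33:
  fixes m x :: int
  assumes "3 \<le> m" "2*m - 1 \<le> 3*x" "x \<le> m - 1"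
  shows "submonoid_gen {9, 9*m + 3, 9*m + 6, 9*x + 7, 18*x - 9*m + 8, 18*x + 10, 18*x + 13}
      = kset 9 (\<lambda>i. [0, 2*x + 1, 2*x + 1, m, 2*x + 1, 2*x + 1, m, x, 2*x - m] ! nat i)" (is ?A)
    and "gap_sums_cover (submonoid_gen {9, 9*m + 3, 9*m + 6, 9*x + 7, 18*x - 9*m + 8, 18*x + 10, 18*x + 13})"
proof -
  show A: ?A
    by (rule submonoid_gen_eq_kset[where xss =
          "[[], [18*x + 10], [9*m + 3, 18*x - 9*m + 8], [9*m + 3], [18*x + 13],
            [9*m + 6, 18*x - 9*m + 8], [9*m + 6], [9*x + 7], [18*x - 9*m + 8]]"])
      (use assms in simp_all)
  show "gap_sums_cover (submonoid_gen {9, 9*m + 3, 9*m + 6, 9*x + 7, 18*x - 9*m + 8, 18*x + 10, 18*x + 13})"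
    unfolding A
    by (rule gap_sums_cover_kset[where q = "2*x" and r = 5 and ds = "[0, 1, 3, 4]"])
      (use assms in simp_all)
qed

lemma family_34:
  fixes m x :: int
  assumes "1 \<le> m" "1 \<le> x" "2*m - 2 \<le> 3*x" "x \<le> m - 1"
  shows "submonoid_gen {9, 9*m + 1, 18*m - 9*x - 5, 18*m - 9*x - 2, 9*x + 8, 18*m + 5}
      = kset 9 (\<lambda>i. [0, m, 2*m, 2*m, 2*m - x - 1, 2*m, 2*m, 2*m - x - 1, x] ! nat i)" (is ?A)
    and "gap_sums_cover (submonoid_gen {9, 9*m + 1, 18*m - 9*x - 5, 18*m - 9*x - 2, 9*x + 8, 18*m + 5})"
proof -
  show A: ?A
    by (rule submonoid_gen_eq_kset[where xss =
          "[[], [9*m + 1], [9*m + 1, 9*m + 1], [18*m - 9*x - 5, 9*x + 8], [18*m - 9*x - 5],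
            [18*m + 5], [18*m - 9*x - 2, 9*x + 8], [18*m - 9*x - 2], [9*x + 8]]"])
      (use assms in simp_all)
  show "gap_sums_cover (submonoid_gen {9, 9*m + 1, 18*m - 9*x - 5, 18*m - 9*x - 2, 9*x + 8, 18*m + 5})"
    unfolding A
    by (rule gap_sums_cover_kset[where q = "2*m - 1" and r = 6 and ds = "[0, 1, 3, 4]"])
      (use assms in simp_all)
qed

lemma family_35:
  fixes m x :: int
  assumes "1 \<le> m" "1 \<le> x" "m - 1 \<le> 2*x" "x \<le> m - 1"
  shows "submonoid_gen {9, 9*m - 2, 9*m - 1, 9*m + 1, 9*x + 4, 9*m + 9*x + 6}
      = kset 9 (\<lambda>i. [0, m, m + x, m + x, x, m + x, m + x, m - 1, m - 1] ! nat i)" (is ?A)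
    and "gap_sums_cover (submonoid_gen {9, 9*m - 2, 9*m - 1, 9*m + 1, 9*x + 4, 9*m + 9*x + 6})"
proof -
  show A: ?A
    by (rule submonoid_gen_eq_kset[where xss =
          "[[], [9*m + 1], [9*m - 2, 9*x + 4], [9*m - 1, 9*x + 4], [9*x + 4], [9*m + 1, 9*x + 4],
            [9*m + 9*x + 6], [9*m - 2], [9*m - 1]]"])
      (use assms in simp_all)
  show "gap_sums_cover (submonoid_gen {9, 9*m - 2, 9*m - 1, 9*m + 1, 9*x + 4, 9*m + 9*x + 6})"
    unfolding A
    by (rule gap_sums_cover_kset[where q = "m + x - 1" and r = 6 and ds = "[0, 1, 3, 4]"])
      (use assms in simp_all)
qed

lemma family_36:
  fixes m x :: int
  assumes "1 \<le> m" "m \<le> x" "2*x \<le> 3*m - 1"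
  shows "submonoid_gen {9, 9*m + 1, 18*x - 9*m + 11, 18*x - 9*m + 14, 9*x + 8, 18*x + 13}
      = kset 9 (\<lambda>i.
          [0, m, 2*x - m + 1, 2*x + 1, 2*x + 1, 2*x - m + 1, 2*x + 1, 2*x + 1, x] ! nat i)" (is ?A)
    and "gap_sums_cover (submonoid_gen {9, 9*m + 1, 18*x - 9*m + 11, 18*x - 9*m + 14, 9*x + 8, 18*x + 13})"
proof -
  show A: ?A
    by (rule submonoid_gen_eq_kset[where xss =
          "[[], [9*m + 1], [18*x - 9*m + 11], [9*m + 1, 18*x - 9*m + 11], [18*x + 13],
            [18*x - 9*m + 14], [9*m + 1, 18*x - 9*m + 14], [9*x + 8, 9*x + 8], [9*x + 8]]"])
      (use assms in simp_all)
  show "gap_sums_cover (submonoid_gen {9, 9*m + 1, 18*x - 9*m + 11, 18*x - 9*m + 14, 9*x + 8, 18*x + 13})"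
    unfolding A
    by (rule gap_sums_cover_kset[where q = "2*x" and r = 7 and ds = "[0, 1, 3, 4]"])
      (use assms in simp_all)
qed

lemma family_37:
  fixes m x :: int
  assumes "1 \<le> m" "1 \<le> x" "m - 1 \<le> 2*x" "x \<le> m - 1"
  shows "submonoid_gen {9, 9*m - 1, 9*m + 1, 9*m + 2, 9*x + 5, 9*m + 9*x + 3}
      = kset 9 (\<lambda>i. [0, m, m, m + x, m + x, x, m + x, m + x, m - 1] ! nat i)" (is ?A)
    and "gap_sums_cover (submonoid_gen {9, 9*m - 1, 9*m + 1, 9*m + 2, 9*x + 5, 9*m + 9*x + 3})"
proof -
  show A: ?A
    by (rule submonoid_gen_eq_kset[where xss =
          "[[], [9*m + 1], [9*m + 2], [9*m + 9*x + 3], [9*m - 1, 9*x + 5], [9*x + 5],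
            [9*m + 1, 9*x + 5], [9*m + 2, 9*x + 5], [9*m - 1]]"])
      (use assms in simp_all)
  show "gap_sums_cover (submonoid_gen {9, 9*m - 1, 9*m + 1, 9*m + 2, 9*x + 5, 9*m + 9*x + 3})"
    unfolding A
    by (rule gap_sums_cover_kset[where q = "m + x - 1" and r = 7 and ds = "[0, 1, 3, 4]"])
      (use assms in simp_all)
qed

lemma family_38:
  fixes m x :: int
  assumes "1 \<le> m" "m \<le> x" "x \<le> 2*m"
  shows "submonoid_gen {9, 9*m + 1, 9*x + 2, 18*x - 9*m + 3, 18*x - 9*m + 6, 18*x + 5, 18*x + 8}
      = kset 9 (\<lambda>i. [0, m, x, 2*x - m, 2*x, 2*x, 2*x - m, 2*x, 2*x] ! nat i)" (is ?A)
    and "gap_sums_cover (submonoid_gen {9, 9*m + 1, 9*x + 2, 18*x - 9*m + 3, 18*x - 9*m + 6, 18*x + 5, 18*x + 8})"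
proof -
  show A: ?A
    by (rule submonoid_gen_eq_kset[where xss =
          "[[], [9*m + 1], [9*x + 2], [18*x - 9*m + 3], [9*m + 1, 18*x - 9*m + 3], [18*x + 5],
            [18*x - 9*m + 6], [9*m + 1, 18*x - 9*m + 6], [18*x + 8]]"])
      (use assms in simp_all)
  show "gap_sums_cover (submonoid_gen {9, 9*m + 1, 9*x + 2, 18*x - 9*m + 3, 18*x - 9*m + 6, 18*x + 5, 18*x + 8})"
    unfolding A
    by (rule gap_sums_cover_kset[where q = "2*x - 1" and r = 8 and ds = "[0, 1, 3, 4]"])
      (use assms in simp_all)
qed

lemma family_39:
  fixes m x :: int
  assumes "1 \<le> x" "x \<le> m - 1"
  shows "submonoid_gen {9, 9*x + 3, 9*x + 6, 9*m + 1, 9*m + 2}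
      = kset 9 (\<lambda>i. [0, m, m, x, m + x, m + x, x, m + x, m + x] ! nat i)" (is ?A)
    and "gap_sums_cover (submonoid_gen {9, 9*x + 3, 9*x + 6, 9*m + 1, 9*m + 2})"
proof -
  show A: ?A
    by (rule submonoid_gen_eq_kset[where xss =
          "[[], [9*m + 1], [9*m + 2], [9*x + 3], [9*x + 3, 9*m + 1], [9*x + 3, 9*m + 2], [9*x + 6],
            [9*x + 6, 9*m + 1], [9*x + 6, 9*m + 2]]"])
      (use assms in simp_all)
  show "gap_sums_cover (submonoid_gen {9, 9*x + 3, 9*x + 6, 9*m + 1, 9*m + 2})"
    unfolding A
    by (rule gap_sums_cover_kset[where q = "m + x - 1" and r = 8 and ds = "[0, 1, 3, 4]"])
      (use assms in simp_all)
qed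

lemma family_40:
  fixes m x :: int
  assumes "1 \<le> m" "m \<le> x"
  shows "submonoid_gen {9, 9*m + 3, 9*x + 4, 9*x + 5, 9*m + 6}
      = kset 9 (\<lambda>i. [0, m + x + 1, m + x + 1, m, x, x, m, m + x, m + x] ! nat i)" (is ?A)
    and "gap_sums_cover (submonoid_gen {9, 9*m + 3, 9*x + 4, 9*x + 5, 9*m + 6})"
proof -
  show A: ?A
    by (rule submonoid_gen_eq_kset[where xss =
          "[[], [9*x + 4, 9*m + 6], [9*x + 5, 9*m + 6], [9*m + 3], [9*x + 4], [9*x + 5], [9*m + 6],
            [9*m + 3, 9*x + 4], [9*m + 3, 9*x + 5]]"])
      (use assms in simp_all)
  show "gap_sums_cover (submonoid_gen {9, 9*m + 3, 9*x + 4, 9*x + 5, 9*m + 6})"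
    unfolding A
    by (rule gap_sums_cover_kset[where q = "m + x" and r = 2 and ds = "[0, 1, 3, 4]"])
      (use assms in simp_all)
qed

lemma gap_sums_cover_ffg_type4_family: "ffg_type4_family S \<Longrightarrow> gap_sums_cover S"
  by (induction rule: ffg_type4_family.induct)
    (rule family_1(2) family_2(2) family_3(2) family_4(2) family_5(2) family_6(2) family_7(2)
      family_8(2) family_9(2) family_10(2) family_11(2) family_12(2) family_13(2) family_14(2)
      family_15(2) family_16(2) family_17(2) family_18(2) family_19(2) family_20(2)
      family_21(2) family_22(2) family_23(2) family_24(2) family_25(2) family_26(2)
      family_27(2) family_28(2) family_29(2) family_30(2) family_31(2) family_32(2)
      family_33(2) family_34(2) family_35(2) family_36(2) family_37(2) family_38(2)
      family_39(2) family_40(2), assumption+)+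

section \<open>Solving for the Kunz coordinates\<close>

text \<open>\<open>k\<close> are the Kunz coordinates of a semigroup with multiplicity \<open>e\<close> and Frobenius number
  \<open>F = e * q + r\<close>: the least element congruent to \<open>i\<close> is \<open>e * k i + i\<close>. The set \<open>R\<close> contains the
  residues of all pseudo-Frobenius numbers, and \<open>F - d\<close> is one of these for every \<open>d \<in> D\<close>. The
  names of the lemmas on this locale end with \<open>e\<close>, \<open>r\<close> and the elements of \<open>D\<close>. For \<open>e = 5\<close> the
  fourth difference is unbounded, and \<open>D\<close> contains only the other three.\<close>

locale kunz_type =
  fixes e q r :: int and k :: "int \<Rightarrow> int" and D R :: "int set"
  assumes e_pos: "0 < e"
    and k_0: "k 0 = 0"
    and pos: "\<lbrakk>0 < i; i < e\<rbrakk> \<Longrightarrow> 1 \<le> k i"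
    and bound: "\<lbrakk>0 < i; i < e\<rbrakk> \<Longrightarrow> k i \<le> q + (if i \<le> r then 1 else 0)"
    and sub: "\<lbrakk>0 < i; i < e; 0 < j; j < e\<rbrakk> \<Longrightarrow> k ((i + j) mod e) \<le> k i + k j + (i + j) div e"
    and frob: "d \<in> D \<Longrightarrow> k ((r - d) mod e) = q + (r - d) div e + 1"
    and maxl: "\<lbrakk>i \<in> R; 0 < j; j < e; (i + j) mod e \<noteq> 0\<rbrakk>
      \<Longrightarrow> k ((i + j) mod e) < k i + k j + (i + j) div e"
    and nonmax: "\<lbrakk>0 < i; i < e; i \<notin> R\<rbrakk> \<Longrightarrow> list_ex (\<lambda>j. j \<notin> R \<and> (i + j) mod e \<noteq> 0 \<and>
      k ((i + j) mod e) = k i + k j + (i + j) div e) [1..e-1]"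

lemma ffg_kset:
  assumes "ffg_type4_family G" and "G = kset e k'" and "0 < e"
    and "list_all (\<lambda>i. k i = k' i) [0..e-1]"
  shows "ffg_type4_family (kset e k)"
  using assms kset_cong[of e k k'] by (simp add: list_all_iff)

section \<open>Solving for multiplicity 5\<close>

text \<open>All four nonzero classes are maximal, so \<open>nonmax\<close> is void. Three
  coordinates come from \<open>frob\<close>; for the free one, \<open>bound\<close> yields
  \<open>1 \<le> x\<close> and the strict inequality in \<open>maxl\<close> yields
  \<open>x \<le> m\<close>.\<close>

lemma ffg_kunz_type_5_3_0_1_2:
  assumes "kunz_type 5 q 3 k {0, 1, 2} {1, 2, 3, 4}"
  shows "ffg_type4_family (kset 5 k)"
proof -
  interpret kunz_type 5 q 3 k "{0, 1, 2}" "{1, 2, 3, 4}" by fact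
  have
      "1 \<le> k 1 - k 4" "k 1 - k 4 \<le> k 4" "k 2 = k 1" "k 3 = k 1"
    using
      frob[of 2, simplified] frob[of 1, simplified] frob[of 0, simplified]
      bound[of 4, simplified] maxl[of 4 4, simplified]
    by (smt (verit))+
  then show ?thesis
    by (intro ffg_kset[OF F2[where m = "k 4" and x = "k 1 - k 4"]
        family_2(1)[where m = "k 4" and x = "k 1 - k 4"]])
        (simp_all add: k_0)
qed

lemma ffg_kunz_type_5_4_0_1_2:
  assumes "kunz_type 5 q 4 k {0, 1, 2} {1, 2, 3, 4}"
  shows "ffg_type4_family (kset 5 k)"
proof -
  interpret kunz_type 5 q 4 k "{0, 1, 2}" "{1, 2, 3, 4}" by fact
  have
      "1 \<le> k 2 - k 1 + 1" "k 2 - k 1 + 1 \<le> k 1" "k 3 = k 2" "k 4 = k 2"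
    using
      frob[of 2, simplified] frob[of 1, simplified] frob[of 0, simplified]
      bound[of 1, simplified] maxl[of 1 1, simplified]
    by (smt (verit))+
  then show ?thesis
    by (intro ffg_kset[OF F1[where m = "k 1" and x = "k 2 - k 1 + 1"]
        family_1(1)[where m = "k 1" and x = "k 2 - k 1 + 1"]])
        (simp_all add: k_0)
qed

lemma ffg_kunz_type_5_2_0_1_3:
  assumes "kunz_type 5 q 2 k {0, 1, 3} {1, 2, 3, 4}"
  shows "ffg_type4_family (kset 5 k)"
proof -
  interpret kunz_type 5 q 2 k "{0, 1, 3}" "{1, 2, 3, 4}" by fact
  have
      "1 \<le> k 1 - k 3" "k 1 - k 3 \<le> k 3" "k 2 = k 1" "k 4 = k 1 - 1"
    using
      frob[of 1, simplified] frob[of 0, simplified] frob[of 3, simplified]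
      bound[of 3, simplified] maxl[of 3 3, simplified]
    by (smt (verit))+
  then show ?thesis
    by (intro ffg_kset[OF F4[where m = "k 3" and x = "k 1 - k 3"]
        family_4(1)[where m = "k 3" and x = "k 1 - k 3"]])
        (simp_all add: k_0)
qed

lemma ffg_kunz_type_5_4_0_1_3:
  assumes "kunz_type 5 q 4 k {0, 1, 3} {1, 2, 3, 4}"
  shows "ffg_type4_family (kset 5 k)"
proof -
  interpret kunz_type 5 q 4 k "{0, 1, 3}" "{1, 2, 3, 4}" by fact
  show ?thesis
  \<comment> \<open>Class 2 is free, with \<open>k 2 \<le> q + 1 = k 1\<close>. As \<open>D\<close>
    records only three differences, equality is possible here; then all coordinates agree, which is
    family 1 with \<open>x = 1\<close>.\<close>
  proof (cases "k 1 \<le> k 2")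
    case True
    have
        "1 \<le> k 2 - k 1 + 1" "k 2 - k 1 + 1 \<le> k 1" "k 3 = k 2" "k 4 = k 2"
      using
        True frob[of 3, simplified] frob[of 1, simplified] frob[of 0, simplified]
        bound[of 2, simplified] maxl[of 1 1, simplified]
      by (smt (verit))+
    then show ?thesis
      by (intro ffg_kset[OF F1[where m = "k 1" and x = "k 2 - k 1 + 1"]
          family_1(1)[where m = "k 1" and x = "k 2 - k 1 + 1"]])
          (simp_all add: k_0)
  next
    case False
    have
        "1 \<le> k 1 - k 2" "k 1 - k 2 \<le> k 2 - 1" "k 3 = k 1" "k 4 = k 1"
      using
        False frob[of 3, simplified] frob[of 1, simplified] frob[of 0, simplified]
        maxl[of 2 2, simplified]
      by (smt (verit))+
    then show ?thesis
      by (intro ffg_kset[OF F3[where m = "k 2" and x = "k 1 - k 2"]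
          family_3(1)[where m = "k 2" and x = "k 1 - k 2"]])
          (simp_all add: k_0)
  qed
qed

section \<open>Solving for multiplicity 6\<close>

text \<open>Only one class is outside \<open>R\<close>. By \<open>nonmax\<close> it is its own
  partner, so its double lies in \<open>R\<close>, where \<open>frob\<close> fixes the coordinate;
  hence a single parameter. The residues in \<open>R\<close> follow the order of \<open>D\<close>,
  as \<open>(r - d) mod e\<close>.\<close>

lemma ffg_kunz_type_6_4_0_1_2_3:
  assumes "kunz_type 6 q 4 k {0, 1, 2, 3} {4, 3, 2, 1}"
  shows "ffg_type4_family (kset 6 k)"
proof -
  interpret kunz_type 6 q 4 k "{0, 1, 2, 3}" "{4, 3, 2, 1}" by fact
  have
      "1 \<le> k 5" "k 1 = 2 * k 5 + 1" "k 2 = 2 * k 5 + 1" "k 3 = 2 * k 5 + 1"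
      "k 4 = 2 * k 5 + 1"
    using
      frob[of 3, simplified] frob[of 2, simplified] frob[of 1, simplified]
      frob[of 0, simplified] pos[of 5, simplified] nonmax[of 5, simplified]
    by (smt (verit))+
  then show ?thesis
    by (intro ffg_kset[OF F5[where m = "k 5"]
        family_5(1)[where m = "k 5"]])
        (simp_all add: k_0)
qed

lemma ffg_kunz_type_6_5_0_1_2_3:
  assumes "kunz_type 6 q 5 k {0, 1, 2, 3} {5, 4, 3, 2}"
  shows "ffg_type4_family (kset 6 k)"
proof -
  interpret kunz_type 6 q 5 k "{0, 1, 2, 3}" "{5, 4, 3, 2}" by fact
  have
      "1 \<le> k 1" "k 2 = 2 * k 1" "k 3 = 2 * k 1" "k 4 = 2 * k 1" "k 5 = 2 * k 1"
    using
      frob[of 3, simplified] frob[of 2, simplified] frob[of 1, simplified]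
      frob[of 0, simplified] pos[of 1, simplified] nonmax[of 1, simplified]
    by (smt (verit))+
  then show ?thesis
    by (intro ffg_kset[OF F6[where m = "k 1"]
        family_6(1)[where m = "k 1"]])
        (simp_all add: k_0)
qed

lemma ffg_kunz_type_6_3_0_1_2_4:
  assumes "kunz_type 6 q 3 k {0, 1, 2, 4} {3, 2, 1, 5}"
  shows "ffg_type4_family (kset 6 k)"
proof -
  interpret kunz_type 6 q 3 k "{0, 1, 2, 4}" "{3, 2, 1, 5}" by fact
  have
      "1 \<le> k 4" "k 1 = 2 * k 4 + 1" "k 2 = 2 * k 4 + 1" "k 3 = 2 * k 4 + 1" "k 5 = 2 * k 4"
    using
      frob[of 2, simplified] frob[of 1, simplified] frob[of 0, simplified]
      frob[of 4, simplified] pos[of 4, simplified] nonmax[of 4, simplified]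
    by (smt (verit))+
  then show ?thesis
    by (intro ffg_kset[OF F8[where m = "k 4"]
        family_8(1)[where m = "k 4"]])
        (simp_all add: k_0)
qed

lemma ffg_kunz_type_6_5_0_1_2_4:
  assumes "kunz_type 6 q 5 k {0, 1, 2, 4} {5, 4, 3, 1}"
  shows "ffg_type4_family (kset 6 k)"
proof -
  interpret kunz_type 6 q 5 k "{0, 1, 2, 4}" "{5, 4, 3, 1}" by fact
  have
      "1 \<le> k 2" "k 1 = 2 * k 2" "k 3 = 2 * k 2" "k 4 = 2 * k 2" "k 5 = 2 * k 2"
    using
      frob[of 4, simplified] frob[of 2, simplified] frob[of 1, simplified]
      frob[of 0, simplified] pos[of 2, simplified] nonmax[of 2, simplified]
    by (smt (verit))+
  then show ?thesis
    by (intro ffg_kset[OF F7[where m = "k 2"]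
        family_7(1)[where m = "k 2"]])
        (simp_all add: k_0)
qed

lemma ffg_kunz_type_6_3_0_1_2_5:
  assumes "kunz_type 6 q 3 k {0, 1, 2, 5} {3, 2, 1, 4}"
  shows "ffg_type4_family (kset 6 k)"
proof -
  interpret kunz_type 6 q 3 k "{0, 1, 2, 5}" "{3, 2, 1, 4}" by fact
  have
      "1 \<le> k 5" "k 1 = 2 * k 5 + 2" "k 2 = 2 * k 5 + 2" "k 3 = 2 * k 5 + 2"
      "k 4 = 2 * k 5 + 1"
    using
      frob[of 2, simplified] frob[of 1, simplified] frob[of 0, simplified]
      frob[of 5, simplified] pos[of 5, simplified] nonmax[of 5, simplified]
    by (smt (verit))+
  then show ?thesis
    by (intro ffg_kset[OF F9[where m = "k 5"]
        family_9(1)[where m = "k 5"]])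
        (simp_all add: k_0)
qed

lemma ffg_kunz_type_6_4_0_1_2_5:
  assumes "kunz_type 6 q 4 k {0, 1, 2, 5} {4, 3, 2, 5}"
  shows "ffg_type4_family (kset 6 k)"
proof -
  interpret kunz_type 6 q 4 k "{0, 1, 2, 5}" "{4, 3, 2, 5}" by fact
  have
      "1 \<le> k 1" "k 2 = 2 * k 1" "k 3 = 2 * k 1" "k 4 = 2 * k 1" "k 5 = 2 * k 1 - 1"
    using
      frob[of 2, simplified] frob[of 1, simplified] frob[of 0, simplified]
      frob[of 5, simplified] pos[of 1, simplified] nonmax[of 1, simplified]
    by (smt (verit))+
  then show ?thesis
    by (intro ffg_kset[OF F10[where m = "k 1"]
        family_10(1)[where m = "k 1"]])
        (simp_all add: k_0)
qed

text \<open>The free class 3 could only be its own partner, but \<open>3 + 3\<close> is 0 modulo 6.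
  The same happens in the next lemma.\<close>

lemma not_kunz_type_6_2_0_1_3_4:
  "\<not> kunz_type 6 q 2 k {0, 1, 3, 4} {2, 1, 5, 4}"
proof
  assume "kunz_type 6 q 2 k {0, 1, 3, 4} {2, 1, 5, 4}"
  then interpret kunz_type 6 q 2 k "{0, 1, 3, 4}" "{2, 1, 5, 4}" .
  show False
    using
      nonmax[of 3, simplified]
    by (smt (verit))
qed

lemma not_kunz_type_6_5_0_1_3_4:
  "\<not> kunz_type 6 q 5 k {0, 1, 3, 4} {5, 4, 2, 1}"
proof
  assume "kunz_type 6 q 5 k {0, 1, 3, 4} {5, 4, 2, 1}"
  then interpret kunz_type 6 q 5 k "{0, 1, 3, 4}" "{5, 4, 2, 1}" .
  show False
    using
      nonmax[of 3, simplified]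
    by (smt (verit))
qed

lemma ffg_kunz_type_6_2_0_1_3_5:
  assumes "kunz_type 6 q 2 k {0, 1, 3, 5} {2, 1, 5, 3}"
  shows "ffg_type4_family (kset 6 k)"
proof -
  interpret kunz_type 6 q 2 k "{0, 1, 3, 5}" "{2, 1, 5, 3}" by fact
  have
      "1 \<le> k 4" "k 1 = 2 * k 4 + 1" "k 2 = 2 * k 4 + 1" "k 3 = 2 * k 4" "k 5 = 2 * k 4"
    using
      frob[of 1, simplified] frob[of 0, simplified] frob[of 5, simplified]
      frob[of 3, simplified] pos[of 4, simplified] nonmax[of 4, simplified]
    by (smt (verit))+
  then show ?thesis
    by (intro ffg_kset[OF F11[where m = "k 4"]
        family_11(1)[where m = "k 4"]])
        (simp_all add: k_0)
qed

lemma ffg_kunz_type_6_4_0_1_3_5: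
  assumes "kunz_type 6 q 4 k {0, 1, 3, 5} {4, 3, 1, 5}"
  shows "ffg_type4_family (kset 6 k)"
proof -
  interpret kunz_type 6 q 4 k "{0, 1, 3, 5}" "{4, 3, 1, 5}" by fact
  have
      "1 \<le> k 2" "k 1 = 2 * k 2" "k 3 = 2 * k 2" "k 4 = 2 * k 2" "k 5 = 2 * k 2 - 1"
    using
      frob[of 3, simplified] frob[of 1, simplified] frob[of 0, simplified]
      frob[of 5, simplified] pos[of 2, simplified] nonmax[of 2, simplified]
    by (smt (verit))+
  then show ?thesis
    by (intro ffg_kset[OF F12[where m = "k 2"]
        family_12(1)[where m = "k 2"]])
        (simp_all add: k_0)
qed

section \<open>Solving for multiplicity 7\<close>

text \<open>The two free classes 5 and 6 are partners, which gives the common coordinate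
  \<open>k 5 + k 6 + 1\<close> on \<open>R\<close>. The Kunz inequalities for their doubles bound
  the parameters: \<open>6 + 6\<close> gives \<open>k 5 - 1 \<le> 2 * k 6\<close>, and
  \<open>5 + 5\<close> gives \<open>k 6 \<le> k 5\<close>.\<close>

lemma ffg_kunz_type_7_4_0_1_2_3:
  assumes "kunz_type 7 q 4 k {0, 1, 2, 3} {4, 3, 2, 1}"
  shows "ffg_type4_family (kset 7 k)"
proof -
  interpret kunz_type 7 q 4 k "{0, 1, 2, 3}" "{4, 3, 2, 1}" by fact
  have
      "1 \<le> k 5" "1 \<le> k 6" "k 5 - 1 \<le> 2 * k 6" "k 6 \<le> k 5" "k 1 = k 5 + k 6 + 1"
      "k 2 = k 5 + k 6 + 1" "k 3 = k 5 + k 6 + 1" "k 4 = k 5 + k 6 + 1"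
    using
      frob[of 3, simplified] frob[of 2, simplified] frob[of 1, simplified]
      frob[of 0, simplified] pos[of 6, simplified] sub[of 5 5, simplified]
      sub[of 5 6, simplified] sub[of 6 6, simplified] nonmax[of 5, simplified]
      nonmax[of 6, simplified]
    by (smt (verit))+
  then show ?thesis
    by (intro ffg_kset[OF F13[where m = "k 5" and x = "k 6"]
        family_13(1)[where m = "k 5" and x = "k 6"]])
        (simp_all add: k_0)
qed

text \<open>The free classes 1 and 6 add up to 0 modulo 7, so each is its own partner. Then
  \<open>q + 1\<close> equals both \<open>2 * k 1\<close> and \<open>2 * k 6 + 1\<close>, against
  parity.\<close>

lemma not_kunz_type_7_5_0_1_2_3:
  "\<not> kunz_type 7 q 5 k {0, 1, 2, 3} {5, 4, 3, 2}"
proof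
  assume "kunz_type 7 q 5 k {0, 1, 2, 3} {5, 4, 3, 2}"
  then interpret kunz_type 7 q 5 k "{0, 1, 2, 3}" "{5, 4, 3, 2}" .
  show False
    using
      frob[of 3, simplified] frob[of 0, simplified] nonmax[of 1, simplified]
      nonmax[of 6, simplified]
    by presburger
qed

lemma ffg_kunz_type_7_6_0_1_2_3:
  assumes "kunz_type 7 q 6 k {0, 1, 2, 3} {6, 5, 4, 3}"
  shows "ffg_type4_family (kset 7 k)"
proof -
  interpret kunz_type 7 q 6 k "{0, 1, 2, 3}" "{6, 5, 4, 3}" by fact
  have
      "1 \<le> k 1" "k 1 \<le> k 2" "k 2 \<le> 2 * k 1" "k 3 = k 1 + k 2" "k 4 = k 1 + k 2"
      "k 5 = k 1 + k 2" "k 6 = k 1 + k 2"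
    using
      frob[of 3, simplified] frob[of 2, simplified] frob[of 1, simplified]
      frob[of 0, simplified] pos[of 1, simplified] sub[of 1 1, simplified]
      sub[of 1 2, simplified] sub[of 2 2, simplified] nonmax[of 1, simplified]
      nonmax[of 2, simplified]
    by (smt (verit))+
  then show ?thesis
    by (intro ffg_kset[OF F14[where m = "k 1" and x = "k 2"]
        family_14(1)[where m = "k 1" and x = "k 2"]])
        (simp_all add: k_0)
qed

text \<open>The sums \<open>4 + 4\<close>, \<open>4 + 5\<close> and \<open>5 + 5\<close> all carry
  and land on classes with coordinate \<open>q + 1\<close>. From \<open>q \<le> 2 * k 4\<close>,
  \<open>q \<le> 2 * k 5\<close> and the equations of \<open>nonmax\<close> it follows that
  \<open>k 4 = k 5\<close>, so only one parameter survives.\<close>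

lemma ffg_kunz_type_7_3_0_1_2_4:
  assumes "kunz_type 7 q 3 k {0, 1, 2, 4} {3, 2, 1, 6}"
  shows "ffg_type4_family (kset 7 k)"
proof -
  interpret kunz_type 7 q 3 k "{0, 1, 2, 4}" "{3, 2, 1, 6}" by fact
  have
      "1 \<le> k 4" "k 1 = 2 * k 4 + 1" "k 2 = 2 * k 4 + 1" "k 3 = 2 * k 4 + 1" "k 5 = k 4"
      "k 6 = 2 * k 4"
    using
      frob[of 2, simplified] frob[of 1, simplified] frob[of 0, simplified]
      frob[of 4, simplified] pos[of 4, simplified] sub[of 4 4, simplified]
      sub[of 5 5, simplified] nonmax[of 4, simplified] nonmax[of 5, simplified]
    by (smt (verit))+
  then show ?thesis
    by (intro ffg_kset[OF F16[where m = "k 4"]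
        family_16(1)[where m = "k 4"]])
        (simp_all add: k_0)
qed

text \<open>If 2 and 6 were partners, then \<open>k 2 + k 6 = q\<close>, against
  \<open>q + 1 \<le> 2 * k 2\<close> and \<open>q \<le> 2 * k 6\<close>. If each is its own partner,
  then \<open>q + 1\<close> equals \<open>2 * k 2\<close> and \<open>2 * k 6 + 1\<close>, against
  parity.\<close>

lemma not_kunz_type_7_5_0_1_2_4:
  "\<not> kunz_type 7 q 5 k {0, 1, 2, 4} {5, 4, 3, 1}"
proof
  assume "kunz_type 7 q 5 k {0, 1, 2, 4} {5, 4, 3, 1}"
  then interpret kunz_type 7 q 5 k "{0, 1, 2, 4}" "{5, 4, 3, 1}" .
  show False
    using
      frob[of 4, simplified] frob[of 1, simplified] frob[of 0, simplified]
      sub[of 2 2, simplified] sub[of 6 6, simplified] nonmax[of 2, simplified]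
      nonmax[of 6, simplified]
    by (smt (verit))
qed

lemma ffg_kunz_type_7_6_0_1_2_4:
  assumes "kunz_type 7 q 6 k {0, 1, 2, 4} {6, 5, 4, 2}"
  shows "ffg_type4_family (kset 7 k)"
proof -
  interpret kunz_type 7 q 6 k "{0, 1, 2, 4}" "{6, 5, 4, 2}" by fact
  have
      "1 \<le> k 1" "k 2 = 2 * k 1" "k 3 = k 1" "k 4 = 2 * k 1" "k 5 = 2 * k 1" "k 6 = 2 * k 1"
    using
      frob[of 4, simplified] frob[of 2, simplified] frob[of 1, simplified]
      frob[of 0, simplified] pos[of 1, simplified] sub[of 1 1, simplified]
      sub[of 3 3, simplified] nonmax[of 1, simplified] nonmax[of 3, simplified]
    by (smt (verit))+
  then show ?thesis
    by (intro ffg_kset[OF F15[where m = "k 1"]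
        family_15(1)[where m = "k 1"]])
        (simp_all add: k_0)
qed

lemma ffg_kunz_type_7_3_0_1_2_5:
  assumes "kunz_type 7 q 3 k {0, 1, 2, 5} {3, 2, 1, 5}"
  shows "ffg_type4_family (kset 7 k)"
proof -
  interpret kunz_type 7 q 3 k "{0, 1, 2, 5}" "{3, 2, 1, 5}" by fact
  have
      "1 \<le> k 4" "1 \<le> k 6" "k 4 - 1 \<le> k 6" "k 6 \<le> k 4" "k 1 = k 4 + k 6 + 1"
      "k 2 = k 4 + k 6 + 1" "k 3 = k 4 + k 6 + 1" "k 5 = k 4 + k 6"
    using
      frob[of 2, simplified] frob[of 1, simplified] frob[of 0, simplified]
      frob[of 5, simplified] pos[of 6, simplified] sub[of 4 4, simplified]
      sub[of 6 6, simplified] nonmax[of 4, simplified] nonmax[of 6, simplified]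
    by (smt (verit))+
  then show ?thesis
    by (intro ffg_kset[OF F18[where m = "k 4" and x = "k 6"]
        family_18(1)[where m = "k 4" and x = "k 6"]])
        (simp_all add: k_0)
qed

text \<open>Here 1 and 5 cannot be partners because of the inequalities for \<open>1 + 1\<close> and
  \<open>5 + 5\<close>, and as their own partners they would give
  \<open>q + 1 = 2 * k 1 = 2 * k 5 + 1\<close>.\<close>

lemma not_kunz_type_7_4_0_1_2_5:
  "\<not> kunz_type 7 q 4 k {0, 1, 2, 5} {4, 3, 2, 6}"
proof
  assume "kunz_type 7 q 4 k {0, 1, 2, 5} {4, 3, 2, 6}"
  then interpret kunz_type 7 q 4 k "{0, 1, 2, 5}" "{4, 3, 2, 6}" .
  show False
    using
      frob[of 2, simplified] frob[of 1, simplified] frob[of 5, simplified]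
      sub[of 1 1, simplified] sub[of 5 5, simplified] nonmax[of 1, simplified]
      nonmax[of 5, simplified]
    by (smt (verit))
qed

lemma ffg_kunz_type_7_6_0_1_2_5:
  assumes "kunz_type 7 q 6 k {0, 1, 2, 5} {6, 5, 4, 1}"
  shows "ffg_type4_family (kset 7 k)"
proof -
  interpret kunz_type 7 q 6 k "{0, 1, 2, 5}" "{6, 5, 4, 1}" by fact
  have
      "1 \<le> k 2" "k 1 = 2 * k 2" "k 3 = k 2" "k 4 = 2 * k 2" "k 5 = 2 * k 2" "k 6 = 2 * k 2"
    using
      frob[of 5, simplified] frob[of 2, simplified] frob[of 1, simplified]
      frob[of 0, simplified] pos[of 2, simplified] sub[of 2 2, simplified]
      sub[of 3 3, simplified] nonmax[of 2, simplified] nonmax[of 3, simplified]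
    by (smt (verit))+
  then show ?thesis
    by (intro ffg_kset[OF F17[where m = "k 2"]
        family_17(1)[where m = "k 2"]])
        (simp_all add: k_0)
qed

text \<open>Since \<open>3 + 4\<close> is 0 modulo 7, both free classes are their own partners:
  \<open>q = 2 * k 3\<close> and \<open>q + 1 = 2 * k 4 + 1\<close>. This time the parities agree
  and \<open>k 3 = k 4\<close>.\<close>

lemma ffg_kunz_type_7_2_0_1_3_4:
  assumes "kunz_type 7 q 2 k {0, 1, 3, 4} {2, 1, 6, 5}"
  shows "ffg_type4_family (kset 7 k)"
proof -
  interpret kunz_type 7 q 2 k "{0, 1, 3, 4}" "{2, 1, 6, 5}" by fact
  have
      "1 \<le> k 3" "k 1 = 2 * k 3 + 1" "k 2 = 2 * k 3 + 1" "k 4 = k 3" "k 5 = 2 * k 3"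
      "k 6 = 2 * k 3"
    using
      frob[of 1, simplified] frob[of 0, simplified] frob[of 4, simplified]
      frob[of 3, simplified] pos[of 3, simplified] nonmax[of 3, simplified]
      nonmax[of 4, simplified]
    by (smt (verit))+
  then show ?thesis
    by (intro ffg_kset[OF F21[where m = "k 3"]
        family_21(1)[where m = "k 3"]])
        (simp_all add: k_0)
qed

lemma ffg_kunz_type_7_5_0_1_3_4:
  assumes "kunz_type 7 q 5 k {0, 1, 3, 4} {5, 4, 2, 1}"
  shows "ffg_type4_family (kset 7 k)"
proof -
  interpret kunz_type 7 q 5 k "{0, 1, 3, 4}" "{5, 4, 2, 1}" by fact
  have
      "1 \<le> k 3" "k 3 \<le> k 6" "k 6 \<le> 2 * k 3" "k 1 = k 3 + k 6 + 1"
      "k 2 = k 3 + k 6 + 1" "k 4 = k 3 + k 6 + 1" "k 5 = k 3 + k 6 + 1"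
    using
      frob[of 4, simplified] frob[of 3, simplified] frob[of 1, simplified]
      frob[of 0, simplified] pos[of 6, simplified] sub[of 3 3, simplified]
      sub[of 3 6, simplified] sub[of 6 6, simplified] nonmax[of 3, simplified]
      nonmax[of 6, simplified]
    by (smt (verit))+
  then show ?thesis
    by (intro ffg_kset[OF F19[where m = "k 3" and x = "k 6"]
        family_19(1)[where m = "k 3" and x = "k 6"]])
        (simp_all add: k_0)
qed

lemma ffg_kunz_type_7_6_0_1_3_4:
  assumes "kunz_type 7 q 6 k {0, 1, 3, 4} {6, 5, 3, 2}"
  shows "ffg_type4_family (kset 7 k)"
proof -
  interpret kunz_type 7 q 6 k "{0, 1, 3, 4}" "{6, 5, 3, 2}" by fact
  have
      "1 \<le> k 1" "1 \<le> k 4" "k 1 - 1 \<le> 2 * k 4" "k 4 \<le> k 1" "k 2 = k 1 + k 4"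
      "k 3 = k 1 + k 4" "k 5 = k 1 + k 4" "k 6 = k 1 + k 4"
    using
      frob[of 4, simplified] frob[of 3, simplified] frob[of 1, simplified]
      frob[of 0, simplified] pos[of 4, simplified] sub[of 1 1, simplified]
      sub[of 1 4, simplified] sub[of 4 4, simplified] nonmax[of 1, simplified]
      nonmax[of 4, simplified]
    by (smt (verit))+
  then show ?thesis
    by (intro ffg_kset[OF F20[where m = "k 1" and x = "k 4"]
        family_20(1)[where m = "k 1" and x = "k 4"]])
        (simp_all add: k_0)
qed

lemma ffg_kunz_type_7_2_0_1_3_5:
  assumes "kunz_type 7 q 2 k {0, 1, 3, 5} {2, 1, 6, 4}"
  shows "ffg_type4_family (kset 7 k)"
proof -
  interpret kunz_type 7 q 2 k "{0, 1, 3, 5}" "{2, 1, 6, 4}" by fact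
  have
      "1 \<le> k 3" "1 \<le> k 5" "k 3 - 1 \<le> 2 * k 5" "k 5 \<le> k 3" "k 1 = k 3 + k 5 + 1"
      "k 2 = k 3 + k 5 + 1" "k 4 = k 3 + k 5" "k 6 = k 3 + k 5"
    using
      frob[of 1, simplified] frob[of 0, simplified] frob[of 5, simplified]
      frob[of 3, simplified] pos[of 5, simplified] sub[of 3 3, simplified]
      sub[of 3 5, simplified] sub[of 5 5, simplified] nonmax[of 3, simplified]
      nonmax[of 5, simplified]
    by (smt (verit))+
  then show ?thesis
    by (intro ffg_kset[OF F23[where m = "k 3" and x = "k 5"]
        family_23(1)[where m = "k 3" and x = "k 5"]])
        (simp_all add: k_0)
qed

text \<open>Since \<open>2 + 5\<close> is 0 modulo 7, parity is violated by
  \<open>q + 1 = 2 * k 2 = 2 * k 5 + 1\<close>.\<close>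

lemma not_kunz_type_7_4_0_1_3_5:
  "\<not> kunz_type 7 q 4 k {0, 1, 3, 5} {4, 3, 1, 6}"
proof
  assume "kunz_type 7 q 4 k {0, 1, 3, 5} {4, 3, 1, 6}"
  then interpret kunz_type 7 q 4 k "{0, 1, 3, 5}" "{4, 3, 1, 6}" .
  show False
    using
      frob[of 1, simplified] frob[of 0, simplified] nonmax[of 2, simplified]
      nonmax[of 5, simplified]
    by presburger
qed

lemma ffg_kunz_type_7_6_0_1_3_5:
  assumes "kunz_type 7 q 6 k {0, 1, 3, 5} {6, 5, 3, 1}"
  shows "ffg_type4_family (kset 7 k)"
proof -
  interpret kunz_type 7 q 6 k "{0, 1, 3, 5}" "{6, 5, 3, 1}" by fact
  have
      "1 \<le> k 2" "1 \<le> k 4" "k 2 - 1 \<le> k 4" "k 4 \<le> 2 * k 2" "k 1 = k 2 + k 4"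
      "k 3 = k 2 + k 4" "k 5 = k 2 + k 4" "k 6 = k 2 + k 4"
    using
      frob[of 5, simplified] frob[of 3, simplified] frob[of 1, simplified]
      frob[of 0, simplified] pos[of 4, simplified] sub[of 2 2, simplified]
      sub[of 2 4, simplified] sub[of 4 4, simplified] nonmax[of 2, simplified]
      nonmax[of 4, simplified]
    by (smt (verit))+
  then show ?thesis
    by (intro ffg_kset[OF F22[where m = "k 2" and x = "k 4"]
        family_22(1)[where m = "k 2" and x = "k 4"]])
        (simp_all add: k_0)
qed

section \<open>Solving for multiplicity 8\<close>

lemma ffg_kunz_type_8_3_0_1_2_5:
  assumes "kunz_type 8 q 3 k {0, 1, 2, 5} {3, 2, 1, 6}"
  shows "ffg_type4_family (kset 8 k)"
proof -
  interpret kunz_type 8 q 3 k "{0, 1, 2, 5}" "{3, 2, 1, 6}" by fact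
  have
      "1 \<le> k 4" "k 4 \<le> k 5" "k 1 = k 4 + k 5 + 1" "k 2 = k 4 + k 5 + 1"
      "k 3 = k 4 + k 5 + 1" "k 6 = k 4 + k 5" "k 7 = k 5"
    using
      frob[of 2, simplified] frob[of 1, simplified] frob[of 0, simplified]
      frob[of 5, simplified] pos[of 4, simplified] sub[of 4 5, simplified]
      sub[of 4 7, simplified] sub[of 5 5, simplified] sub[of 7 7, simplified]
      nonmax[of 4, simplified] nonmax[of 5, simplified] nonmax[of 7, simplified]
    by (smt (verit))+
  then show ?thesis
    by (intro ffg_kset[OF F25[where m = "k 4" and x = "k 5"]
        family_25(1)[where m = "k 4" and x = "k 5"]])
        (simp_all add: k_0)
qed

text \<open>The inequalities for \<open>1 + 1\<close> and \<open>6 + 6\<close> exclude 1 and 6 as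
  partners. Every remaining choice of partners for 1 and 6 violates parity or positivity.\<close>

lemma not_kunz_type_8_4_0_1_2_5:
  "\<not> kunz_type 8 q 4 k {0, 1, 2, 5} {4, 3, 2, 7}"
proof
  assume "kunz_type 8 q 4 k {0, 1, 2, 5} {4, 3, 2, 7}"
  then interpret kunz_type 8 q 4 k "{0, 1, 2, 5}" "{4, 3, 2, 7}" .
  show False
    using
      frob[of 2, simplified] frob[of 1, simplified] frob[of 0, simplified]
      frob[of 5, simplified] pos[of 5, simplified] sub[of 1 1, simplified]
      sub[of 5 5, simplified] sub[of 6 6, simplified] nonmax[of 1, simplified]
      nonmax[of 6, simplified]
    by (smt (verit))
qed

lemma not_kunz_type_8_6_0_1_2_5:
  "\<not> kunz_type 8 q 6 k {0, 1, 2, 5} {6, 5, 4, 1}"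
proof
  assume "kunz_type 8 q 6 k {0, 1, 2, 5} {6, 5, 4, 1}"
  then interpret kunz_type 8 q 6 k "{0, 1, 2, 5}" "{6, 5, 4, 1}" .
  show False
    using
      frob[of 5, simplified] frob[of 2, simplified] frob[of 1, simplified]
      frob[of 0, simplified] bound[of 2, simplified] sub[of 2 2, simplified]
      sub[of 3 3, simplified] sub[of 7 7, simplified] nonmax[of 2, simplified]
      nonmax[of 7, simplified]
    by (smt (verit))
qed

lemma ffg_kunz_type_8_7_0_1_2_5:
  assumes "kunz_type 8 q 7 k {0, 1, 2, 5} {7, 6, 5, 2}"
  shows "ffg_type4_family (kset 8 k)"
proof -
  interpret kunz_type 8 q 7 k "{0, 1, 2, 5}" "{7, 6, 5, 2}" by fact
  have
      "1 \<le> k 4" "k 4 \<le> k 1" "k 2 = k 1 + k 4" "k 3 = k 1" "k 5 = k 1 + k 4"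
      "k 6 = k 1 + k 4" "k 7 = k 1 + k 4"
    using
      frob[of 5, simplified] frob[of 2, simplified] frob[of 1, simplified]
      frob[of 0, simplified] pos[of 4, simplified] sub[of 1 1, simplified]
      sub[of 1 4, simplified] sub[of 3 3, simplified] sub[of 3 4, simplified]
      nonmax[of 1, simplified] nonmax[of 3, simplified] nonmax[of 4, simplified]
    by (smt (verit))+
  then show ?thesis
    by (intro ffg_kset[OF F24[where m = "k 1" and x = "k 4"]
        family_24(1)[where m = "k 1" and x = "k 4"]])
        (simp_all add: k_0)
qed

lemma ffg_kunz_type_8_2_0_1_3_4:
  assumes "kunz_type 8 q 2 k {0, 1, 3, 4} {2, 1, 7, 6}"
  shows "ffg_type4_family (kset 8 k)"
proof -
  interpret kunz_type 8 q 2 k "{0, 1, 3, 4}" "{2, 1, 7, 6}" by fact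
  have
      "1 \<le> k 4" "k 4 \<le> k 3" "k 1 = k 3 + k 4 + 1" "k 2 = k 3 + k 4 + 1" "k 5 = k 3"
      "k 6 = k 3 + k 4" "k 7 = k 3 + k 4"
    using
      frob[of 1, simplified] frob[of 0, simplified] frob[of 4, simplified]
      frob[of 3, simplified] pos[of 4, simplified] sub[of 3 3, simplified]
      sub[of 3 4, simplified] sub[of 4 5, simplified] sub[of 5 5, simplified]
      nonmax[of 3, simplified] nonmax[of 4, simplified] nonmax[of 5, simplified]
    by (smt (verit))+
  then show ?thesis
    by (intro ffg_kset[OF F31[where m = "k 3" and x = "k 4"]
        family_31(1)[where m = "k 3" and x = "k 4"]])
        (simp_all add: k_0)
qed

lemma ffg_kunz_type_8_5_0_1_3_4:
  assumes "kunz_type 8 q 5 k {0, 1, 3, 4} {5, 4, 2, 1}"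
  shows "ffg_type4_family (kset 8 k)"
proof -
  interpret kunz_type 8 q 5 k "{0, 1, 3, 4}" "{5, 4, 2, 1}" by fact
  show ?thesis
  \<comment> \<open>Both \<open>3 + 6\<close> and \<open>6 + 7\<close> land on classes with
    coordinate \<open>q + 1\<close>, so \<open>k 3 + k 6\<close> and \<open>k 6 + k 7\<close> are at
    least \<open>q\<close>. Class 6 can attain equality only with the smaller of \<open>k 3\<close>
    and \<open>k 7\<close>.\<close>
  proof (cases "k 3 \<le> k 7")
    case True
    have
        "1 \<le> k 3" "k 3 \<le> k 6" "k 6 \<le> 2 * k 3" "k 1 = k 3 + k 6 + 1"
        "k 2 = k 3 + k 6 + 1" "k 4 = k 3 + k 6 + 1" "k 5 = k 3 + k 6 + 1" "k 7 = k 6"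
      using
        True frob[of 4, simplified] frob[of 3, simplified] frob[of 1, simplified]
        frob[of 0, simplified] pos[of 6, simplified] sub[of 3 3, simplified]
        sub[of 3 6, simplified] sub[of 3 7, simplified] sub[of 6 6, simplified]
        nonmax[of 6, simplified] nonmax[of 7, simplified]
      by (smt (verit))+
    then show ?thesis
      by (intro ffg_kset[OF F26[where m = "k 3" and x = "k 6"]
          family_26(1)[where m = "k 3" and x = "k 6"]])
          (simp_all add: k_0)
  next
    case False
    have
        "1 \<le> k 3" "1 \<le> k 7" "k 3 - 1 \<le> 2 * k 7" "k 7 \<le> k 3 - 1"
        "k 1 = k 3 + k 7 + 1" "k 2 = k 3 + k 7 + 1" "k 4 = k 3 + k 7 + 1" "k 5 = k 3 + k 7 + 1"
        "k 6 = k 3"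
      using
        False frob[of 4, simplified] frob[of 3, simplified] frob[of 1, simplified]
        frob[of 0, simplified] pos[of 7, simplified] sub[of 6 7, simplified]
        sub[of 7 7, simplified] nonmax[of 3, simplified] nonmax[of 6, simplified]
      by (smt (verit))+
    then show ?thesis
      by (intro ffg_kset[OF F27[where m = "k 3" and x = "k 7"]
          family_27(1)[where m = "k 3" and x = "k 7"]])
          (simp_all add: k_0)
  qed
qed

lemma ffg_kunz_type_8_6_0_1_3_4:
  assumes "kunz_type 8 q 6 k {0, 1, 3, 4} {6, 5, 3, 2}"
  shows "ffg_type4_family (kset 8 k)"
proof -
  interpret kunz_type 8 q 6 k "{0, 1, 3, 4}" "{6, 5, 3, 2}" by fact
  have
      "1 \<le> k 4" "k 4 \<le> k 1 - 1" "k 2 = k 1 + k 4" "k 3 = k 1 + k 4" "k 5 = k 1 + k 4"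
      "k 6 = k 1 + k 4" "k 7 = k 1 - 1"
    using
      frob[of 4, simplified] frob[of 3, simplified] frob[of 1, simplified]
      frob[of 0, simplified] pos[of 4, simplified] sub[of 1 1, simplified]
      sub[of 1 4, simplified] sub[of 4 7, simplified] sub[of 7 7, simplified]
      nonmax[of 1, simplified] nonmax[of 7, simplified]
    by (smt (z3))+
  then show ?thesis
    by (intro ffg_kset[OF F28[where m = "k 1" and x = "k 4"]
        family_28(1)[where m = "k 1" and x = "k 4"]])
        (simp_all add: k_0)
qed

lemma ffg_kunz_type_8_7_0_1_3_4:
  assumes "kunz_type 8 q 7 k {0, 1, 3, 4} {7, 6, 4, 3}"
  shows "ffg_type4_family (kset 8 k)"
proof -
  interpret kunz_type 8 q 7 k "{0, 1, 3, 4}" "{7, 6, 4, 3}" by fact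
  show ?thesis
  \<comment> \<open>Class 2 competes for a partner between 1 and 5: \<open>1 + 2\<close> and
    \<open>2 + 5\<close> both land on coordinate \<open>q + 1\<close>, so only the smaller of
    \<open>k 1\<close> and \<open>k 5\<close> can give equality.\<close>
  proof (cases "k 1 \<le> k 5")
    case True
    have
        "1 \<le> k 1" "k 1 \<le> k 2" "k 2 \<le> 2 * k 1" "k 3 = k 1 + k 2" "k 4 = k 1 + k 2"
        "k 5 = k 2" "k 6 = k 1 + k 2" "k 7 = k 1 + k 2"
      using
        True frob[of 4, simplified] frob[of 3, simplified] frob[of 1, simplified]
        frob[of 0, simplified] pos[of 1, simplified] sub[of 1 1, simplified]
        sub[of 1 2, simplified] sub[of 1 5, simplified] sub[of 2 2, simplified]
        nonmax[of 2, simplified] nonmax[of 5, simplified]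
      by (smt (verit))+
    then show ?thesis
      by (intro ffg_kset[OF F29[where m = "k 1" and x = "k 2"]
          family_29(1)[where m = "k 1" and x = "k 2"]])
          (simp_all add: k_0)
  next
    case False
    have
        "1 \<le> k 1" "1 \<le> k 5" "k 1 - 1 \<le> 2 * k 5" "k 5 \<le> k 1 - 1" "k 2 = k 1"
        "k 3 = k 1 + k 5" "k 4 = k 1 + k 5" "k 6 = k 1 + k 5" "k 7 = k 1 + k 5"
      using
        False frob[of 4, simplified] frob[of 3, simplified] frob[of 1, simplified]
        frob[of 0, simplified] pos[of 5, simplified] sub[of 2 5, simplified]
        sub[of 5 5, simplified] nonmax[of 1, simplified] nonmax[of 2, simplified]
      by (smt (verit))+
    then show ?thesis
      by (intro ffg_kset[OF F30[where m = "k 1" and x = "k 5"]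
          family_30(1)[where m = "k 1" and x = "k 5"]])
          (simp_all add: k_0)
  qed
qed

section \<open>Solving for multiplicity 9\<close>

lemma ffg_kunz_type_9_2_0_1_3_4:
  assumes "kunz_type 9 q 2 k {0, 1, 3, 4} {2, 1, 8, 7}"
  shows "ffg_type4_family (kset 9 k)"
proof -
  interpret kunz_type 9 q 2 k "{0, 1, 3, 4}" "{2, 1, 8, 7}" by fact
  have
      "1 \<le> k 3" "k 3 \<le> k 4" "k 1 = k 3 + k 4 + 1" "k 2 = k 3 + k 4 + 1" "k 5 = k 4"
      "k 6 = k 3" "k 7 = k 3 + k 4" "k 8 = k 3 + k 4"
    using
      frob[of 1, simplified] frob[of 0, simplified] frob[of 4, simplified]
      frob[of 3, simplified] pos[of 6, simplified] sub[of 3 4, simplified]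
      sub[of 3 5, simplified] sub[of 4 4, simplified] sub[of 4 6, simplified]
      sub[of 5 5, simplified] sub[of 5 6, simplified] nonmax[of 3, simplified]
      nonmax[of 4, simplified] nonmax[of 5, simplified] nonmax[of 6, simplified]
    by (smt (verit))+
  then show ?thesis
    by (intro ffg_kset[OF F40[where m = "k 3" and x = "k 4"]
        family_40(1)[where m = "k 3" and x = "k 4"]])
        (simp_all add: k_0)
qed

lemma ffg_kunz_type_9_5_0_1_3_4:
  assumes "kunz_type 9 q 5 k {0, 1, 3, 4} {5, 4, 2, 1}"
  shows "ffg_type4_family (kset 9 k)"
proof -
  interpret kunz_type 9 q 5 k "{0, 1, 3, 4}" "{5, 4, 2, 1}" by fact
  show ?thesis
  \<comment> \<open>As \<open>7 + 7\<close> lands on class 5, \<open>q \<le> 2 * k 7\<close>. If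
    \<open>k 7 < k 3\<close>, this excludes 3 as a partner of 7, and 7 ends up as its own
    partner.\<close>
  proof (cases "k 3 \<le> k 7")
    case True
    have
        "1 \<le> k 3" "k 3 \<le> k 7" "k 1 = k 3 + k 7 + 1" "k 2 = k 3 + k 7 + 1"
        "k 4 = k 3 + k 7 + 1" "k 5 = k 3 + k 7 + 1" "k 6 = k 3" "k 8 = k 7"
      using
        True frob[of 4, simplified] frob[of 3, simplified] frob[of 1, simplified]
        frob[of 0, simplified] pos[of 6, simplified] sub[of 3 7, simplified]
        sub[of 3 8, simplified] sub[of 6 7, simplified] sub[of 6 8, simplified]
        sub[of 8 8, simplified] nonmax[of 3, simplified] nonmax[of 6, simplified]
        nonmax[of 7, simplified] nonmax[of 8, simplified]
      by (smt (verit))+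
    then show ?thesis
      by (intro ffg_kset[OF F32[where m = "k 3" and x = "k 7"]
          family_32(1)[where m = "k 3" and x = "k 7"]])
          (simp_all add: k_0)
  next
    case False
    \<comment> \<open>The bound \<open>3 \<le> k 3\<close> comes from
      \<open>1 \<le> k 8 = 2 * k 7 - k 3\<close> and \<open>k 7 \<le> k 3 - 1\<close>; the
      inequality for \<open>8 + 8\<close> gives \<open>2 * k 3 - 1 \<le> 3 * k 7\<close>.\<close>
    have
        "3 \<le> k 3" "2 * k 3 - 1 \<le> 3 * k 7" "k 7 \<le> k 3 - 1" "k 1 = 2 * k 7 + 1"
        "k 2 = 2 * k 7 + 1" "k 4 = 2 * k 7 + 1" "k 5 = 2 * k 7 + 1" "k 6 = k 3"
        "k 8 = 2 * k 7 - k 3"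
      using
        False frob[of 4, simplified] frob[of 3, simplified] frob[of 1, simplified]
        frob[of 0, simplified] pos[of 8, simplified] bound[of 6, simplified]
        sub[of 6 8, simplified] sub[of 7 7, simplified] sub[of 8 8, simplified]
        nonmax[of 3, simplified] nonmax[of 6, simplified] nonmax[of 7, simplified]
      by (smt (verit))+
    then show ?thesis
      by (intro ffg_kset[OF F33[where m = "k 3" and x = "k 7"]
          family_33(1)[where m = "k 3" and x = "k 7"]])
          (simp_all add: k_0)
  qed
qed

lemma ffg_kunz_type_9_6_0_1_3_4:
  assumes "kunz_type 9 q 6 k {0, 1, 3, 4} {6, 5, 3, 2}"
  shows "ffg_type4_family (kset 9 k)"
proof -
  interpret kunz_type 9 q 6 k "{0, 1, 3, 4}" "{6, 5, 3, 2}" by fact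
  show ?thesis
  \<comment> \<open>The sums \<open>1 + 1\<close> and \<open>1 + 4\<close> land on coordinate
    \<open>q + 1\<close>. In the first case class 1 is its own partner; if \<open>k 4 < k 1\<close>,
    the inequality for \<open>1 + 4\<close> excludes that.\<close>
  proof (cases "k 1 \<le> k 4")
    case True
    have
        "1 \<le> k 1" "1 \<le> k 8" "2 * k 1 - 2 \<le> 3 * k 8" "k 8 \<le> k 1 - 1"
        "k 2 = 2 * k 1" "k 3 = 2 * k 1" "k 4 = 2 * k 1 - k 8 - 1" "k 5 = 2 * k 1"
        "k 6 = 2 * k 1" "k 7 = 2 * k 1 - k 8 - 1"
      using
        True frob[of 4, simplified] frob[of 3, simplified] frob[of 1, simplified]
        frob[of 0, simplified] pos[of 6, simplified] pos[of 8, simplified]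
        sub[of 1 1, simplified] sub[of 4 8, simplified] sub[of 7 7, simplified]
        sub[of 8 8, simplified] nonmax[of 1, simplified] nonmax[of 4, simplified]
        nonmax[of 7, simplified] nonmax[of 8, simplified]
      by (smt (z3))+
    then show ?thesis
      by (intro ffg_kset[OF F34[where m = "k 1" and x = "k 8"]
          family_34(1)[where m = "k 1" and x = "k 8"]])
          (simp_all add: k_0)
  next
    case False
    have
        "1 \<le> k 1" "1 \<le> k 4" "k 1 - 1 \<le> 2 * k 4" "k 4 \<le> k 1 - 1"
        "k 2 = k 1 + k 4" "k 3 = k 1 + k 4" "k 5 = k 1 + k 4" "k 6 = k 1 + k 4" "k 7 = k 1 - 1"
        "k 8 = k 1 - 1"
      using
        False frob[of 4, simplified] frob[of 3, simplified] frob[of 1, simplified]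
        frob[of 0, simplified] pos[of 4, simplified] sub[of 1 4, simplified]
        sub[of 4 4, simplified] sub[of 4 7, simplified] sub[of 4 8, simplified]
        sub[of 7 7, simplified] nonmax[of 1, simplified] nonmax[of 4, simplified]
        nonmax[of 7, simplified] nonmax[of 8, simplified]
      by (smt (verit))+
    then show ?thesis
      by (intro ffg_kset[OF F35[where m = "k 1" and x = "k 4"]
          family_35(1)[where m = "k 1" and x = "k 4"]])
          (simp_all add: k_0)
  qed
qed

lemma ffg_kunz_type_9_7_0_1_3_4:
  assumes "kunz_type 9 q 7 k {0, 1, 3, 4} {7, 6, 4, 3}"
  shows "ffg_type4_family (kset 9 k)"
proof -
  interpret kunz_type 9 q 7 k "{0, 1, 3, 4}" "{7, 6, 4, 3}" by fact
  show ?thesis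
  \<comment> \<open>The sums \<open>1 + 5\<close> and \<open>2 + 5\<close> land on coordinate
    \<open>q + 1\<close>, so \<open>k 1 < k 2\<close> excludes 5 as a partner of 2.\<close>
  proof (cases "k 1 \<le> k 2 - 1")
    case True
    have
        "1 \<le> k 1" "k 1 \<le> k 8" "2 * k 8 \<le> 3 * k 1 - 1" "k 2 = 2 * k 8 - k 1 + 1"
        "k 3 = 2 * k 8 + 1" "k 4 = 2 * k 8 + 1" "k 5 = 2 * k 8 - k 1 + 1" "k 6 = 2 * k 8 + 1"
        "k 7 = 2 * k 8 + 1"
      using
        True frob[of 4, simplified] frob[of 3, simplified] frob[of 1, simplified]
        frob[of 0, simplified] pos[of 8, simplified] sub[of 1 1, simplified]
        sub[of 1 5, simplified] sub[of 8 8, simplified] nonmax[of 2, simplified]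
        nonmax[of 5, simplified] nonmax[of 8, simplified]
      by (smt (z3))+
    then show ?thesis
      by (intro ffg_kset[OF F36[where m = "k 1" and x = "k 8"]
          family_36(1)[where m = "k 1" and x = "k 8"]])
          (simp_all add: k_0)
  next
    case False
    have
        "1 \<le> k 1" "1 \<le> k 5" "k 1 - 1 \<le> 2 * k 5" "k 5 \<le> k 1 - 1" "k 2 = k 1"
        "k 3 = k 1 + k 5" "k 4 = k 1 + k 5" "k 6 = k 1 + k 5" "k 7 = k 1 + k 5" "k 8 = k 1 - 1"
      using
        False frob[of 4, simplified] frob[of 3, simplified] frob[of 1, simplified]
        frob[of 0, simplified] pos[of 8, simplified] bound[of 8, simplified]
        sub[of 2 2, simplified] sub[of 2 5, simplified] sub[of 5 5, simplified]
        sub[of 5 8, simplified] sub[of 8 8, simplified] nonmax[of 1, simplified]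
        nonmax[of 8, simplified]
      by (smt (z3))+
    then show ?thesis
      by (intro ffg_kset[OF F37[where m = "k 1" and x = "k 5"]
          family_37(1)[where m = "k 1" and x = "k 5"]])
          (simp_all add: k_0)
  qed
qed

lemma ffg_kunz_type_9_8_0_1_3_4:
  assumes "kunz_type 9 q 8 k {0, 1, 3, 4} {8, 7, 5, 4}"
  shows "ffg_type4_family (kset 9 k)"
proof -
  interpret kunz_type 9 q 8 k "{0, 1, 3, 4}" "{8, 7, 5, 4}" by fact
  show ?thesis
  \<comment> \<open>In the first case class 2 is its own partner, \<open>k 4 = 2 * k 2\<close>; in
    the second, classes 1 and 2 are both completed by 3 and by 6.\<close>
  proof (cases "k 1 \<le> k 3")
    case True
    have
        "1 \<le> k 1" "k 1 \<le> k 2" "k 2 \<le> 2 * k 1" "k 3 = 2 * k 2 - k 1" "k 4 = 2 * k 2"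
        "k 5 = 2 * k 2" "k 6 = 2 * k 2 - k 1" "k 7 = 2 * k 2" "k 8 = 2 * k 2"
      using
        True frob[of 4, simplified] frob[of 3, simplified] frob[of 1, simplified]
        frob[of 0, simplified] pos[of 6, simplified] sub[of 1 1, simplified]
        sub[of 1 3, simplified] sub[of 1 6, simplified] sub[of 2 2, simplified]
        nonmax[of 2, simplified] nonmax[of 3, simplified] nonmax[of 6, simplified]
      by (smt (verit))+
    then show ?thesis
      by (intro ffg_kset[OF F38[where m = "k 1" and x = "k 2"]
          family_38(1)[where m = "k 1" and x = "k 2"]])
          (simp_all add: k_0)
  next
    case False
    have
        "1 \<le> k 3" "k 3 \<le> k 1 - 1" "k 2 = k 1" "k 4 = k 1 + k 3" "k 5 = k 1 + k 3"
        "k 6 = k 3" "k 7 = k 1 + k 3" "k 8 = k 1 + k 3"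
      using
        False frob[of 4, simplified] frob[of 3, simplified] frob[of 1, simplified]
        frob[of 0, simplified] pos[of 2, simplified] pos[of 6, simplified]
        sub[of 1 3, simplified] sub[of 1 6, simplified] sub[of 2 3, simplified]
        sub[of 2 6, simplified] nonmax[of 1, simplified] nonmax[of 2, simplified]
        nonmax[of 3, simplified] nonmax[of 6, simplified]
      by (smt (verit))+
    then show ?thesis
      by (intro ffg_kset[OF F39[where m = "k 1" and x = "k 3"]
          family_39(1)[where m = "k 1" and x = "k 3"]])
          (simp_all add: k_0)
  qed
qed

section \<open>The classification\<close>

definition pseudo_frobenius :: "int set \<Rightarrow> int set" where
  "pseudo_frobenius S = {x. x \<notin> S \<and> (\<forall>h\<in>S. h \<noteq> 0 \<longrightarrow> x + h \<in> S)}"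

lemma ex_kunz_coordinates:
  fixes S :: "int set"
  assumes S: "add_submonoid S" "S \<subseteq> {0..}" "\<forall>n\<ge>N. n \<in> S" and e: "e \<in> S" "0 < e"
  obtains k where "S = kset e k" "k 0 = 0"
proof
  define k where "k i = int (LEAST n. e * int n + i \<in> S)" for i
  have k: "e * k i + i \<in> S" if "0 \<le> i" for i
  proof -
    have "int (nat N) \<le> e * int (nat N)" using mult_right_mono[of 1 e "int (nat N)"] e(2) by simp
    then have "N \<le> e * int (nat N) + i" using that by linarith
    then have "e * int (nat N) + i \<in> S" using S(3) by blast
    then show ?thesis unfolding k_def by (rule LeastI)
  qed
  show "S = kset e k"
  proof (intro set_eqI iffI)
    fix z
    let ?i = "z mod e" and ?q = "z div e"
    have i: "0 \<le> ?i" "?i < e" using e(2) by simp_all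
    have z: "z = e * ?q + ?i" by simp
    {
      assume "z \<in> S"
      then have "0 \<le> ?q" using S(2) e(2) by (auto simp: pos_imp_zdiv_nonneg_iff)
      then have "(LEAST n. e * int n + ?i \<in> S) \<le> nat ?q" using \<open>z \<in> S\<close> by (intro Least_le) simp
      then show "z \<in> kset e k" using \<open>0 \<le> ?q\<close> by (simp add: kset_def k_def)
    next
      assume "z \<in> kset e k"
      then have "e * (?q - k ?i) \<in> S" using mult_in_submonoid[OF S(1) e(1)] by (simp add: kset_def)
      then have "e * (?q - k ?i) + (e * k ?i + ?i) \<in> S" using k[OF i(1)] S(1) by (simp add: add_submonoid_def)
      then show "z \<in> S" by (simp add: algebra_simps)
    }
  qed
  have "(LEAST n. e * int n + 0 \<in> S) \<le> 0" using S(1) by (intro Least_le) (simp add: add_submonoid_def)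
  then show "k 0 = 0" by (simp add: k_def)
qed

text \<open>Pseudo-Frobenius numbers are the Apery elements, lowered by \<open>e\<close>, that are
  maximal when \<open>a\<close> is put below \<open>b\<close> whenever \<open>b - a\<close> is in
  the semigroup. \<open>R\<close> marks their classes; \<open>maxl\<close> and \<open>nonmax\<close>
  express the maximality, and its failure elsewhere, by coordinates.\<close>

lemma kunz_type_pseudo_frobenius:
  assumes S: "add_submonoid (kset e k)" and k0: "k 0 = 0" and e: "0 < e" and r: "r < e"
    and least: "\<And>i. \<lbrakk>0 < i; i < e\<rbrakk> \<Longrightarrow> i \<notin> kset e k"
    and F: "\<And>z. e * q + r < z \<Longrightarrow> z \<in> kset e k"
    and D: "\<And>d. d \<in> D \<Longrightarrow> e * q + r - d \<in> pseudo_frobenius (kset e k)"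
    and R: "R = (\<lambda>f. f mod e) ` pseudo_frobenius (kset e k)"
  shows "kunz_type e q r k D R"
proof -
  have eS: "e \<in> kset e k" using e k0 by (simp add: kset_def)
  have pos: "1 \<le> k i" if "0 < i" "i < e" for i
    using least[OF that] mem_kset[of i e 0 k] that by simp
  have sub: "k ((i + j) mod e) \<le> k i + k j + (i + j) div e"
    if "0 < i" "i < e" "0 < j" "j < e" for i j
  proof -
    have "(e * k i + i) + (e * k j + j) \<in> kset e k"
      using S that by (simp add: add_submonoid_def mem_kset)
    moreover have "(e * k i + i) + (e * k j + j) = e * (k i + k j) + (i + j)" by (simp add: algebra_simps)
    ultimately show ?thesis using e by (simp add: kset_def)
  qed
  have pf: "k (f mod e) = f div e + 1" if "f \<in> pseudo_frobenius (kset e k)" for f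
  proof -
    have "f \<notin> kset e k" "f + e \<in> kset e k" using that eS e by (auto simp: pseudo_frobenius_def)
    then show ?thesis using e by (simp add: kset_def)
  qed
  have maxl: "k ((i + j) mod e) < k i + k j + (i + j) div e" if "i \<in> R" "0 < j" "j < e" for i j
  proof -
    obtain f where f: "f \<in> pseudo_frobenius (kset e k)" "i = f mod e" using \<open>i \<in> R\<close> R by blast
    have "0 < e * k j" using pos[OF that(2,3)] e by simp
    then have "e * k j + j \<noteq> 0" using that(2) by linarith
    moreover have "e * k j + j \<in> kset e k" using that by (simp add: mem_kset)
    ultimately have "f + (e * k j + j) \<in> kset e k" using f(1) by (simp add: pseudo_frobenius_def)
    moreover have "f + (e * k j + j) = e * (f div e + k j) + (i + j)"
      using f(2) mult_div_mod_eq[of e f] by (simp add: algebra_simps)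
    ultimately have "k ((i + j) mod e) \<le> f div e + k j + (i + j) div e"
      using e by (simp add: kset_def)
    then show ?thesis using pf[OF f(1)] f(2) by simp
  qed
  show ?thesis
  proof
    show "0 < e" "k 0 = 0" by fact+
    show "1 \<le> k i" if "0 < i" "i < e" for i by (rule pos[OF that])
    show "k i \<le> q + (if i \<le> r then 1 else 0)" if "0 < i" "i < e" for i
    proof -
      have "e * q + r < e * (q + (if i \<le> r then 1 else 0)) + i"
        using \<open>r < e\<close> that by (simp add: distrib_left)
      then have "e * (q + (if i \<le> r then 1 else 0)) + i \<in> kset e k" by (rule F)
      then show ?thesis using that mem_kset[of i e] by simp
    qed
    show "k ((i + j) mod e) \<le> k i + k j + (i + j) div e"
      if "0 < i" "i < e" "0 < j" "j < e" for i j by (rule sub[OF that])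
    show "k ((r - d) mod e) = q + (r - d) div e + 1" if "d \<in> D" for d
      using pf[OF D[OF that]] e by (simp add: add_diff_eq[symmetric])
    show "k ((i + j) mod e) < k i + k j + (i + j) div e"
      if "i \<in> R" "0 < j" "j < e" "(i + j) mod e \<noteq> 0" for i j by (rule maxl[OF that(1-3)])
    fix i assume i: "0 < i" "i < e" "i \<notin> R"
    \<comment> \<open>This is the Apery element of class \<open>i\<close> minus \<open>e\<close>. It
      is a gap outside the pseudo-Frobenius numbers, so some nonzero \<open>h\<close> of the
      semigroup leads from it to another gap; the class of \<open>h\<close> is the partner of
      \<open>i\<close>.\<close>
    let ?y = "e * (k i - 1) + i"
    have "?y \<notin> kset e k" using i by (simp add: mem_kset)
    moreover have "?y \<notin> pseudo_frobenius (kset e k)"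
    proof
      assume "?y \<in> pseudo_frobenius (kset e k)"
      then have "?y mod e \<in> R" using R by blast
      then show False using i by simp
    qed
    ultimately obtain h where h: "h \<in> kset e k" "h \<noteq> 0" "?y + h \<notin> kset e k"
      by (auto simp: pseudo_frobenius_def)
    define j where "j = h mod e"
    define t where "t = h div e"
    have h_eq: "h = e * t + j" by (simp add: j_def t_def)
    have j: "0 \<le> j" "j < e" using e by (simp_all add: j_def)
    have t: "k j \<le> t" using h(1) by (simp add: kset_def j_def t_def)
    have y_eq: "?y + h = e * (k i - 1 + t) + (i + j)" by (simp add: h_eq algebra_simps)
    have "(?y + h) mod e = (i + j) mod e" "(?y + h) div e = k i - 1 + t + (i + j) div e"
      unfolding y_eq using e by simp_all
    then have lt: "k i - 1 + t + (i + j) div e < k ((i + j) mod e)"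
      using h(3) by (simp only: kset_def mem_Collect_eq not_le)
    have "j \<noteq> 0"
    proof
      assume "j = 0"
      then have "t \<noteq> 0" "0 \<le> t" using h(2) h_eq t k0 by auto
      then show False using lt i \<open>j = 0\<close> by simp
    qed
    then have j': "0 < j" "j < e" using j by simp_all
    \<comment> \<open>\<open>lt\<close> bounds the coordinate of \<open>i + j\<close> from below and
      the Kunz inequality from above; with \<open>k j \<le> t\<close> this leaves only equality and
      \<open>t = k j\<close>.\<close>
    have eq: "k ((i + j) mod e) = k i + k j + (i + j) div e"
      using sub[OF i(1,2) j'] lt t by linarith
    moreover have "(i + j) mod e \<noteq> 0"
    proof
      assume "(i + j) mod e = 0"
      moreover have "0 \<le> (i + j) div e" using i j' e by (simp add: pos_imp_zdiv_nonneg_iff)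
      ultimately show False using eq k0 pos[OF i(1,2)] pos[OF j'] by simp
    qed
    moreover have "j \<notin> R" using maxl[of j i] i eq by (auto simp: add.commute)
    ultimately show "list_ex (\<lambda>j. j \<notin> R \<and> (i + j) mod e \<noteq> 0 \<and>
      k ((i + j) mod e) = k i + k j + (i + j) div e) [1..e-1]"
      using j' by (auto simp: list_ex_iff)
  qed
qed

text \<open>Each number below \<open>e\<close> filters the candidates: 1 forces
  \<open>1 \<in> D\<close>, 3 forces \<open>b\<close> to be 2 or 3, and 5 limits \<open>c\<close> to
  five pairs. Reaching 7 leaves \<open>{0, 1, 2, 5}\<close> and \<open>{0, 1, 3, 4}\<close>,
  reaching 8 only the latter, and 9 is out of reach. For \<open>e = 5\<close>, \<open>c\<close>
  stays arbitrary.\<close>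

lemma four_element_basis:
  fixes D :: "int set"
  assumes D: "card D = 4" "D \<subseteq> {0..}" "0 \<in> D" and e: "5 \<le> e"
    and cover: "\<And>n. \<lbrakk>0 \<le> n; n < e\<rbrakk> \<Longrightarrow> \<exists>c\<in>D. \<exists>d\<in>D. n = c + d"
  obtains b c where "D = {0, 1, b, c}"
    "e = 5 \<and> (b = 2 \<or> b = 3)
     \<or> (e = 6 \<or> e = 7) \<and> (b = 2 \<and> (c = 3 \<or> c = 4 \<or> c = 5) \<or> b = 3 \<and> (c = 4 \<or> c = 5))
     \<or> e = 8 \<and> (b = 2 \<and> c = 5 \<or> b = 3 \<and> c = 4) \<or> e = 9 \<and> b = 3 \<and> c = 4"
proof -
  obtain u v where uv: "u \<in> D" "v \<in> D" "1 = u + v" using cover[of 1] e by auto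
  then have "0 \<le> u" "0 \<le> v" using D(2) by auto
  then have "u = 1 \<or> v = 1" using uv(3) by linarith
  then have "1 \<in> D" using uv by blast
  have fin: "finite D" using D(1) by (simp add: card_ge_0_finite)
  then have "card (D - {0, 1}) = 2" using D \<open>1 \<in> D\<close> by (simp add: card_Diff_subset)
  then obtain b' c' where bc': "D - {0, 1} = {b', c'}" "b' \<noteq> c'" by (auto simp: card_2_iff)
  define b c where "b = min b' c'" and "c = max b' c'"
  have bc: "D - {0, 1} = {b, c}" "b < c" using bc' by (auto simp: b_def c_def min_def max_def)
  then have D_eq: "D = {0, 1, b, c}" using D(3) \<open>1 \<in> D\<close> by blast
  have "b \<in> D - {0, 1}" using bc(1) by blast
  then have "0 \<le> b" "b \<noteq> 0" "b \<noteq> 1" using D(2) by auto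
  then have "1 < b" by linarith
  have *: "n \<in> {0, 1, 2, b, b + 1, 2 * b, c, c + 1, b + c, 2 * c}" if "0 \<le> n" "n < e" for n
    using cover[OF that] unfolding D_eq by auto
  have b: "b = 2 \<or> b = 3" using *[of 3] e \<open>1 < b\<close> \<open>b < c\<close> by auto
  have c: "b = 2 \<and> (c = 3 \<or> c = 4 \<or> c = 5) \<or> b = 3 \<and> (c = 4 \<or> c = 5)" if "6 \<le> e"
    using *[of 5] that \<open>b < c\<close> b by auto
  have c8: "b = 2 \<and> c = 5 \<or> b = 3 \<and> c = 4" if "8 \<le> e"
  proof -
    have "6 \<in> {0, 1, 2, b, b + 1, 2 * b, c, c + 1, b + c, 2 * c}"
      "7 \<in> {0, 1, 2, b, b + 1, 2 * b, c, c + 1, b + c, 2 * c}"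
      using *[of 6] *[of 7] that by simp_all
    moreover have "b = 2 \<and> (c = 3 \<or> c = 4 \<or> c = 5) \<or> b = 3 \<and> (c = 4 \<or> c = 5)"
      using c that by simp
    ultimately show ?thesis by (elim disjE conjE) simp_all
  qed
  have c9: "b = 3 \<and> c = 4" if "9 \<le> e"
    using c8 *[of 8] that by auto
  have "e < 10"
    using c9 *[of 9] by force
  then have "e = 5 \<or> e = 6 \<or> e = 7 \<or> e = 8 \<or> e = 9" using e by linarith
  then show thesis
    using that[OF D_eq] b c c8 c9 by (elim disjE) simp_all
qed

text \<open>Among the gaps \<open>y\<close> with \<open>y - z\<close> in \<open>S\<close>, which are
  all at most \<open>F\<close>, a largest one is pseudo-Frobenius. In terms of \<open>K\<close>: it
  is generated over \<open>S\<close> by the differences \<open>F - f\<close>.\<close>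

lemma ex_maximal_gap:
  assumes S: "add_submonoid S" "S \<subseteq> {0..}" and F: "\<And>z. F < z \<Longrightarrow> z \<in> S" and z: "z \<notin> S"
  shows "\<exists>f\<in>pseudo_frobenius S. f - z \<in> S"
proof -
  have "z \<notin> S \<and> z - z \<in> S" using z S(1) by (simp add: add_submonoid_def)
  from ex_has_least_nat[of "\<lambda>y. y \<notin> S \<and> y - z \<in> S", OF this, of "\<lambda>y. nat (F - y)"]
  obtain f where f: "f \<notin> S" "f - z \<in> S"
    and max: "\<And>y. y \<notin> S \<Longrightarrow> y - z \<in> S \<Longrightarrow> nat (F - f) \<le> nat (F - y)" by blast
  have "f + h \<in> S" if h: "h \<in> S" "h \<noteq> 0" for h
  proof (rule ccontr)
    assume *: "f + h \<notin> S"
    have "(f - z) + h \<in> S" using f(2) h(1) S(1) unfolding add_submonoid_def by blast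
    then have "nat (F - f) \<le> nat (F - (f + h))" using * by (intro max) (auto simp: algebra_simps)
    moreover have "f + h \<le> F" using F[of "f + h"] * by linarith
    moreover have "0 \<le> h" using h(1) S(2) by auto
    then have "0 < h" using h(2) by simp
    ultimately show False by linarith
  qed
  then show ?thesis using f by (auto simp: pseudo_frobenius_def)
qed

lemma ffg_type4_familyI:
  assumes S: "add_submonoid S" "S \<subseteq> {0..}" and type: "card (pseudo_frobenius S) = 4"
    and ffg: "gap_sums_cover S"
  shows "ffg_type4_family S"
proof -
  let ?P = "pseudo_frobenius S"
  obtain F where F: "F \<notin> S" "\<And>z. F < z \<Longrightarrow> z \<in> S"
    and cover: "\<And>n. 0 \<le> n \<Longrightarrow> \<exists>y z. y \<notin> S \<and> z \<notin> S \<and> n = (F - y) + (F - z)"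
    using ffg unfolding gap_sums_cover_def by blast
  have P: "f \<notin> S" "f \<le> F" if "f \<in> ?P" for f
    using that F(2)[of f] by (auto simp: pseudo_frobenius_def not_le[symmetric])
  have PI: "f + h \<in> S" if "f \<in> ?P" "h \<in> S" "h \<noteq> 0" for f h
    using that by (auto simp: pseudo_frobenius_def)
  have "F \<in> ?P"
  proof -
    have "0 < h" if "h \<in> S" "h \<noteq> 0" for h
      using that(2) subsetD[OF S(2) that(1)] by simp
    then show ?thesis using F by (auto simp: pseudo_frobenius_def)
  qed
  \<comment> \<open>A negative \<open>f\<close> makes \<open>F - f\<close> an element of
    \<open>S\<close>, and adding it to \<open>f\<close> gives the gap \<open>F\<close>; so
    \<open>f = F\<close>. Then \<open>S\<close> is all of the natural numbers and -1 is the only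
    candidate for a pseudo-Frobenius number, against type 4.\<close>
  have pos: "0 \<le> f" if f: "f \<in> ?P" for f
  proof (rule ccontr)
    assume neg: "\<not> 0 \<le> f"
    then have "F - f \<in> S" using F(2) by simp
    then have "f = F" using PI[OF f, of "F - f"] F(1) by auto
    then have all: "z \<in> S" if "0 \<le> z" for z using neg F(2)[of z] that by simp
    have "x = -1" if "x \<in> ?P" for x
    proof -
      have "x < 0" using P(1)[OF that] all[of x] by linarith
      moreover have "x + 1 \<in> S" using PI[OF that, of 1] all[of 1] by simp
      ultimately show ?thesis using S(2) by force
    qed
    then have "?P \<subseteq> {-1}" by blast
    then have "card ?P \<le> card {-1::int}" by (intro card_mono) auto
    then show False using type by simp
  qed
  have "nat (F + 1) + 1 > 0 \<and> int (nat (F + 1) + 1) \<in> S" using F(2) by simp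
  from ex_has_least_nat[of "\<lambda>n. n > 0 \<and> int n \<in> S", OF this, of "\<lambda>n. n"]
  obtain n where n: "0 < n" "int n \<in> S" "\<And>m. 0 < m \<Longrightarrow> int m \<in> S \<Longrightarrow> n \<le> m"
    by blast
  define e where "e = int n"
  have e: "0 < e" "e \<in> S" using n by (simp_all add: e_def)
  have least: "i \<notin> S" if "0 < i" "i < e" for i
  proof
    assume "i \<in> S"
    then have "n \<le> nat i" using n(3)[of "nat i"] that(1) by simp
    then show False using that by (simp add: e_def)
  qed
  obtain k where k: "S = kset e k" "k 0 = 0"
    using ex_kunz_coordinates[OF S, of "F + 1" e] F(2) e by auto
  have mod_ne: "f mod e \<noteq> 0" if f: "f \<in> ?P" for f
  proof
    assume "f mod e = 0"
    then have "f = e * (f div e)" by auto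
    moreover have "0 \<le> f div e" using pos[OF f] e(1) by (simp add: pos_imp_zdiv_nonneg_iff)
    ultimately have "f \<in> S" using mult_in_submonoid[OF S(1) e(2)] by metis
    then show False using P(1)[OF f] by simp
  qed
  \<comment> \<open>Congruent pseudo-Frobenius numbers would differ by a positive multiple of
    \<open>e\<close>, an element of \<open>S\<close>, which pushes the smaller one into
    \<open>S\<close>. With \<open>mod_ne\<close> this gives four nonzero residues, hence
    \<open>5 \<le> e\<close>.\<close>
  have inj: "inj_on (\<lambda>f. f mod e) ?P"
  proof (rule linorder_inj_onI')
    fix f g assume fg: "f \<in> ?P" "g \<in> ?P" "f < g"
    show "f mod e \<noteq> g mod e"
    proof
      assume "f mod e = g mod e"
      then obtain t where t: "g - f = e * t" by (metis mod_eq_dvd_iff dvd_def)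
      then have "0 < t" using fg(3) e(1) by (metis diff_gt_0_iff_gt zero_less_mult_pos)
      then have "g - f \<in> S" using t mult_in_submonoid[OF S(1) e(2), of t] by simp
      then have "g \<in> S" using PI[OF fg(1), of "g - f"] fg(3) by simp
      then show False using P(1)[OF fg(2)] by simp
    qed
  qed
  define R where "R = (\<lambda>f. f mod e) ` ?P"
  have R: "R \<subseteq> {1..e - 1}"
  proof
    fix i assume "i \<in> R"
    then obtain f where f: "f \<in> ?P" "i = f mod e" by (auto simp: R_def)
    then show "i \<in> {1..e - 1}"
      using mod_ne[OF f(1)] pos_mod_sign[OF e(1), of f] pos_mod_bound[OF e(1), of f] by auto
  qed
  have cardR: "card R = 4" unfolding R_def using card_image[OF inj] type by simp
  then have "5 \<le> e" using card_mono[OF _ R] e(1) by simp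
  define D where "D = (\<lambda>f. F - f) ` ?P"
  have D_P: "F - d \<in> ?P" if "d \<in> D" for d using that by (auto simp: D_def)
  obtain b c where D: "D = {0, 1, b, c}" and ebc:
    "e = 5 \<and> (b = 2 \<or> b = 3)
     \<or> (e = 6 \<or> e = 7) \<and> (b = 2 \<and> (c = 3 \<or> c = 4 \<or> c = 5) \<or> b = 3 \<and> (c = 4 \<or> c = 5))
     \<or> e = 8 \<and> (b = 2 \<and> c = 5 \<or> b = 3 \<and> c = 4) \<or> e = 9 \<and> b = 3 \<and> c = 4"
  proof (rule four_element_basis[of D e])
    show "card D = 4" unfolding D_def using type by (subst card_image) (auto simp: inj_on_def)
    show "D \<subseteq> {0..}" using P(2) by (auto simp: D_def)
    show "5 \<le> e" by fact
    show "0 \<in> D" using \<open>F \<in> ?P\<close> by (force simp: D_def)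
    fix n assume n: "0 \<le> n" "n < e"
    obtain y z where yz: "y \<notin> S" "z \<notin> S" "n = (F - y) + (F - z)" using cover[OF n(1)] by blast
    obtain f g where fg: "f \<in> ?P" "f - y \<in> S" "g \<in> ?P" "g - z \<in> S"
      using ex_maximal_gap[OF S F(2)] yz by meson
    \<comment> \<open>\<open>s\<close> collects what the two pseudo-Frobenius numbers exceed the
      gaps by. It lies in \<open>S\<close> and is at most \<open>n < e\<close>, so it
      vanishes.\<close>
    define s where "s = (f - y) + (g - z)"
    have "s \<in> S" using fg S(1) unfolding s_def add_submonoid_def by blast
    moreover have "s \<le> n" using P(2)[OF fg(1)] P(2)[OF fg(3)] yz(3) by (simp add: s_def)
    ultimately have "s = 0" using least[of s] n(2) S(2) by force
    then have "n = (F - f) + (F - g)" using yz(3) by (simp add: s_def)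
    then show "\<exists>c\<in>D. \<exists>d\<in>D. n = c + d" using fg by (auto simp: D_def)
  qed
  define q r where "q = F div e" and "r = F mod e"
  have F_eq: "F = e * q + r" by (simp add: q_def r_def)
  have r: "0 \<le> r" "r < e" using e(1) by (simp_all add: r_def)
  have R_eq: "R = (\<lambda>d. (r - d) mod e) ` D"
    unfolding R_def D_def image_image by (simp add: r_def mod_diff_left_eq)
  \<comment> \<open>Since \<open>F - d\<close> is pseudo-Frobenius, it is not a multiple of
    \<open>e\<close>: the residue \<open>r\<close> avoids \<open>D\<close> modulo \<open>e\<close>.
    This leaves the few values of \<open>r\<close> in each case below.\<close>
  have r_ne: "(r - d) mod e \<noteq> 0" if "d \<in> D" for d
    using mod_ne[OF D_P[OF that]] by (simp add: r_def mod_diff_left_eq)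
  have type: "kunz_type e q r k D' R" if "D' \<subseteq> D" for D'
    using kunz_type_pseudo_frobenius[of e k r q D' R] S(1) k e(1) r(2) least F(2) D_P that
    unfolding F_eq R_def by blast
  have "ffg_type4_family (kset e k)"
    using ebc 
  proof (elim disjE conjE)
    assume "e = 5"
    have "R = {1, 2, 3, 4}"
    proof (rule card_subset_eq)
      show "R \<subseteq> {1, 2, 3, 4}" using R \<open>e = 5\<close> by auto
    qed (use cardR in simp_all)
    {
      assume b: "b = 2"
      have "r = 3 \<or> r = 4" using r_ne[of 0] r_ne[of 1] r_ne[of 2] r unfolding \<open>e = 5\<close> D b by (simp, presburger)
      then show ?thesis
        using type[of "{0, 1, 2}"] ffg_kunz_type_5_3_0_1_2 ffg_kunz_type_5_4_0_1_2
        unfolding \<open>e = 5\<close> D b \<open>R = {1, 2, 3, 4}\<close> by auto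
    next
      assume b: "b = 3"
      have "r = 2 \<or> r = 4" using r_ne[of 0] r_ne[of 1] r_ne[of 3] r unfolding \<open>e = 5\<close> D b by (simp, presburger)
      then show ?thesis
        using type[of "{0, 1, 3}"] ffg_kunz_type_5_2_0_1_3 ffg_kunz_type_5_4_0_1_3
        unfolding \<open>e = 5\<close> D b \<open>R = {1, 2, 3, 4}\<close> by auto
    }
  next
    assume v: "e = 6" "b = 2" "c = 3"
    have "r = 4 \<or> r = 5"
      using r_ne[of 0] r_ne[of 1] r_ne[of 2] r_ne[of 3] r unfolding D v by (simp, presburger)
    then show ?thesis
      using type[of D] R_eq ffg_kunz_type_6_4_0_1_2_3 ffg_kunz_type_6_5_0_1_2_3
      unfolding D v by (elim disjE) simp_all
  next
    assume v: "e = 6" "b = 2" "c = 4"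
    have "r = 3 \<or> r = 5"
      using r_ne[of 0] r_ne[of 1] r_ne[of 2] r_ne[of 4] r unfolding D v by (simp, presburger)
    then show ?thesis
      using type[of D] R_eq ffg_kunz_type_6_3_0_1_2_4 ffg_kunz_type_6_5_0_1_2_4
      unfolding D v by (elim disjE) simp_all
  next
    assume v: "e = 6" "b = 2" "c = 5"
    have "r = 3 \<or> r = 4"
      using r_ne[of 0] r_ne[of 1] r_ne[of 2] r_ne[of 5] r unfolding D v by (simp, presburger)
    then show ?thesis
      using type[of D] R_eq ffg_kunz_type_6_3_0_1_2_5 ffg_kunz_type_6_4_0_1_2_5
      unfolding D v by (elim disjE) simp_all
  next
    assume v: "e = 6" "b = 3" "c = 4"
    have "r = 2 \<or> r = 5"
      using r_ne[of 0] r_ne[of 1] r_ne[of 3] r_ne[of 4] r unfolding D v by (simp, presburger)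
    then show ?thesis
      using type[of D] R_eq not_kunz_type_6_2_0_1_3_4 not_kunz_type_6_5_0_1_3_4
      unfolding D v by (elim disjE) simp_all
  next
    assume v: "e = 6" "b = 3" "c = 5"
    have "r = 2 \<or> r = 4"
      using r_ne[of 0] r_ne[of 1] r_ne[of 3] r_ne[of 5] r unfolding D v by (simp, presburger)
    then show ?thesis
      using type[of D] R_eq ffg_kunz_type_6_2_0_1_3_5 ffg_kunz_type_6_4_0_1_3_5
      unfolding D v by (elim disjE) simp_all
  next
    assume v: "e = 7" "b = 2" "c = 3"
    have "r = 4 \<or> r = 5 \<or> r = 6"
      using r_ne[of 0] r_ne[of 1] r_ne[of 2] r_ne[of 3] r unfolding D v by (simp, presburger)
    then show ?thesis
      using type[of D] R_eq ffg_kunz_type_7_4_0_1_2_3 not_kunz_type_7_5_0_1_2_3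
        ffg_kunz_type_7_6_0_1_2_3
      unfolding D v by (elim disjE) simp_all
  next
    assume v: "e = 7" "b = 2" "c = 4"
    have "r = 3 \<or> r = 5 \<or> r = 6"
      using r_ne[of 0] r_ne[of 1] r_ne[of 2] r_ne[of 4] r unfolding D v by (simp, presburger)
    then show ?thesis
      using type[of D] R_eq ffg_kunz_type_7_3_0_1_2_4 not_kunz_type_7_5_0_1_2_4
        ffg_kunz_type_7_6_0_1_2_4
      unfolding D v by (elim disjE) simp_all
  next
    assume v: "e = 7" "b = 2" "c = 5"
    have "r = 3 \<or> r = 4 \<or> r = 6"
      using r_ne[of 0] r_ne[of 1] r_ne[of 2] r_ne[of 5] r unfolding D v by (simp, presburger)
    then show ?thesis
      using type[of D] R_eq ffg_kunz_type_7_3_0_1_2_5 not_kunz_type_7_4_0_1_2_5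
        ffg_kunz_type_7_6_0_1_2_5
      unfolding D v by (elim disjE) simp_all
  next
    assume v: "e = 7" "b = 3" "c = 4"
    have "r = 2 \<or> r = 5 \<or> r = 6"
      using r_ne[of 0] r_ne[of 1] r_ne[of 3] r_ne[of 4] r unfolding D v by (simp, presburger)
    then show ?thesis
      using type[of D] R_eq ffg_kunz_type_7_2_0_1_3_4 ffg_kunz_type_7_5_0_1_3_4
        ffg_kunz_type_7_6_0_1_3_4
      unfolding D v by (elim disjE) simp_all
  next
    assume v: "e = 7" "b = 3" "c = 5"
    have "r = 2 \<or> r = 4 \<or> r = 6"
      using r_ne[of 0] r_ne[of 1] r_ne[of 3] r_ne[of 5] r unfolding D v by (simp, presburger)
    then show ?thesis
      using type[of D] R_eq ffg_kunz_type_7_2_0_1_3_5 not_kunz_type_7_4_0_1_3_5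
        ffg_kunz_type_7_6_0_1_3_5
      unfolding D v by (elim disjE) simp_all
  next
    assume v: "e = 8" "b = 2" "c = 5"
    have "r = 3 \<or> r = 4 \<or> r = 6 \<or> r = 7"
      using r_ne[of 0] r_ne[of 1] r_ne[of 2] r_ne[of 5] r unfolding D v by (simp, presburger)
    then show ?thesis
      using type[of D] R_eq ffg_kunz_type_8_3_0_1_2_5 not_kunz_type_8_4_0_1_2_5
        not_kunz_type_8_6_0_1_2_5 ffg_kunz_type_8_7_0_1_2_5
      unfolding D v by (elim disjE) simp_all
  next
    assume v: "e = 8" "b = 3" "c = 4"
    have "r = 2 \<or> r = 5 \<or> r = 6 \<or> r = 7"
      using r_ne[of 0] r_ne[of 1] r_ne[of 3] r_ne[of 4] r unfolding D v by (simp, presburger)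
    then show ?thesis
      using type[of D] R_eq ffg_kunz_type_8_2_0_1_3_4 ffg_kunz_type_8_5_0_1_3_4
        ffg_kunz_type_8_6_0_1_3_4 ffg_kunz_type_8_7_0_1_3_4
      unfolding D v by (elim disjE) simp_all
  next
    assume v: "e = 9" "b = 3" "c = 4"
    have "r = 2 \<or> r = 5 \<or> r = 6 \<or> r = 7 \<or> r = 8"
      using r_ne[of 0] r_ne[of 1] r_ne[of 3] r_ne[of 4] r unfolding D v by (simp, presburger)
    then show ?thesis
      using type[of D] R_eq ffg_kunz_type_9_2_0_1_3_4 ffg_kunz_type_9_5_0_1_3_4
        ffg_kunz_type_9_6_0_1_3_4 ffg_kunz_type_9_7_0_1_3_4 ffg_kunz_type_9_8_0_1_3_4
      unfolding D v by (elim disjE) simp_all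
  qed
  then show ?thesis by (simp add: k(1))
qed

section \<open>Laurent series with restricted support\<close>

definition supported_fls :: "int set \<Rightarrow> 'k::field fls set" where
  "supported_fls A = {f. \<forall>n. fls_nth f n \<noteq> 0 \<longrightarrow> n \<in> A}"

definition monom_fls :: "int \<Rightarrow> 'k::field fls" where
  "monom_fls i = fls_X_intpow i"

lemma monom_fls_nth [simp]: "fls_nth (monom_fls i) n = (if n = i then 1 else 0)"
  by (simp add: monom_fls_def)

lemma monom_fls_neq_0 [simp]: "monom_fls i \<noteq> 0"
  by (simp add: monom_fls_def)

lemma supported_flsI: "(\<And>n. fls_nth f n \<noteq> 0 \<Longrightarrow> n \<in> A) \<Longrightarrow> f \<in> supported_fls A"
  by (auto simp: supported_fls_def)

lemma supported_flsD: "f \<in> supported_fls A \<Longrightarrow> fls_nth f n \<noteq> 0 \<Longrightarrow> n \<in> A"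
  by (auto simp: supported_fls_def)

lemma supported_fls_mono: "A \<subseteq> B \<Longrightarrow> supported_fls A \<subseteq> supported_fls B"
  by (auto simp: supported_fls_def)

lemma supported_fls_0 [simp]: "0 \<in> supported_fls A"
  by (simp add: supported_fls_def)

lemma supported_fls_1: "0 \<in> A \<Longrightarrow> 1 \<in> supported_fls A"
  by (auto simp: supported_fls_def)

lemma supported_fls_add: "f \<in> supported_fls A \<Longrightarrow> g \<in> supported_fls A \<Longrightarrow> f + g \<in> supported_fls A"
  by (auto simp: supported_fls_def) (metis add.right_neutral)

lemma supported_fls_uminus: "f \<in> supported_fls A \<Longrightarrow> - f \<in> supported_fls A"
  by (auto simp: supported_fls_def)

lemma supported_fls_diff: "f \<in> supported_fls A \<Longrightarrow> g \<in> supported_fls A \<Longrightarrow> f - g \<in> supported_fls A"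
  using supported_fls_add[of f A "- g"] supported_fls_uminus[of g A] by simp

lemma supported_fls_sum:
  "(\<And>i. i \<in> I \<Longrightarrow> f i \<in> supported_fls A) \<Longrightarrow> (\<Sum>i\<in>I. f i) \<in> supported_fls A"
  by (induction I rule: infinite_finite_induct) (auto intro: supported_fls_add)

lemma supported_fls_const: "0 \<in> A \<Longrightarrow> fls_const c \<in> supported_fls A"
  by (auto simp: supported_fls_def)

lemma supported_fls_const_mult: "f \<in> supported_fls A \<Longrightarrow> fls_const c * f \<in> supported_fls A"
  by (auto simp: supported_fls_def)

lemma monom_fls_supported [simp]: "monom_fls i \<in> supported_fls A \<longleftrightarrow> i \<in> A"
  by (auto simp: supported_fls_def)

lemma fls_nth_mult_neq_0E:
  fixes f g :: "'k::field fls"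
  assumes "fls_nth (f * g) n \<noteq> 0"
  obtains i where "fls_nth f i \<noteq> 0" "fls_nth g (n - i) \<noteq> 0"
proof -
  have "(\<Sum>i = fls_subdegree f..n - fls_subdegree g. fls_nth f i * fls_nth g (n - i)) \<noteq> 0"
    using assms by (simp add: fls_times_nth(2))
  then obtain i where "fls_nth f i * fls_nth g (n - i) \<noteq> 0" by (meson sum.neutral)
  then show thesis using that[of i] by simp
qed

lemma supported_fls_mult:
  assumes "f \<in> supported_fls A" "g \<in> supported_fls B" "\<And>a b. a \<in> A \<Longrightarrow> b \<in> B \<Longrightarrow> a + b \<in> C"
  shows "f * g \<in> supported_fls C"
proof (rule supported_flsI)
  fix n assume "fls_nth (f * g) n \<noteq> 0"
  then obtain i where "fls_nth f i \<noteq> 0" "fls_nth g (n - i) \<noteq> 0" by (rule fls_nth_mult_neq_0E)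
  then have "i \<in> A" "n - i \<in> B" using assms(1,2) by (auto dest: supported_flsD)
  from assms(3)[OF this] show "n \<in> C" by simp
qed

lemma fls_nth_mult_monom:
  "fls_nth (f * monom_fls i) n = fls_nth f (n - i)" "fls_nth (monom_fls i * f) n = fls_nth f (n - i)"
  by (simp_all add: monom_fls_def fls_X_intpow_times_conv_shift)

lemma supported_fls_atLeast_iff: "f \<in> supported_fls {N..} \<longleftrightarrow> f = 0 \<or> N \<le> fls_subdegree f"
proof
  show "f = 0 \<or> N \<le> fls_subdegree f" if "f \<in> supported_fls {N..}"
    using supported_flsD[OF that, of "fls_subdegree f"] nth_fls_subdegree_zero_iff[of f] by auto
  show "f \<in> supported_fls {N..}" if "f = 0 \<or> N \<le> fls_subdegree f"
  proof (rule supported_flsI)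
    fix n assume "fls_nth f n \<noteq> 0"
    then show "n \<in> {N..}" using that fls_subdegree_leI[of f n] by auto
  qed
qed

text \<open>Testing \<open>q\<close> against the monomials with exponents in \<open>B\<close>
  already confines its support, so such a colon is again given by a set of exponents.\<close>

lemma colon_supported_fls:
  "(\<forall>x\<in>supported_fls B. q * x \<in> supported_fls A) \<longleftrightarrow> q \<in> supported_fls {z. \<forall>b\<in>B. z + b \<in> A}"
proof
  assume *: "\<forall>x\<in>supported_fls B. q * x \<in> supported_fls A"
  show "q \<in> supported_fls {z. \<forall>b\<in>B. z + b \<in> A}"
  proof (rule supported_flsI, clarify)
    fix n b assume "fls_nth q n \<noteq> 0" "b \<in> B"
    then have "q * monom_fls b \<in> supported_fls A" using * by simp
    then show "n + b \<in> A"
      using supported_flsD[of "q * monom_fls b" A "n + b"] \<open>fls_nth q n \<noteq> 0\<close>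
      by (simp add: fls_nth_mult_monom)
  qed
qed (auto intro: supported_fls_mult)

section \<open>The semigroup ring: fractions, maximal ideal and integral closure\<close>

text \<open>A numerical semigroup placed among the integers, with its Frobenius number
  \<open>F\<close>; for \<open>S = {0..}\<close> this means \<open>F = -1\<close>.\<close>

locale numerical_set =
  fixes S :: "int set" and F :: int
  assumes submonoid: "add_submonoid S" and nonneg: "S \<subseteq> {0..}"
    and F_notin: "F \<notin> S" and above_F: "\<And>z. F < z \<Longrightarrow> z \<in> S"
begin

definition R :: "'k::field fls set" where "R = supported_fls S"

lemma zero_in: "0 \<in> S" and add_in: "a \<in> S \<Longrightarrow> b \<in> S \<Longrightarrow> a + b \<in> S"
  using submonoid by (auto simp: add_submonoid_def)

lemma nonneg': "a \<in> S \<Longrightarrow> 0 \<le> a"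
  using nonneg by auto

lemma R_0 [simp]: "0 \<in> R" and R_1 [simp]: "1 \<in> R" and R_const [simp]: "fls_const c \<in> R"
  using zero_in by (simp_all add: R_def supported_fls_1 supported_fls_const)

lemma R_add: "f \<in> R \<Longrightarrow> g \<in> R \<Longrightarrow> f + g \<in> R"
  and R_uminus: "f \<in> R \<Longrightarrow> - f \<in> R"
  and R_diff: "f \<in> R \<Longrightarrow> g \<in> R \<Longrightarrow> f - g \<in> R"
  by (simp_all add: R_def supported_fls_add supported_fls_uminus supported_fls_diff)

lemma R_mult: "f \<in> R \<Longrightarrow> g \<in> R \<Longrightarrow> f * g \<in> R"
  unfolding R_def by (rule supported_fls_mult) (auto intro: add_in)

lemma supported_above_F: "supported_fls {F + 1..} \<subseteq> R"
  unfolding R_def by (rule supported_fls_mono) (auto intro: above_F)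

text \<open>A monomial of high degree lies in \<open>R\<close> and pushes any Laurent series above
  order \<open>F\<close>, hence into \<open>R\<close>.\<close>

lemma total_fractions_R: "total_fractions R = (UNIV :: 'k::field fls set)"
proof -
  have "q \<in> total_fractions R" for q :: "'k fls"
  proof -
    define N where "N = max (F + 1) (F + 1 - fls_subdegree q)"
    have "monom_fls N \<in> (R :: 'k fls set)" using above_F by (simp add: R_def N_def)
    moreover have "q * monom_fls N \<in> supported_fls {F + 1..}"
      unfolding supported_fls_atLeast_iff
      by (cases "q = 0") (simp_all add: monom_fls_def fls_subdegree_mult_fls_X_intpow N_def)
    then have "q * monom_fls N \<in> R" using supported_above_F by blast
    moreover have "q = q * monom_fls N / monom_fls N" by simp
    ultimately show ?thesis unfolding total_fractions_def using monom_fls_neq_0 by blast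
  qed
  then show ?thesis by blast
qed

lemma colon_R: "colon R I J = {q. \<forall>x\<in>J. q * x \<in> I}"
  by (simp add: colon_def total_fractions_R)

lemma nonunits_R: "nonunits R = (supported_fls (S - {0}) :: 'k::field fls set)" (is "?L = ?M")
proof
  show "?M \<subseteq> ?L"
  proof
    fix x :: "'k fls" assume x: "x \<in> ?M"
    have "x * y \<noteq> 1" if "y \<in> R" for y
    proof
      assume "x * y = 1"
      then have "fls_nth (x * y) 0 \<noteq> 0" by simp
      then obtain i where "fls_nth x i \<noteq> 0" "fls_nth y (0 - i) \<noteq> 0" by (rule fls_nth_mult_neq_0E)
      then have "i \<in> S - {0}" "0 - i \<in> S" using x \<open>y \<in> R\<close> unfolding R_def by (blast dest: supported_flsD)+
      then show False using nonneg'[of i] nonneg'[of "0 - i"] by simp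
    qed
    then show "x \<in> ?L" using x supported_fls_mono[of "S - {0}" S] by (auto simp: nonunits_def R_def)
  qed
  show "?L \<subseteq> ?M"
  proof
    fix x :: "'k fls" assume x: "x \<in> ?L"
    then have xS: "x \<in> supported_fls S" by (simp add: nonunits_def R_def)
    have "fls_nth x 0 = 0"
    proof (rule ccontr)
      assume x0: "fls_nth x 0 \<noteq> 0"
      define y where "y = inverse x"
      have "x \<noteq> 0" using x0 by auto
      then have xy: "x * y = 1" by (simp add: y_def)
      have sub: "fls_subdegree x = 0"
        using x0 nonneg' supported_flsD[OF xS] by (intro fls_subdegree_eqI) force+
      then have suby: "fls_subdegree y = 0" by (simp add: y_def)
      \<comment> \<open>Compare coefficients of \<open>x * y = 1\<close> at some \<open>n\<close>
        outside \<open>S\<close>. By induction, a nonzero term with \<open>0 < i\<close> has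
        \<open>i\<close> and \<open>n - i\<close> in \<open>S\<close>, which is impossible; what
        remains is \<open>fls_nth x 0 * fls_nth y n = 0\<close>.\<close>
      have "n \<in> S" if "fls_nth y n \<noteq> 0" for n
        using that
      proof (induction "nat n" arbitrary: n rule: less_induct)
        case less
        show ?case
        proof (rule ccontr)
          assume "n \<notin> S"
          then have "0 \<noteq> n" using zero_in by blast
          have "0 \<le> n" using less.prems suby fls_subdegree_leI[of y n] by simp
          have "0 = fls_nth (x * y) n" using \<open>0 \<noteq> n\<close> by (simp add: xy)
          also have "\<dots> = (\<Sum>i = 0..n. fls_nth x i * fls_nth y (n - i))"
            by (simp add: fls_times_nth(2) sub suby)
          also have "\<dots> = (\<Sum>i\<in>{0}. fls_nth x i * fls_nth y (n - i))"
          proof (rule sum.mono_neutral_right)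
            show "\<forall>i\<in>{0..n} - {0}. fls_nth x i * fls_nth y (n - i) = 0"
            proof (rule ballI, rule ccontr)
              fix i assume i: "i \<in> {0..n} - {0}" "fls_nth x i * fls_nth y (n - i) \<noteq> 0"
              then have "n - i \<in> S" by (intro less.hyps) auto
              moreover have "i \<in> S" using i(2) supported_flsD[OF xS] by auto
              ultimately have "n \<in> S" using add_in[of "n - i" i] by simp
              then show False using \<open>n \<notin> S\<close> by simp
            qed
          qed (use \<open>0 \<le> n\<close> in auto)
          finally show False using x0 less.prems by simp
        qed
      qed
      then have "y \<in> R" unfolding R_def by (rule supported_flsI)
      then show False using x xy by (simp add: nonunits_def)
    qed
    then show "x \<in> ?M" using supported_flsD[OF xS] by (intro supported_flsI) auto
  qed
qed

text \<open>If \<open>q\<close> has negative order, \<open>q ^ n\<close> has smaller order than all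
  other terms of a monic equation of degree \<open>n\<close>. Conversely, split
  \<open>f = c + g\<close> with \<open>g\<close> of positive order: a high power of \<open>g\<close>
  lies in \<open>R\<close>, and \<open>f\<close> is a root of
  \<open>(X - c)^n - g^n\<close>.\<close>

lemma int_closure_R: "int_closure R = (supported_fls {0..} :: 'k::field fls set)" (is "?L = ?M")
proof
  show "?L \<subseteq> ?M"
  proof
    fix q :: "'k fls" assume "q \<in> ?L"
    then obtain p where p: "lead_coeff p = 1" "\<And>i. coeff p i \<in> R" "poly p q = 0"
      by (auto simp: int_closure_def)
    show "q \<in> ?M"
    proof (rule ccontr)
      assume "q \<notin> ?M"
      then have q: "q \<noteq> 0" "fls_subdegree q < 0" by (auto simp: supported_fls_atLeast_iff)
      define n where "n = degree p"
      have "- (q ^ n) = (\<Sum>i<n. coeff p i * q ^ i)"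
        using p(1,3) by (simp add: poly_altdef n_def lessThan_Suc_atMost[symmetric] neg_eq_iff_add_eq_0 add.commute)
      also have "\<dots> \<in> supported_fls {int n * fls_subdegree q + 1..}"
      proof -
        have "coeff p i * q ^ i \<in> supported_fls {int n * fls_subdegree q + 1..}" if "i < n" for i
        proof -
          have c: "coeff p i \<in> supported_fls {0..}"
            using p(2)[of i] supported_fls_mono[OF nonneg] by (auto simp: R_def)
          have "int n * fls_subdegree q + 1 \<le> int i * fls_subdegree q"
          proof -
            have "(int n - int i) * fls_subdegree q \<le> (int n - int i) * (-1)"
              using that q(2) by (intro mult_left_mono) auto
            then show ?thesis using that by (simp add: algebra_simps)
          qed
          then have "q ^ i \<in> supported_fls {int n * fls_subdegree q + 1..}"
            by (simp add: supported_fls_atLeast_iff fls_subdegree_pow)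
          from supported_fls_mult[OF c this] show ?thesis by auto
        qed
        then show ?thesis
          by (intro supported_fls_sum) auto
      qed
      finally have "q ^ n \<in> supported_fls {int n * fls_subdegree q + 1..}"
        using supported_fls_uminus by fastforce
      then show False using q(1) by (simp add: supported_fls_atLeast_iff fls_subdegree_pow)
    qed
  qed
  show "?M \<subseteq> ?L"
  proof
    fix f :: "'k fls" assume f: "f \<in> ?M"
    define c where "c = fls_nth f 0"
    define g where "g = f - fls_const c"
    have g: "g \<in> supported_fls {1..}"
      using supported_flsD[OF f] by (intro supported_flsI) (force simp: g_def c_def split: if_splits)
    \<comment> \<open>\<open>F + 2\<close> rather than \<open>F + 1\<close>, so that
      \<open>n\<close> is positive even for \<open>F = -1\<close>.\<close>
    define n where "n = nat (F + 2)"
    have "-1 \<le> F" using above_F[of "-1"] nonneg'[of "-1"] by (cases "F < -1") auto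
    then have n: "0 < n" "F + 1 \<le> int n" by (auto simp: n_def)
    have gn: "g ^ n \<in> R"
    proof -
      have "g ^ n \<in> supported_fls {F + 1..}"
      proof (cases "g = 0")
        case True
        then show ?thesis using n by (simp add: zero_power)
      next
        case False
        then have "1 \<le> fls_subdegree g" using g by (simp add: supported_fls_atLeast_iff)
        then have "int n * 1 \<le> int n * fls_subdegree g" by (intro mult_left_mono) auto
        then have "F + 1 \<le> int n * fls_subdegree g" using n(2) by linarith
        then show ?thesis by (simp add: supported_fls_atLeast_iff fls_subdegree_pow)
      qed
      then show ?thesis using supported_above_F by blast
    qed
    define p where "p = [:- fls_const c, 1:] ^ n + [:- (g ^ n):]"
    have "poly p f = 0" by (simp add: p_def poly_power g_def)
    have deg: "degree ([:- fls_const c, 1:] ^ n) = n"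
      by (simp add: degree_power_eq)
    then have "degree p = n" using n unfolding p_def by (subst degree_add_eq_left) auto
    have "lead_coeff ([:- fls_const c, 1:] ^ n) = 1" by (simp add: lead_coeff_power)
    then have "lead_coeff p = 1" using n unfolding \<open>degree p = n\<close> deg by (simp add: p_def coeff_pCons split: nat.splits)
    have "coeff ([:- fls_const c, 1:] ^ m) i \<in> R" for m i
    proof (induction m arbitrary: i)
      case (Suc m)
      then show ?case
        by (auto simp: coeff_pCons intro!: R_add R_diff R_mult R_uminus split: nat.splits)
    qed (auto simp: coeff_pCons split: nat.splits)
    then have "coeff p i \<in> R" for i
      using gn by (auto simp: p_def coeff_pCons intro!: R_diff R_add R_uminus split: nat.splits)
    then show "f \<in> ?L"
      using \<open>poly p f = 0\<close> \<open>lead_coeff p = 1\<close> by (auto simp: int_closure_def total_fractions_R)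
  qed
qed


section \<open>Fractional ideals and uniqueness of the canonical ideal\<close>

lemma submodule_supported_fls:
  assumes "\<And>s a. s \<in> S \<Longrightarrow> a \<in> A \<Longrightarrow> s + a \<in> A"
  shows "is_submodule R (supported_fls A :: 'k::field fls set)"
  unfolding is_submodule_def using assms
  by (auto simp: R_def intro: supported_fls_add supported_fls_mult)

lemma submodule_hull: "is_submodule R (is_submodule R hull A)"
  by (rule hull_in) (auto simp: is_submodule_def)

lemma submodule_colon: "is_submodule R I \<Longrightarrow> is_submodule R (colon R I J :: 'k::field fls set)"
  by (auto simp: is_submodule_def colon_R distrib_right mult.assoc)

text \<open>A common denominator bounds all orders from below by minus its own order; conversely, a
  monomial of large degree moves a set bounded below beyond \<open>F\<close>, into
  \<open>R\<close>.\<close>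

lemma fractional_ideal_iff:
  "fractional_ideal R I \<longleftrightarrow>
    is_submodule R I \<and> I \<noteq> {0} \<and> (\<exists>N. I \<subseteq> (supported_fls {N..} :: 'k::field fls set))"
proof -
  have "\<exists>N. I \<subseteq> supported_fls {N..}" if d: "d \<in> R" "d \<noteq> 0" "\<forall>x\<in>I. d * x \<in> R" for d :: "'k fls"
  proof (intro exI subsetI)
    fix x assume "x \<in> I"
    then have "d * x \<in> supported_fls {0..}"
      using d(3) supported_fls_mono[OF nonneg] by (auto simp: R_def)
    then show "x \<in> supported_fls {- fls_subdegree d..}"
      using d(2) by (cases "x = 0") (auto simp: supported_fls_atLeast_iff)
  qed
  moreover have "\<exists>d\<in>R. d \<noteq> 0 \<and> (\<forall>x\<in>I. d * x \<in> R)" if N: "I \<subseteq> supported_fls {N..}" for N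
  proof (intro bexI conjI ballI)
    let ?d = "monom_fls (max (F + 1) (F + 1 - N)) :: 'k fls"
    show "?d \<noteq> 0" by simp
    show "?d \<in> R" using above_F by (simp add: R_def)
    fix x assume "x \<in> I"
    then have "x \<in> supported_fls {N..}" using N by blast
    then have "?d * x \<in> supported_fls {F + 1..}"
      by (auto intro: supported_fls_mult[where A = "{max (F + 1) (F + 1 - N)}"])
    then show "?d * x \<in> R" using supported_above_F by blast
  qed
  ultimately show ?thesis
    unfolding fractional_ideal_def total_fractions_R by blast
qed

lemma canonical_idealD:
  assumes "canonical_ideal R (\<omega> :: 'k::field fls set)"
  shows "is_submodule R \<omega>" "\<omega> \<noteq> {0}" "\<exists>N. \<omega> \<subseteq> supported_fls {N..}"
    and "\<lbrakk>is_submodule R I; I \<noteq> {0}; I \<subseteq> supported_fls {N..}\<rbrakk> \<Longrightarrow> colon R \<omega> (colon R \<omega> I) = I"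
  using assms unfolding canonical_ideal_def fractional_ideal_iff by blast+

lemma submodule_R: "is_submodule R (R :: 'k::field fls set)"
  unfolding R_def[symmetric] by (auto simp: is_submodule_def intro: R_add R_mult)

text \<open>Since \<open>\<omega> : R = \<omega>\<close>, this is the duality
  \<open>\<omega> : (\<omega> : I) = I\<close> for \<open>I = R\<close>.\<close>

lemma colon_self_canonical:
  assumes "canonical_ideal R (\<omega> :: 'k::field fls set)"
  shows "colon R \<omega> \<omega> = R"
proof -
  have "colon R \<omega> R = \<omega>"
  proof (intro set_eqI iffI)
    fix q assume "q \<in> colon R \<omega> R"
    then have "q * 1 \<in> \<omega>" unfolding colon_R using R_1 by blast
    then show "q \<in> \<omega>" by simp
  next
    fix q assume "q \<in> \<omega>"
    then show "q \<in> colon R \<omega> R"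
      using canonical_idealD(1)[OF assms] by (auto simp: colon_R is_submodule_def mult.commute)
  qed
  moreover have "R \<noteq> {0 :: 'k fls}" using R_1 by (metis singletonD zero_neq_one)
  moreover have "R \<subseteq> (supported_fls {0..} :: 'k fls set)"
    unfolding R_def by (rule supported_fls_mono[OF nonneg])
  ultimately show ?thesis using canonical_idealD(4)[OF assms submodule_R, of 0] by simp
qed

lemma submodule_nonunits: "is_submodule R (nonunits R :: 'k::field fls set)"
proof -
  have "s + a \<in> S - {0}" if "s \<in> S" "a \<in> S - {0}" for s a
    using that add_in[of s a] nonneg'[of s] nonneg'[of a] by auto
  then show ?thesis unfolding nonunits_R by (intro submodule_supported_fls)
qed

text \<open>If \<open>\<omega>\<close> and \<open>\<omega>'\<close> are canonical, then \<open>J = \<omega> : \<omega>'\<close> and \<open>J' = \<omega>' : \<omega>\<close> satisfy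
  \<open>\<omega> : J J' = \<omega>\<close>, hence \<open>J J' = R\<close>; as \<open>R\<close> is local, some product of elements of \<open>J\<close> and \<open>J'\<close>
  is a unit.\<close>

lemma canonical_ideal_unique:
  assumes c: "canonical_ideal R (\<omega> :: 'k::field fls set)" and c': "canonical_ideal R \<omega>'"
  obtains u where "u \<noteq> 0" "\<omega>' = (*) u ` \<omega>"
proof -
  note D = canonical_idealD[OF c] and D' = canonical_idealD[OF c']
  define J where "J = colon R \<omega> \<omega>'"
  define J' where "J' = colon R \<omega>' \<omega>"
  have J: "j * x \<in> \<omega>" if "j \<in> J" "x \<in> \<omega>'" for j x using that by (simp add: J_def colon_R)
  have J': "j * x \<in> \<omega>'" if "j \<in> J'" "x \<in> \<omega>" for j x using that by (simp add: J'_def colon_R)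
  obtain N N' where N: "\<omega> \<subseteq> supported_fls {N..}" and N': "\<omega>' \<subseteq> supported_fls {N'..}"
    using D(3) D'(3) by blast
  have z: "0 \<in> \<omega>" "0 \<in> \<omega>'" using D(1) D'(1) by (auto simp: is_submodule_def)
  have colon_J: "colon R \<omega> J = \<omega>'" unfolding J_def by (rule D(4)[OF D'(1,2) N'])
  have colon_J': "colon R \<omega>' J' = \<omega>" unfolding J'_def by (rule D'(4)[OF D(1,2) N])
  define A where "A = {j * j' | j j'. j \<in> J \<and> j' \<in> J'}"
  define P where "P = is_submodule R hull A"
  have P: "is_submodule R P" unfolding P_def by (rule submodule_hull)
  have AP: "A \<subseteq> P" unfolding P_def by (rule hull_subset)
  have AR: "a \<in> R" if a_in: "a \<in> A" for a
  proof -
    obtain j j' where a: "a = j * j'" "j \<in> J" "j' \<in> J'"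
      using a_in unfolding A_def by blast
    then have "a * x \<in> \<omega>" if "x \<in> \<omega>" for x using J J' that by (simp add: mult.assoc)
    then have "a \<in> colon R \<omega> \<omega>" by (simp add: colon_R)
    then show ?thesis by (simp add: colon_self_canonical[OF c])
  qed
  have PR: "P \<subseteq> R" unfolding P_def using AR submodule_R by (intro hull_minimal) auto
  have colon_P: "colon R \<omega> P = \<omega>"
  proof (intro set_eqI iffI)
    fix q assume q: "q \<in> colon R \<omega> P"
    have "q * j' \<in> \<omega>'" if "j' \<in> J'" for j'
    proof -
      have "(q * j') * j \<in> \<omega>" if "j \<in> J" for j
      proof -
        have "j * j' \<in> P" using AP \<open>j \<in> J\<close> \<open>j' \<in> J'\<close> by (auto simp: A_def)
        then have "q * (j * j') \<in> \<omega>" using q by (simp add: colon_R)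
        then show ?thesis by (simp add: mult.assoc mult.commute mult.left_commute)
      qed
      then show ?thesis by (simp add: colon_J[symmetric] colon_R)
    qed
    then show "q \<in> \<omega>" by (simp add: colon_J'[symmetric] colon_R)
  next
    fix q assume "q \<in> \<omega>"
    then show "q \<in> colon R \<omega> P"
      using D(1) PR by (auto simp: colon_R is_submodule_def mult.commute)
  qed
  have "P \<noteq> {0}"
  proof
    assume "P = {0}"
    then have "\<omega> = UNIV" using colon_P z(1) by (auto simp: colon_R)
    then have "monom_fls (N - 1) \<in> (supported_fls {N..} :: 'k fls set)" using N by blast
    then show False by simp
  qed
  have "P \<subseteq> supported_fls {0..}"
    using PR supported_fls_mono[OF nonneg] unfolding R_def by blast
  have "P = R"
    using D(4)[OF P \<open>P \<noteq> {0}\<close> \<open>P \<subseteq> supported_fls {0..}\<close>] colon_P colon_self_canonical[OF c] by simp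
  have "\<not> A \<subseteq> nonunits R"
  proof
    assume "A \<subseteq> nonunits R"
    then have "P \<subseteq> nonunits R" unfolding P_def using submodule_nonunits by (rule hull_minimal)
    then have "(1 :: 'k fls) \<in> nonunits R" unfolding \<open>P = R\<close> by (rule subsetD) simp
    then have "1 * 1 \<noteq> (1 :: 'k fls)" unfolding nonunits_def mem_Collect_eq using R_1 by metis
    then show False by simp
  qed
  then obtain a where a: "a \<in> A" "a \<notin> nonunits R" by blast
  then obtain v where v: "v \<in> R" "a * v = 1" using AR unfolding nonunits_def by blast
  from a(1) obtain j j' where "j \<in> J" "j' \<in> J'" "a = j * j'" unfolding A_def by blast
  with v have j: "j \<in> J" "j' \<in> J'" "v \<in> R" "j * j' * v = 1" by simp_all
  then have "j \<noteq> 0" by auto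
  \<comment> \<open>Multiplication by \<open>j\<close> takes \<open>\<omega>'\<close> into
    \<open>\<omega>\<close>, and its inverse is multiplication by \<open>v * j'\<close>, which takes
    \<open>\<omega>\<close> into \<open>\<omega>'\<close>.\<close>
  have "\<omega>' = (*) (inverse j) ` \<omega>"
  proof (intro set_eqI iffI)
    fix x assume "x \<in> \<omega>'"
    then have "j * x \<in> \<omega>" "x = inverse j * (j * x)" using J j(1) \<open>j \<noteq> 0\<close> by (simp_all add: field_simps)
    then show "x \<in> (*) (inverse j) ` \<omega>" by blast
  next
    fix x assume "x \<in> (*) (inverse j) ` \<omega>"
    then obtain w where w: "w \<in> \<omega>" "x = inverse j * w" by blast
    have "inverse j = v * j'" using j(4) \<open>j \<noteq> 0\<close> by (simp add: field_simps)
    then have "x = v * (j' * w)" using w(2) by (simp add: mult.assoc)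
    then show "x \<in> \<omega>'" using J'[OF j(2) w(1)] j(3) D'(1) by (simp add: is_submodule_def)
  qed
  then show thesis using that[of "inverse j"] \<open>j \<noteq> 0\<close> by simp
qed

section \<open>Homomorphisms and trace ideals\<close>

text \<open>Any \<open>x\<close> in \<open>M\<close> is commensurable with a fixed nonzero
  \<open>y\<close>: \<open>b * x = a * y\<close> with \<open>a\<close>, \<open>b\<close> in
  \<open>R\<close>. Linearity then gives \<open>\<phi> x / x = \<phi> y / y\<close> for nonzero
  \<open>x\<close>, so the multiplier is \<open>\<phi> y / y\<close>.\<close>

lemma module_homsE:
  assumes M: "is_submodule R (M :: 'k::field fls set)" and \<phi>: "\<phi> \<in> module_homs R M N"
  obtains q where "\<And>x. x \<in> M \<Longrightarrow> \<phi> x = q * x"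
proof (cases "M \<subseteq> {0}")
  case True
  have "0 \<in> M" using M by (simp add: is_submodule_def)
  then have "\<phi> (0 * 0) = 0 * \<phi> 0" using \<phi> R_0 unfolding module_homs_def by blast
  then show thesis using True that[of 0] by auto
next
  case False
  then obtain y where y: "y \<in> M" "y \<noteq> 0" by blast
  have lin: "\<phi> (r * x) = r * \<phi> x" if "r \<in> R" "x \<in> M" for r x
    using \<phi> that by (simp add: module_homs_def)
  have "\<phi> x = \<phi> y / y * x" if x: "x \<in> M" for x
  proof -
    obtain a b where ab: "x / y = a / b" "a \<in> R" "b \<in> R" "b \<noteq> 0"
      using total_fractions_R unfolding total_fractions_def by blast
    then have *: "b * x = a * y" using y(2) by (simp add: field_simps)
    then have "b * \<phi> x = a * \<phi> y" using lin[OF ab(3) x] lin[OF ab(2) y(1)] by simp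
    then have "\<phi> x = (a / b) * \<phi> y" using ab(4) by (simp add: field_simps)
    then show ?thesis by (simp add: ab(1)[symmetric])
  qed
  then show thesis by (rule that)
qed

text \<open>Homomorphisms into \<open>R\<close> are the multiplications by elements of
  \<open>R : M\<close>, so the trace is the product \<open>(R : M) M\<close>.\<close>

lemma trace_ideal_R:
  assumes M: "is_submodule R (M :: 'k::field fls set)"
  shows "trace_ideal R M = is_submodule R hull {q * x | q x. q \<in> colon R R M \<and> x \<in> M}"
proof -
  have "(\<Union>\<phi>\<in>module_homs R M R. \<phi> ` M) = {q * x | q x. q \<in> colon R R M \<and> x \<in> M}"
  proof (intro set_eqI iffI)
    fix z assume "z \<in> (\<Union>\<phi>\<in>module_homs R M R. \<phi> ` M)"
    then obtain \<phi> x where \<phi>: "\<phi> \<in> module_homs R M R" "x \<in> M" "z = \<phi> x" by blast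
    obtain q where q: "\<And>x. x \<in> M \<Longrightarrow> \<phi> x = q * x" using module_homsE[OF M \<phi>(1)] by blast
    then have "q \<in> colon R R M" using \<phi>(1) by (auto simp: colon_R module_homs_def)
    then show "z \<in> {q * x | q x. q \<in> colon R R M \<and> x \<in> M}" using \<phi> q by blast
  next
    fix z assume "z \<in> {q * x | q x. q \<in> colon R R M \<and> x \<in> M}"
    then obtain q x where q: "q \<in> colon R R M" "x \<in> M" "z = q * x" by blast
    then have "(*) q \<in> module_homs R M R"
      by (auto simp: module_homs_def colon_R distrib_left mult.left_commute)
    then show "z \<in> (\<Union>\<phi>\<in>module_homs R M R. \<phi> ` M)" using q by blast
  qed
  then show ?thesis by (simp add: trace_ideal_def)
qed

lemma trace_ideal_scale:
  assumes "is_submodule R (M :: 'k::field fls set)" "is_submodule R ((*) u ` M)" "u \<noteq> 0"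
  shows "trace_ideal R ((*) u ` M) = trace_ideal R M"
proof -
  have "{q * x | q x. q \<in> colon R R ((*) u ` M) \<and> x \<in> (*) u ` M}
      = {q * x | q x. q \<in> colon R R M \<and> x \<in> M}" (is "?A = ?B")
  proof (intro set_eqI iffI)
    fix z assume "z \<in> ?A"
    then obtain q x where q: "\<forall>y\<in>M. q * (u * y) \<in> R" "x \<in> M" "z = q * (u * x)"
      by (auto simp: colon_R)
    then have "q * u \<in> colon R R M" "z = (q * u) * x" by (simp_all add: colon_R mult.assoc)
    then show "z \<in> ?B" using q(2) by blast
  next
    fix z assume "z \<in> ?B"
    then obtain q x where q: "\<forall>y\<in>M. q * y \<in> R" "x \<in> M" "z = q * x" by (auto simp: colon_R)
    then have "q / u \<in> colon R R ((*) u ` M)" "z = (q / u) * (u * x)"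
      using assms(3) by (simp_all add: colon_R)
    then show "z \<in> ?A" using q(2) by blast
  qed
  then show ?thesis using assms by (simp add: trace_ideal_R)
qed

section \<open>The canonical ideal given by K\<close>

definition K :: "int set" where "K = {z. F - z \<notin> S}"

lemma K_nonneg: "z \<in> K \<Longrightarrow> 0 \<le> z"
  using above_F[of "F - z"] by (cases "z < 0") (auto simp: K_def)

lemma zero_in_K: "0 \<in> K"
  using F_notin by (simp add: K_def)

lemma add_in_K: "s \<in> S \<Longrightarrow> z \<in> K \<Longrightarrow> s + z \<in> K"
  using add_in[of "F - (s + z)" s] by (auto simp: K_def)

lemma submodule_K: "is_submodule R (supported_fls K :: 'k::field fls set)"
  by (rule submodule_supported_fls) (rule add_in_K)

text \<open>This is the orthogonal complement of \<open>R\<close> for the pairing by the coefficient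
  at \<open>F\<close>. The monomial with exponent \<open>F - n\<close> detects a forbidden exponent
  \<open>n\<close>.\<close>

lemma supported_K_iff:
  "f \<in> supported_fls K \<longleftrightarrow> (\<forall>r\<in>R. fls_nth (f * r) F = (0 :: 'k::field))"
proof
  assume f: "f \<in> supported_fls K"
  show "\<forall>r\<in>R. fls_nth (f * r) F = 0"
  proof (rule ballI, rule ccontr)
    fix r assume r: "r \<in> R" and "fls_nth (f * r) F \<noteq> 0"
    then obtain i where "fls_nth f i \<noteq> 0" "fls_nth r (F - i) \<noteq> 0" by (blast elim: fls_nth_mult_neq_0E)
    then show False
      using supported_flsD[OF f, of i] r supported_flsD[of r S "F - i"] by (simp add: K_def R_def)
  qed
next
  assume *: "\<forall>r\<in>R. fls_nth (f * r) F = 0"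
  show "f \<in> supported_fls K"
  proof (rule supported_flsI, rule ccontr)
    fix n assume n: "fls_nth f n \<noteq> 0" "n \<notin> K"
    then have "monom_fls (F - n) \<in> (R :: 'k fls set)" by (simp add: R_def K_def)
    then have "fls_nth (f * monom_fls (F - n)) F = 0" using * by blast
    then show False using n(1) by (simp add: fls_nth_mult_monom)
  qed
qed

text \<open>As \<open>I\<close> absorbs the factors from \<open>R\<close>, the colon is the
  orthogonal complement of \<open>I\<close>. Applying it twice is therefore a biduality
  statement.\<close>

lemma colon_K:
  assumes I: "is_submodule R (I :: 'k::field fls set)"
  shows "colon R (supported_fls K) I = {q. \<forall>x\<in>I. fls_nth (q * x) F = 0}"
proof (intro set_eqI iffI)
  fix q assume "q \<in> colon R (supported_fls K) I"
  then have "fls_nth (q * x * 1) F = 0" if "x \<in> I" for x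
    using that R_1 unfolding colon_R mem_Collect_eq supported_K_iff by blast
  then show "q \<in> {q. \<forall>x\<in>I. fls_nth (q * x) F = 0}" by simp
next
  fix q assume q: "q \<in> {q. \<forall>x\<in>I. fls_nth (q * x) F = 0}"
  have "fls_nth (q * x * r) F = 0" if "x \<in> I" "r \<in> R" for x r
  proof -
    have "r * x \<in> I" using I that by (simp add: is_submodule_def)
    then have "fls_nth (q * (r * x)) F = 0" using q by simp
    then show ?thesis by (simp add: mult.assoc mult.commute[of x])
  qed
  then show "q \<in> colon R (supported_fls K) I" by (simp add: colon_R supported_K_iff)
qed

lemma nonzero_submodule_tail:
  assumes I: "is_submodule R (I :: 'k::field fls set)" "I \<noteq> {0}"
  obtains N where "supported_fls {N..} \<subseteq> I"
proof -
  have "0 \<in> I" using I(1) by (simp add: is_submodule_def)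
  then obtain x where x: "x \<in> I" "x \<noteq> 0" using I(2) by blast
  have "f \<in> I" if f: "f \<in> supported_fls {F + 1 + fls_subdegree x..}" for f
  proof -
    have "f / x \<in> supported_fls {F + 1..}"
      using f x(2) by (cases "f = 0") (auto simp: supported_fls_atLeast_iff fls_divide_subdegree)
    then have "f / x \<in> R" using supported_above_F by blast
    then have "f / x * x \<in> I" using I(1) x(1) unfolding is_submodule_def by blast
    then show ?thesis using x(2) by simp
  qed
  then show thesis by (intro that) blast
qed

end

lemma vector_space_fls: "vector_space (\<lambda>c (f :: 'k::field fls). fls_const c * f)"
  by unfold_locales
    (simp_all add: distrib_left distrib_right mult.assoc[symmetric] flip: fls_plus_const)

lemma vector_space_field: "vector_space ((*) :: 'k::field \<Rightarrow> 'k \<Rightarrow> 'k)"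
  by unfold_locales (simp_all add: algebra_simps)

text \<open>A basis of \<open>I\<close> stays independent after adjoining \<open>g\<close>, so
  values on it can be prescribed. No continuity is claimed for \<open>l\<close>.\<close>

lemma ex_separating_functional:
  fixes I :: "'k::field fls set"
  assumes I: "0 \<in> I" "\<And>x y. x \<in> I \<Longrightarrow> y \<in> I \<Longrightarrow> x + y \<in> I" "\<And>c x. x \<in> I \<Longrightarrow> fls_const c * x \<in> I"
    and g: "g \<notin> I"
  shows "\<exists>l :: 'k fls \<Rightarrow> 'k. (\<forall>x y. l (x + y) = l x + l y) \<and> (\<forall>c x. l (fls_const c * x) = c * l x) \<and>
    (\<forall>x\<in>I. l x = 0) \<and> l g = 1"
proof -
  interpret V: vector_space "\<lambda>c (f :: 'k fls). fls_const c * f" by (rule vector_space_fls)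
  interpret W: vector_space "(*) :: 'k \<Rightarrow> 'k \<Rightarrow> 'k" by (rule vector_space_field)
  interpret VW: vector_space_pair "\<lambda>c (f :: 'k fls). fls_const c * f" "(*) :: 'k \<Rightarrow> 'k \<Rightarrow> 'k" ..
  have sub: "V.subspace I" using I by (simp add: V.subspace_def)
  obtain B where B: "B \<subseteq> I" "V.independent B" "I \<subseteq> V.span B"
    by (rule V.maximal_independent_subset)
  have "V.span B \<subseteq> I" using V.span_minimal[OF B(1) sub] .
  then have "V.independent (insert g B)" using g B by (auto simp: V.independent_insert)
  from VW.linear_independent_extend[OF this, of "\<lambda>x. if x = g then 1 else 0"]
  obtain l where l: "Vector_Spaces.linear (\<lambda>c (f :: 'k fls). fls_const c * f) (*) l"
    "\<forall>x\<in>insert g B. l x = (if x = g then 1 else 0)" by blast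
  interpret l: Vector_Spaces.linear "\<lambda>c (f :: 'k fls). fls_const c * f" "(*) :: 'k \<Rightarrow> 'k \<Rightarrow> 'k" l by (rule l(1))
  have "l x = 0" if "x \<in> B" for x using l(2) that g B(1) by auto
  then have "l x = 0" if "x \<in> I" for x
    using l.eq_0_on_span[of B x] that B(3) by blast
  then show ?thesis using l.add l.scale l(2) by (intro exI[of _ l]) auto
qed

context numerical_set begin

text \<open>If \<open>g\<close> were in the double complement but not in \<open>I\<close>, a
  functional \<open>l\<close> would vanish on \<open>I\<close> with \<open>l g = 1\<close>. It also
  vanishes on the tail \<open>supported_fls {N..}\<close> inside \<open>I\<close>, so on
  \<open>I\<close> and at \<open>g\<close> it is the pairing with a Laurent polynomial
  \<open>q\<close>. Then \<open>q\<close> is orthogonal to \<open>I\<close> but not to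
  \<open>g\<close>.\<close>

lemma canonical_ideal_K: "canonical_ideal R (supported_fls K :: 'k::field fls set)"
  unfolding canonical_ideal_def fractional_ideal_iff
proof (intro conjI allI impI)
  show "is_submodule R (supported_fls K :: 'k fls set)" by (rule submodule_K)
  show "supported_fls K \<noteq> {0 :: 'k fls}"
    using supported_fls_1[OF zero_in_K] by (metis singletonD zero_neq_one)
  show "\<exists>N. supported_fls K \<subseteq> (supported_fls {N..} :: 'k fls set)"
    by (intro exI[of _ 0] supported_fls_mono) (auto intro: K_nonneg)
  fix I :: "'k fls set"
  assume I: "is_submodule R I \<and> I \<noteq> {0} \<and> (\<exists>N. I \<subseteq> supported_fls {N..})"
  define L where "L = colon R (supported_fls K) I"
  have L: "q \<in> L \<longleftrightarrow> (\<forall>x\<in>I. fls_nth (q * x) F = 0)" for q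
    using I by (simp add: L_def colon_K)
  have "is_submodule R L" unfolding L_def by (rule submodule_colon[OF submodule_K])
  then have LL: "g \<in> colon R (supported_fls K) L \<longleftrightarrow> (\<forall>q\<in>L. fls_nth (g * q) F = 0)" for g
    by (simp add: colon_K)
  have "colon R (supported_fls K) L = I"
  proof (intro set_eqI iffI)
    fix g assume "g \<in> I"
    then show "g \<in> colon R (supported_fls K) L" by (simp add: LL L mult.commute)
  next
    fix g assume g: "g \<in> colon R (supported_fls K) L"
    show "g \<in> I"
    proof (rule ccontr)
      assume "g \<notin> I"
      have I': "0 \<in> I" "\<And>x y. x \<in> I \<Longrightarrow> y \<in> I \<Longrightarrow> x + y \<in> I"
        "\<And>c x. x \<in> I \<Longrightarrow> fls_const c * x \<in> I"
        using I R_const unfolding is_submodule_def by simp_all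
      obtain l :: "'k fls \<Rightarrow> 'k" where l: "\<And>x y. l (x + y) = l x + l y"
        "\<And>c x. l (fls_const c * x) = c * l x" "\<And>x. x \<in> I \<Longrightarrow> l x = 0" "l g = 1"
        using ex_separating_functional[OF I' \<open>g \<notin> I\<close>] by blast
      have l_sum: "l (\<Sum>i\<in>A. f i) = (\<Sum>i\<in>A. l (f i))" for f and A :: "int set"
        using l(1) l(2)[of 0 0] by (induction A rule: infinite_finite_induct) auto
      obtain N where N: "supported_fls {N..} \<subseteq> I" using nonzero_submodule_tail I by blast
      obtain N' where N': "I \<subseteq> supported_fls {N'..}" using I by blast
      define M where "M = min N' (fls_subdegree g)"
      have M: "x \<in> supported_fls {M..}" if "x \<in> insert g I" for x
      proof (cases "x = g")
        case True
        then show ?thesis by (simp add: M_def supported_fls_atLeast_iff)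
      next
        case False
        then show ?thesis
          using that N' supported_fls_mono[of "{N'..}" "{M..}"] by (auto simp: M_def)
      qed
      \<comment> \<open>The coefficient of \<open>q * x\<close> at \<open>F\<close> is the sum of
        \<open>fls_nth x i * l (monom_fls i)\<close> over \<open>M \<le> i < N\<close>: below
        \<open>M\<close> the relevant \<open>x\<close> have no terms, and from \<open>N\<close> on
        \<open>l\<close> vanishes.\<close>
      define q where "q = (\<Sum>i\<in>{M..<N}. fls_const (l (monom_fls i)) * monom_fls (F - i))"
      have q: "fls_nth (q * x) F = l x" if x: "x \<in> insert g I" for x
      proof -
        define y where "y = (\<Sum>i\<in>{M..<N}. fls_const (fls_nth x i) * monom_fls i)"
        have y_nth: "fls_nth y n = (if n \<in> {M..<N} then fls_nth x n else 0)" for n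
          by (simp add: y_def fls_nth_sum if_distrib[of "(*) _"] cong: if_cong)
        have "x - y \<in> supported_fls {N..}"
        proof (rule supported_flsI)
          fix n assume n: "fls_nth (x - y) n \<noteq> 0"
          show "n \<in> {N..}"
          proof (rule ccontr)
            assume "n \<notin> {N..}"
            then have "n < M" "fls_nth x n \<noteq> 0" using n y_nth[of n] by (auto split: if_splits)
            then show False using supported_flsD[OF M[OF x], of n] by simp
          qed
        qed
        then have "l (x - y) = 0" using N l(3) by blast
        then have "l x = l y" using l(1)[of "x - y" y] by simp
        also have "\<dots> = (\<Sum>i\<in>{M..<N}. fls_nth x i * l (monom_fls i))"
          by (simp add: y_def l_sum l(2))
        also have "\<dots> = fls_nth (q * x) F"
          unfolding q_def sum_distrib_right fls_nth_sum
          by (rule sum.cong) (simp_all add: mult.assoc fls_nth_mult_monom mult.commute[of "fls_nth x _"])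
        finally show ?thesis by simp
      qed
      have "q \<in> L" using q l(3) by (simp add: L)
      then have "fls_nth (g * q) F = 0" using g LL by blast
      then have "fls_nth (q * g) F = 0" by (simp add: mult.commute)
      then show False using q[of g] l(4) by simp
    qed
  qed
  then show "colon R (supported_fls K) (colon R (supported_fls K) I) = I" by (simp add: L_def)
qed

section \<open>The trace criterion in terms of gaps\<close>

text \<open>Canonical ideals differ by a scalar factor, which the trace ignores; so the existential
  over \<open>\<omega>\<close> may be tested on \<open>K\<close>.\<close>

lemma far_flung_iff_trace:
  "far_flung_gorenstein (R :: 'k::field fls set) \<longleftrightarrow>
    trace_ideal R (supported_fls K :: 'k fls set) = colon R R (int_closure R)"
proof
  assume "far_flung_gorenstein (R :: 'k fls set)"
  then obtain \<omega> :: "'k fls set" where \<omega>: "canonical_ideal R \<omega>"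
    "trace_ideal R \<omega> = colon R R (int_closure R)"
    by (auto simp: far_flung_gorenstein_def)
  obtain u where "u \<noteq> 0" "\<omega> = (*) u ` supported_fls K"
    using canonical_ideal_unique[OF canonical_ideal_K \<omega>(1)] by blast
  then have "trace_ideal R \<omega> = trace_ideal R (supported_fls K)"
    using trace_ideal_scale[OF submodule_K] canonical_idealD(1)[OF \<omega>(1)] by simp
  then show "trace_ideal R (supported_fls K :: 'k fls set) = colon R R (int_closure R)"
    using \<omega>(2) by simp
qed (auto simp: far_flung_gorenstein_def intro: canonical_ideal_K)

lemma far_flung_iff_gap_sums_cover:
  "far_flung_gorenstein (R :: 'k::field fls set) \<longleftrightarrow> gap_sums_cover S"
proof -
  define T where "T = {z. \<forall>b\<in>K. z + b \<in> S}"
  have T: "colon R R (supported_fls K) = (supported_fls T :: 'k fls set)"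
    unfolding colon_R T_def by (simp add: R_def colon_supported_fls)
  have "(\<forall>b\<in>{0..}. z + b \<in> S) \<longleftrightarrow> F < z" for z
  proof
    assume *: "\<forall>b\<in>{0..}. z + b \<in> S"
    show "F < z"
    proof (rule ccontr)
      assume "\<not> F < z"
      then have "z + (F - z) \<in> S" by (intro bspec[OF *]) simp
      then show False using F_notin by simp
    qed
  qed (simp add: above_F)
  then have "{z. \<forall>b\<in>{0..}. z + b \<in> S} = {F<..}" by auto
  then have C: "colon R R (int_closure R) = (supported_fls {F<..} :: 'k fls set)"
    unfolding colon_R int_closure_R by (simp add: R_def colon_supported_fls)
  define A where "A = {q * x | q x. q \<in> (supported_fls T :: 'k fls set) \<and> x \<in> supported_fls K}"
  have trace: "trace_ideal R (supported_fls K) = is_submodule R hull A"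
    by (simp add: trace_ideal_R[OF submodule_K] T A_def)
  have one: "q \<in> is_submodule R hull A" if "q \<in> supported_fls T" for q
  proof -
    have "q * 1 \<in> A" using that supported_fls_1[OF zero_in_K] unfolding A_def by blast
    then show ?thesis by (simp add: hull_inc)
  qed
  have "is_submodule R hull A = supported_fls {F<..} \<longleftrightarrow> gap_sums_cover S"
  proof
    assume eq: "is_submodule R hull A = supported_fls {F<..}"
    have TF: "z > F" if "z \<in> T" for z
      using one[of "monom_fls z"] that by (simp add: eq)
    have "\<exists>y z. y \<notin> S \<and> z \<notin> S \<and> n = (F - y) + (F - z)" if "0 \<le> n" for n
    proof -
      \<comment> \<open>Failure of membership in \<open>T\<close> is a representation as a sum:
        \<open>F - n + b\<close> being a gap, with \<open>F - b\<close> a gap too, writes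
        \<open>n\<close> as \<open>b\<close> plus an element of \<open>K\<close>.\<close>
      have "F - n \<notin> T" using TF[of "F - n"] that by auto
      then obtain b where "b \<in> K" "F - n + b \<notin> S" by (auto simp: T_def)
      then show ?thesis by (intro exI[of _ "F - b"] exI[of _ "F - n + b"]) (simp add: K_def)
    qed
    then show "gap_sums_cover S"
      unfolding gap_sums_cover_def using F_notin above_F by blast
  next
    assume "gap_sums_cover S"
    then obtain F' where F': "F' \<notin> S" "\<forall>z>F'. z \<in> S"
      "\<And>n. 0 \<le> n \<Longrightarrow> \<exists>y z. y \<notin> S \<and> z \<notin> S \<and> n = (F' - y) + (F' - z)"
      unfolding gap_sums_cover_def by blast
    have "F' = F" using F'(1,2) F_notin above_F[of F'] by (cases F' F rule: linorder_cases) auto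
    have "T = {F<..}"
    proof (intro set_eqI iffI)
      fix z assume z: "z \<in> T"
      show "z \<in> {F<..}"
      proof (rule ccontr)
        assume "z \<notin> {F<..}"
        then obtain y y' where y: "y \<notin> S" "y' \<notin> S" "F - z = (F - y) + (F - y')"
          using F'(3)[of "F - z"] \<open>F' = F\<close> by auto
        then have "z + (F - y) \<in> S" using z by (auto simp: T_def K_def)
        moreover have "z + (F - y) = y'" using y(3) by linarith
        ultimately show False using y(2) by simp
      qed
    next
      fix z assume "z \<in> {F<..}"
      then show "z \<in> T" unfolding T_def by (auto intro!: above_F dest: K_nonneg)
    qed
    show "is_submodule R hull A = supported_fls {F<..}"
    proof
      show "is_submodule R hull A \<subseteq> supported_fls {F<..}"
      proof (rule hull_minimal)
        show "A \<subseteq> supported_fls {F<..}"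
          unfolding A_def \<open>T = {F<..}\<close> by (auto intro!: supported_fls_mult dest: K_nonneg)
        show "is_submodule R (supported_fls {F<..})"
          by (rule submodule_supported_fls) (auto dest: nonneg')
      qed
      show "supported_fls {F<..} \<subseteq> is_submodule R hull A"
        using one \<open>T = {F<..}\<close> by blast
    qed
  qed
  then show ?thesis by (simp add: far_flung_iff_trace trace C)
qed


section \<open>Cohen-Macaulay type and pseudo-Frobenius numbers\<close>

lemma finite_pseudo_frobenius: "finite (pseudo_frobenius S)"
proof (rule finite_subset)
  show "pseudo_frobenius S \<subseteq> {- \<bar>F\<bar> - 1..F}"
  proof
    fix p assume p: "p \<in> pseudo_frobenius S"
    \<comment> \<open>The absolute value keeps this element of \<open>S\<close> nonzero;
      \<open>F + 1\<close> would be 0 for \<open>F = -1\<close>.\<close>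
    have "\<bar>F\<bar> + 1 \<in> S" by (rule above_F) simp
    then have "p + (\<bar>F\<bar> + 1) \<in> S" using p by (simp add: pseudo_frobenius_def)
    then have "0 \<le> p + (\<bar>F\<bar> + 1)" by (rule nonneg')
    moreover have "p \<le> F" using p above_F[of p] by (auto simp: pseudo_frobenius_def not_le[symmetric])
    ultimately show "p \<in> {- \<bar>F\<bar> - 1..F}" by simp
  qed
qed simp

lemma colon_nonunits:
  "(\<forall>y\<in>nonunits R. z * y \<in> R) \<longleftrightarrow> z \<in> (supported_fls (S \<union> pseudo_frobenius S) :: 'k::field fls set)"
proof -
  have "{z. \<forall>b\<in>S - {0}. z + b \<in> S} = S \<union> pseudo_frobenius S"
    by (auto simp: pseudo_frobenius_def intro: add_in)
  then show ?thesis unfolding nonunits_R by (simp add: R_def colon_supported_fls)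
qed

lemma const_nonunits: "fls_const c \<in> (nonunits R :: 'k::field fls set) \<longleftrightarrow> c = 0"
  by (auto simp: nonunits_R supported_fls_def)

lemma minus_const_nonunits:
  "r \<in> R \<Longrightarrow> r - fls_const (fls_nth r 0) \<in> (nonunits R :: 'k::field fls set)"
  unfolding nonunits_R by (rule supported_flsI) (auto simp: R_def dest: supported_flsD split: if_splits)

text \<open>Dividing by the parameter turns the socle of \<open>R/aR\<close> into \<open>(R : \<mm>)/R\<close>, which has the
  monomials with pseudo-Frobenius exponents as a basis.\<close>

lemma cm_type_eq_card_pseudo_frobenius:
  assumes "has_cm_type (R :: 'k::field fls set) n"
  shows "card (pseudo_frobenius S) = n"
proof -
  let ?P = "pseudo_frobenius S"
  obtain a :: "'k fls" where a: "a \<in> nonunits R" "a \<noteq> 0"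
    "has_residue_dim R {x \<in> R. \<forall>y\<in>nonunits R. x * y \<in> (*) a ` R} ((*) a ` R) n"
    using assms unfolding has_cm_type_def by blast
  define N where "N = {x \<in> R. \<forall>y\<in>nonunits R. x * y \<in> (*) a ` R}"
  have aR: "x \<in> (*) a ` R \<longleftrightarrow> x / a \<in> R" for x
  proof
    show "x / a \<in> R" if "x \<in> (*) a ` R" using that a(2) by auto
    show "x \<in> (*) a ` R" if "x / a \<in> R"
      using that a(2) by (intro image_eqI[of _ _ "x / a"]) simp_all
  qed
  \<comment> \<open>Division by \<open>a\<close> turns the socle condition into membership in
    \<open>R : m\<close>, with \<open>m\<close> the maximal ideal; \<open>x\<close> itself is then
    in \<open>R\<close> because \<open>a\<close> lies in \<open>m\<close>.\<close>
  have N: "x \<in> N \<longleftrightarrow> x / a \<in> supported_fls (S \<union> ?P)" for x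
  proof -
    have "x \<in> N \<longleftrightarrow> x \<in> R \<and> (\<forall>y\<in>nonunits R. x / a * y \<in> R)"
      by (simp add: N_def aR)
    moreover have "x \<in> R" if "\<forall>y\<in>nonunits R. x / a * y \<in> R"
      using bspec[OF that a(1)] a(2) by simp
    ultimately show ?thesis unfolding colon_nonunits by argo
  qed
  obtain B where B': "finite B \<and> card B = n \<and> B \<subseteq> N \<and>
     (\<forall>x\<in>N. \<exists>c. c ` B \<subseteq> R \<and> x - (\<Sum>b\<in>B. c b * b) \<in> (*) a ` R) \<and>
     (\<forall>c. c ` B \<subseteq> R \<and> (\<Sum>b\<in>B. c b * b) \<in> (*) a ` R \<longrightarrow> c ` B \<subseteq> nonunits R)"
    using a(3) unfolding has_residue_dim_def N_def[symmetric] by (elim exE)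
  then have B: "finite B" "card B = n" "B \<subseteq> N"
    "\<And>x. x \<in> N \<Longrightarrow> \<exists>c. c ` B \<subseteq> R \<and> x - (\<Sum>b\<in>B. c b * b) \<in> (*) a ` R"
    "\<And>c. c ` B \<subseteq> R \<Longrightarrow> (\<Sum>b\<in>B. c b * b) \<in> (*) a ` R \<Longrightarrow> c ` B \<subseteq> nonunits R"
    by simp_all
  \<comment> \<open>\<open>\<pi>\<close> keeps the coefficients at pseudo-Frobenius exponents. On
    \<open>R : m\<close> its kernel is \<open>R\<close>, so it identifies the quotient with a
    coordinate space over the base field.\<close>
  define \<pi> :: "'k fls \<Rightarrow> 'k fls"
    where "\<pi> f = (\<Sum>p\<in>?P. fls_const (fls_nth f p) * monom_fls p)" for f
  have \<pi>_nth: "fls_nth (\<pi> f) i = (if i \<in> ?P then fls_nth f i else 0)" for f i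
    using finite_pseudo_frobenius
    by (simp add: \<pi>_def fls_nth_sum if_distrib[of "(*) _"] cong: if_cong)
  have \<pi>_add: "\<pi> (f + g) = \<pi> f + \<pi> g" for f g by (rule fls_eqI) (simp add: \<pi>_nth)
  have \<pi>_scale: "\<pi> (fls_const c * f) = fls_const c * \<pi> f" for c f by (rule fls_eqI) (simp add: \<pi>_nth)
  have \<pi>_sum: "\<pi> (sum f A) = (\<Sum>i\<in>A. \<pi> (f i))" for f and A :: "'k fls set"
    by (rule fls_eqI) (simp add: \<pi>_nth fls_nth_sum)
  have \<pi>_R: "\<pi> f = 0" if "f \<in> R" for f
    using that by (intro fls_eqI) (auto simp: \<pi>_nth R_def pseudo_frobenius_def dest: supported_flsD)
  have R_if: "f \<in> R" if "f \<in> supported_fls (S \<union> ?P)" "\<pi> f = 0" for f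
    unfolding R_def
  proof (rule supported_flsI)
    fix i assume i: "fls_nth f i \<noteq> 0"
    then have "i \<notin> ?P" using \<pi>_nth[of f i] that(2) by auto
    then show "i \<in> S" using supported_flsD[OF that(1) i] by blast
  qed
  define h where "h b = \<pi> (b / a)" for b
  have indep: "\<kappa> b = 0" if "(\<Sum>b\<in>B. fls_const (\<kappa> b) * h b) = 0" "b \<in> B" for \<kappa> b
  proof -
    let ?y = "\<Sum>b\<in>B. fls_const (\<kappa> b) * b"
    have y_a: "?y / a = (\<Sum>b\<in>B. fls_const (\<kappa> b) * (b / a))" by (simp add: sum_divide_distrib)
    have "?y / a \<in> supported_fls (S \<union> ?P)"
      unfolding y_a using B(3) N by (intro supported_fls_sum supported_fls_const_mult) blast
    moreover have "\<pi> (?y / a) = 0" unfolding y_a \<pi>_sum \<pi>_scale using that(1) by (simp add: h_def)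
    ultimately have "?y \<in> (*) a ` R" unfolding aR by (rule R_if)
    then have "(\<lambda>b. fls_const (\<kappa> b)) ` B \<subseteq> nonunits R" by (intro B(5)) auto
    then show ?thesis using that(2) by (auto simp: const_nonunits)
  qed
  have inj: "inj_on h B"
  proof (rule inj_onI, rule ccontr)
    fix b c assume bc: "b \<in> B" "c \<in> B" "h b = h c" "b \<noteq> c"
    define \<kappa> :: "'k fls \<Rightarrow> 'k" where "\<kappa> d = (if d = b then 1 else if d = c then -1 else 0)" for d
    have "(\<Sum>d\<in>B. fls_const (\<kappa> d) * h d) = (\<Sum>d\<in>{b, c}. fls_const (\<kappa> d) * h d)"
      using B(1) bc by (intro sum.mono_neutral_right) (auto simp: \<kappa>_def)
    also have "\<dots> = 0"
    proof -
      have "fls_const (-1) = (-1 :: 'k fls)" by (rule fls_eqI) simp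
      then show ?thesis using bc(3,4) by (simp add: \<kappa>_def)
    qed
    finally have "\<kappa> b = 0" using bc(1) by (rule indep)
    then show False by (simp add: \<kappa>_def)
  qed
  interpret V: vector_space "\<lambda>c (f :: 'k fls). fls_const c * f" by (rule vector_space_fls)
  have "V.independent (h ` B)"
  proof (rule V.independent_if_scalars_zero)
    fix f :: "'k fls \<Rightarrow> 'k" and x assume f: "(\<Sum>x\<in>h ` B. fls_const (f x) * x) = 0" "x \<in> h ` B"
    then show "f x = 0" using indep[of "\<lambda>b. f (h b)"] by (auto simp: sum.reindex[OF inj])
  qed (use B(1) in simp)
  moreover have "V.independent (monom_fls ` ?P)"
  proof (rule V.independent_if_scalars_zero)
    fix f :: "'k fls \<Rightarrow> 'k" and x assume f: "(\<Sum>x\<in>monom_fls ` ?P. fls_const (f x) * x) = 0" "x \<in> (monom_fls ` ?P :: 'k fls set)"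
    then obtain p where p: "p \<in> ?P" "x = monom_fls p" by blast
    have inj: "inj_on (monom_fls :: int \<Rightarrow> 'k fls) ?P"
      by (rule inj_onI) (metis monom_fls_nth zero_neq_one)
    have "0 = fls_nth (\<Sum>x\<in>monom_fls ` ?P. fls_const (f x) * x) p" by (simp add: f(1))
    also have "\<dots> = f x"
      using finite_pseudo_frobenius p
      by (simp add: sum.reindex[OF inj] fls_nth_sum if_distrib[of "(*) _"] cong: if_cong)
    finally show "f x = 0" by simp
  qed (use finite_pseudo_frobenius in simp)
  moreover have "V.span (h ` B) = V.span (monom_fls ` ?P)"
  proof (rule V.span_eq[THEN iffD2], intro conjI subsetI)
    fix x assume "x \<in> h ` B"
    then obtain b where "x = h b" by blast
    moreover have "h b \<in> V.span (monom_fls ` ?P)"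
      unfolding h_def \<pi>_def by (rule V.span_sum, rule V.span_scale, rule V.span_base, rule imageI)
    ultimately show "x \<in> V.span (monom_fls ` ?P)" by simp
  next
    fix x :: "'k fls" assume "x \<in> monom_fls ` ?P"
    then obtain p where p: "p \<in> ?P" "x = monom_fls p" by blast
    have "a * x \<in> N" using a(2) p by (simp add: N)
    then obtain c where c: "c ` B \<subseteq> R" "a * x - (\<Sum>b\<in>B. c b * b) \<in> (*) a ` R" using B(4) by blast
    \<comment> \<open>Modulo \<open>R\<close>, a coefficient \<open>c b\<close> acts on
      \<open>b / a\<close> through its constant term, since the rest lies in \<open>m\<close> and
      \<open>b / a\<close> in \<open>R : m\<close>. This turns combinations over \<open>R\<close>
      into linear combinations over the base field.\<close>
    have term_eq: "\<pi> (c b * b / a) = fls_const (fls_nth (c b) 0) * h b" if b: "b \<in> B" for b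
    proof -
      have "(c b - fls_const (fls_nth (c b) 0)) \<in> nonunits R"
        using c(1) b by (intro minus_const_nonunits) blast
      moreover have "b / a \<in> supported_fls (S \<union> ?P)" using B(3) b N by blast
      ultimately have "b / a * (c b - fls_const (fls_nth (c b) 0)) \<in> R"
        unfolding colon_nonunits[symmetric] by blast
      then have "\<pi> (b / a * (c b - fls_const (fls_nth (c b) 0)) + fls_const (fls_nth (c b) 0) * (b / a))
          = fls_const (fls_nth (c b) 0) * h b"
        by (simp only: \<pi>_add \<pi>_R \<pi>_scale h_def add_0_left)
      moreover have "b / a * (c b - fls_const (fls_nth (c b) 0)) + fls_const (fls_nth (c b) 0) * (b / a)
          = c b * b / a"
        by (simp add: algebra_simps)
      ultimately show ?thesis by simp
    qed
    have "(a * x - (\<Sum>b\<in>B. c b * b)) / a \<in> R" using c(2) by (simp add: aR)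
    then have "\<pi> ((a * x - (\<Sum>b\<in>B. c b * b)) / a + (\<Sum>b\<in>B. c b * b / a)) = (\<Sum>b\<in>B. \<pi> (c b * b / a))"
      by (simp add: \<pi>_add \<pi>_R \<pi>_sum)
    moreover have "(a * x - (\<Sum>b\<in>B. c b * b)) / a + (\<Sum>b\<in>B. c b * b / a) = x"
      using a(2) by (simp add: diff_divide_distrib sum_divide_distrib)
    moreover have "\<pi> x = x" using p by (intro fls_eqI) (auto simp: \<pi>_nth)
    ultimately have "x = (\<Sum>b\<in>B. fls_const (fls_nth (c b) 0) * h b)" using term_eq by simp
    moreover have "(\<Sum>b\<in>B. fls_const (fls_nth (c b) 0) * h b) \<in> V.span (h ` B)"
      by (rule V.span_sum, rule V.span_scale, rule V.span_base, rule imageI)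
    ultimately show "x \<in> V.span (h ` B)" by simp
  qed
  ultimately have "card (h ` B) = card (monom_fls ` ?P :: 'k fls set)"
    using V.dim_eq_card[of "h ` B" "monom_fls ` ?P"] V.dim_eq_card_independent by simp
  also have "\<dots> = card ?P"
    by (intro card_image inj_onI) (metis monom_fls_nth zero_neq_one)
  finally show ?thesis using card_image[OF inj] B(2) by simp
qed

end

section \<open>From semigroups of naturals to the theorem\<close>

lemma semigroup_ring_eq: "semigroup_ring H = (supported_fls (int ` H) :: 'k::field fls set)"
proof (intro set_eqI iffI)
  fix f :: "'k fls" assume "f \<in> semigroup_ring H"
  then show "f \<in> supported_fls (int ` H)"
    by (auto simp: semigroup_ring_def supported_fls_def split: if_splits intro!: image_eqI[of _ _ "nat _"])
next
  fix f :: "'k fls" assume f: "f \<in> supported_fls (int ` H)"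
  moreover have "int ` H \<subseteq> {0..}" by auto
  ultimately have "f \<in> supported_fls {0..}" using supported_fls_mono by blast
  then have "0 \<le> fls_subdegree f" by (auto simp: supported_fls_atLeast_iff)
  then have "f = fps_to_fls (fls_regpart f)" by simp
  moreover have "n \<in> H" if "fps_nth (fls_regpart f) n \<noteq> 0" for n
    using that supported_flsD[OF f, of "int n"] by auto
  ultimately show "f \<in> semigroup_ring H" unfolding semigroup_ring_def by blast
qed

lemma numerical_set_int:
  assumes "numerical_semigroup H"
  obtains F where "numerical_set (int ` H) F"
proof -
  have H: "0 \<in> H" "\<And>a b. a \<in> H \<Longrightarrow> b \<in> H \<Longrightarrow> a + b \<in> H" "finite (- H)"
    using assms by (auto simp: numerical_semigroup_def add_submonoid_def)
  \<comment> \<open>Inserting -1 keeps the maximum defined when there are no gaps, and gives the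
    conventional value -1 of the Frobenius number in that case.\<close>
  define G where "G = insert (-1) (int ` (- H))"
  have G: "finite G" "G \<noteq> {}" using H(3) by (simp_all add: G_def)
  have "Max G \<in> G" using Max_in[OF G] .
  show thesis
  proof (rule that[of "Max G"], unfold_locales)
    show "add_submonoid (int ` H)"
      unfolding add_submonoid_def using H(1,2) by (auto simp: image_iff of_nat_add[symmetric] simp del: of_nat_add)
    show "int ` H \<subseteq> {0..}" by auto
    show "Max G \<notin> int ` H" using \<open>Max G \<in> G\<close> by (auto simp: G_def)
    fix z assume z: "Max G < z"
    then have "z \<notin> G" using Max_ge[OF G(1)] by (meson linorder_not_less)
    moreover have "-1 \<le> Max G" using G(1) by (intro Max_ge) (simp_all add: G_def)
    ultimately show "z \<in> int ` H"
      using z by (cases z rule: int_cases2) (auto simp: G_def)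
  qed
qed

theorem theorem2p1:
  fixes H :: "nat set"
  assumes "numerical_semigroup H"
    and "has_cm_type (semigroup_ring H :: 'k::field fls set) 4"
  shows "far_flung_gorenstein (semigroup_ring H :: 'k fls set) \<longleftrightarrow> ffg_type4_family (int ` H)"
proof -
  obtain F where "numerical_set (int ` H) F" using assms(1) by (rule numerical_set_int)
  then interpret numerical_set "int ` H" F .
  have R: "semigroup_ring H = (R :: 'k fls set)" by (simp add: R_def semigroup_ring_eq)
  have "card (pseudo_frobenius (int ` H)) = 4"
    using cm_type_eq_card_pseudo_frobenius assms(2) unfolding R by blast
  then have "gap_sums_cover (int ` H) \<longleftrightarrow> ffg_type4_family (int ` H)"
    using ffg_type4_familyI[OF submonoid nonneg] gap_sums_cover_ffg_type4_family by blast
  then show ?thesis by (simp add: R far_flung_iff_gap_sums_cover)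
qed

end
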